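(* Let $A\in\mathbb{R}^{n\times n}$ be the random symmetric matrix with $A_{ii}=0$ and $A_{ij}=A_{ji}=g_{ij}/\sqrt{n}$ for $i<j$. For every $0\le\beta<1$ there exists a constant $C(\beta)<\infty$ such that for all $n\ge1$, $$\mathbb{E}\Big[\Big\|\big((1+\beta^2)I-\beta A\big)\,\mathrm{cov}(\mu)-I\Big\|_F^2\Big]\le C(\beta),$$ where $\mu$ is the Sherrington--Kirkpatrick Gibbs measure on $\{-1,+1\}^n$ at inverse temperature $\beta$ with disorder $(g_{ij})$ and no external field, and $I$ is the $n\times n$ identity matrix. In particular, for all $i\ne j$ in $\{1,\dots,n\}$, $$\mathbb{E}\Big[\Big((1+\beta^2)\langle\sigma_i\sigma_j\rangle-\frac{\beta}{\sqrt{n}}\sum_{k=1}^n g_{ik}\langle\sigma_k\sigma_j\rangle\Big)^2\Big]\le\frac{C(\beta)}{n^2}.$$ (The constant $C(\beta)$ depends only on $\beta$ and may differ between the two displays.)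
   Context: Let $(g_{ij})_{1\le i<j\le n}$ be i.i.d. standard Gaussian $N(0,1)$ random variables (the disorder), and set $g_{ji}=g_{ij}$ for $i<j$ and $g_{ii}=0$. Let $\beta \ge 0$. The Sherrington--Kirkpatrick Gibbs measure (no external field) is the random probability measure on $\{-1,+1\}^n$ $$\mu(\sigma) = \frac{1}{Z}\exp\Big\{\frac{\beta}{\sqrt{n}}\sum_{i<j} g_{ij}\sigma_i\sigma_j\Big\},\qquad \sigma\in\{-1,+1\}^n,$$ with $Z$ the normalizing constant. The bracket $\langle\cdot\rangle$ denotes the average with respect to $\mu$ (for fixed disorder). The covariance matrix is the $n\times n$ random matrix $\mathrm{cov}(\mu)$ with entries $(\mathrm{cov}(\mu))_{ij} = \langle \sigma_i\sigma_j\rangle$ for $i,j\in\{1,\dots,n\}$ (the mean of $\mu$ is zero by symmetry). $\|\cdot\|_F$ is the Frobenius norm, and $\mathbb{E}$ is the expectation over the disorder $(g_{ij})$. *)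

theory Defs
  imports "HOL-Probability.Probability" "Jordan_Normal_Form.Matrix"
begin

text \<open>
  The indices 1, ..., n of the spins are rendered as 0, ..., n - 1.  A realisation of the disorder
  is an array G; outside the locale \<open>sk_disorder\<close> it is deterministic.
\<close>

definition spin_configs :: "nat \<Rightarrow> (nat \<Rightarrow> real) set" where
  "spin_configs n = {..<n} \<rightarrow>\<^sub>E {-1, 1}"

definition sk_weight :: "nat \<Rightarrow> real \<Rightarrow> (nat \<Rightarrow> nat \<Rightarrow> real) \<Rightarrow> (nat \<Rightarrow> real) \<Rightarrow> real" where
  "sk_weight n \<beta> G \<sigma> = exp (\<beta> / sqrt (real n) * (\<Sum>j<n. \<Sum>i<j. G i j * \<sigma> i * \<sigma> j))"

definition sk_partition :: "nat \<Rightarrow> real \<Rightarrow> (nat \<Rightarrow> nat \<Rightarrow> real) \<Rightarrow> real" where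
  "sk_partition n \<beta> G = (\<Sum>\<sigma>\<in>spin_configs n. sk_weight n \<beta> G \<sigma>)"

definition sk_gibbs :: "nat \<Rightarrow> real \<Rightarrow> (nat \<Rightarrow> nat \<Rightarrow> real) \<Rightarrow> (nat \<Rightarrow> real) measure" where
  "sk_gibbs n \<beta> G =
     point_measure (spin_configs n) (\<lambda>\<sigma>. ennreal (sk_weight n \<beta> G \<sigma> / sk_partition n \<beta> G))"

definition sk_avg ::
    "nat \<Rightarrow> real \<Rightarrow> (nat \<Rightarrow> nat \<Rightarrow> real) \<Rightarrow> ((nat \<Rightarrow> real) \<Rightarrow> real) \<Rightarrow> real" where
  "sk_avg n \<beta> G f = (\<integral>\<sigma>. f \<sigma> \<partial>sk_gibbs n \<beta> G)"

text \<open>No centring is needed: the Gibbs measure is invariant under a global spin flip.\<close>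

definition sk_cov :: "nat \<Rightarrow> real \<Rightarrow> (nat \<Rightarrow> nat \<Rightarrow> real) \<Rightarrow> real mat" where
  "sk_cov n \<beta> G = mat n n (\<lambda>(i, j). sk_avg n \<beta> G (\<lambda>\<sigma>. \<sigma> i * \<sigma> j))"

definition sk_matrix :: "nat \<Rightarrow> (nat \<Rightarrow> nat \<Rightarrow> real) \<Rightarrow> real mat" where
  "sk_matrix n G = mat n n (\<lambda>(i, j). G i j / sqrt (real n))"

definition frobenius_norm :: "real mat \<Rightarrow> real" where
  "frobenius_norm A = sqrt (\<Sum>i<dim_row A. \<Sum>j<dim_col A. (A $$ (i, j))\<^sup>2)"

text \<open>
  The entries above the diagonal are i.i.d. standard Gaussians; the remaining ones are determined
  by symmetry and a vanishing diagonal.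
\<close>

locale sk_disorder = prob_space M for M :: "'a measure" +
  fixes n :: nat and g :: "nat \<Rightarrow> nat \<Rightarrow> 'a \<Rightarrow> real"
  assumes indep: "indep_vars (\<lambda>_. borel) (\<lambda>(i, j). g i j) {(i, j). i < j \<and> j < n}"
    and std_gaussian: "\<And>i j. i < j \<Longrightarrow> j < n \<Longrightarrow> distributed M lborel (g i j) std_normal_density"
    and symmetric:
      "\<And>i j \<omega>. i < j \<Longrightarrow> j < n \<Longrightarrow> \<omega> \<in> space M \<Longrightarrow> g j i \<omega> = g i j \<omega>"
    and zero_diagonal: "\<And>i \<omega>. i < n \<Longrightarrow> \<omega> \<in> space M \<Longrightarrow> g i i \<omega> = 0"

lemma sk_partition_pos: "sk_partition n \<beta> G > 0"
proof -
  have "finite (spin_configs n)" "spin_configs n \<noteq> {}"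
    by (auto simp: spin_configs_def PiE_eq_empty_iff intro!: finite_PiE)
  then show ?thesis
    by (auto simp: sk_partition_def sk_weight_def intro!: sum_pos)
qed

lemma prob_space_sk_gibbs: "prob_space (sk_gibbs n \<beta> G)"
proof
  have fin: "finite (spin_configs n)"
    by (auto simp: spin_configs_def intro!: finite_PiE)
  have nonneg: "0 \<le> sk_weight n \<beta> G \<sigma> / sk_partition n \<beta> G" for \<sigma>
    using sk_partition_pos[of n \<beta> G] by (simp add: sk_weight_def)
  have "(\<Sum>\<sigma>\<in>spin_configs n. sk_weight n \<beta> G \<sigma> / sk_partition n \<beta> G) = 1"
    using sk_partition_pos[of n \<beta> G] by (simp add: sk_partition_def flip: sum_divide_distrib)
  then show "emeasure (sk_gibbs n \<beta> G) (space (sk_gibbs n \<beta> G)) = 1"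
    using fin nonneg
    by (simp add: sk_gibbs_def space_point_measure emeasure_point_measure_finite sum_ennreal)
qed

end

theory Submission
  imports Defs
begin

text \<open>
  Freeze all spins but the \<open>i\<close>-th one and let \<open>h\<close> be the field that they exert on it.  With \<open>\<langle>\<cdot>\<rangle>\<close> the
  average over the remaining spins, the \<open>(i, j)\<close> entry of the matrix in question is
  \<open>\<langle>\<sigma> j * \<psi> h\<rangle> / \<langle>cosh h\<rangle>\<close> with \<open>\<psi> h = (1 + \<beta>\<^sup>2) * sinh h - h * cosh h\<close>, and \<open>h\<close> is Gaussian and
  independent of \<open>\<langle>\<cdot>\<rangle>\<close>.  Replicating the numerator and integrating out \<open>h\<close> gives an odd function of the
  overlap \<open>R\<close> of two replicas whose linear coefficient is \<open>O(1/n\<^sup>2)\<close>, so that after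
  averaging over \<open>j\<close> only \<open>E\<langle>R\<^sup>4\<rangle> = O(1/n\<^sup>2)\<close> is needed.  The diagonal entries are similar, with \<open>E\<langle>R\<^sup>2\<rangle> = O(1/n)\<close>.

  For these overlap moments compare the quenched average with the annealed one: for \<open>\<beta> < 1\<close> the
  second moment of the partition function \<open>Z\<close>, even weighted by \<open>exp (c * n * R\<^sup>2)\<close>, is of order \<open>(E Z)\<^sup>2\<close>,
  so it remains to control the lower tail of \<open>ln (Z / E Z)\<close>.  The second moment method
  bounds it from below with positive probability, and tensorization of the variance bounds its
  fluctuations by \<open>n * E\<langle>R\<^sup>2\<rangle>\<close>.  This is circular, but with a square root, and therefore closes.
\<close>

section \<open>Tensorization of the variance\<close>

text \<open>Quenched and annealed averages are tied together by the identity
  \<open>ln (Y G) = W G + 2 * ln (rel_Z G)\<close>. Here \<open>W\<close> is the logarithm of the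
  two-replica Gibbs average of the exponential of \<open>lam\<close> times the squared overlap, and
  \<open>Y\<close> has bounded mean. By convexity \<open>W\<close> dominates \<open>lam\<close>
  times the averaged squared overlap, and its square does the same for the fourth power up to
  constants. Both overlap moments thus reduce to the first two moments of \<open>W\<close>, and the
  only obstacle is the negative part of \<open>ln (rel_Z G)\<close>. The slope of
  \<open>ln Z\<close> in a coupling is \<open>s\<close> times an edge average, and the squares of
  the edge averages add up to the averaged squared overlap; this is how the overlap enters the
  variance. With \<open>v\<close> for the expected squared overlap per spin, the estimates read:
  \<open>v\<close> is at most a constant plus a multiple of the mean of \<open>\<phi> k0\<close>,
  and the square of that mean is at most a constant plus a multiple of \<open>v\<close>. In the
  cavity step the decisive cancellation sits in the numerator. The field comes from n - 1 spins, so
  its variance falls short of \<beta> squared by exactly \<beta> squared over n.\<close>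

lemma (in prob_space) expectation_square_le:
  fixes f :: "'a \<Rightarrow> real"
  assumes "integrable M f" "integrable M (\<lambda>x. (f x)\<^sup>2)"
  shows "(expectation f)\<^sup>2 \<le> expectation (\<lambda>x. (f x)\<^sup>2)"
  using variance_eq[OF assms] variance_positive[of f] by simp

text \<open>The independent-copy form makes the variance an integral of squares of differences, to
  which Jensen and Fubini apply directly.\<close>

lemma (in prob_space) variance_eq_double:
  fixes f :: "'a \<Rightarrow> real"
  assumes "integrable M f" "integrable M (\<lambda>x. (f x)\<^sup>2)"
  shows "expectation (\<lambda>x. (f x)\<^sup>2) - (expectation f)\<^sup>2
    = (\<integral>x. (\<integral>y. (f x - f y)\<^sup>2 \<partial>M) \<partial>M) / 2"
proof -
  have "(\<integral>y. (f x - f y)\<^sup>2 \<partial>M)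
      = (f x)\<^sup>2 + expectation (\<lambda>y. (f y)\<^sup>2) - 2 * f x * expectation f" for x
    using assms by (simp add: power2_diff prob_space)
  then show ?thesis
    using assms by (simp add: prob_space power2_eq_square)
qed

lemma (in prob_space) integrable_bounded:
  fixes f :: "'a \<Rightarrow> real"
  assumes "f \<in> borel_measurable M" "\<And>x. x \<in> space M \<Longrightarrow> \<bar>f x\<bar> \<le> B"
  shows "integrable M f"
  using assms by (intro integrable_const_bound[of _ B]) auto

lemma square_diff_le_of_abs_le:
  fixes a b :: real
  assumes "\<bar>a\<bar> \<le> B" "\<bar>b\<bar> \<le> B"
  shows "(a - b)\<^sup>2 \<le> (2 * B)\<^sup>2"
  using assms by (intro abs_le_square_iff[THEN iffD1]) linarith

text \<open>The variance is convex: averaging over \<open>x\<close> cannot increase the variance in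
  \<open>y\<close> beyond its average. In independent-copy form this is Jensen for the square of
  \<open>F x y - F x y'\<close>, followed by two exchanges of integrals.\<close>

lemma variance_of_section_average_le:
  fixes F :: "'a \<Rightarrow> 'b \<Rightarrow> real"
  assumes "prob_space M" "prob_space N"
    and [measurable]: "(\<lambda>(x, y). F x y) \<in> borel_measurable (M \<Otimes>\<^sub>M N)"
    and bnd: "\<And>x y. x \<in> space M \<Longrightarrow> y \<in> space N \<Longrightarrow> \<bar>F x y\<bar> \<le> B"
  shows "(\<integral>y. (\<integral>x. F x y \<partial>M)\<^sup>2 \<partial>N) - (\<integral>y. (\<integral>x. F x y \<partial>M) \<partial>N)\<^sup>2
    \<le> (\<integral>x. ((\<integral>y. (F x y)\<^sup>2 \<partial>N) - (\<integral>y. F x y \<partial>N)\<^sup>2) \<partial>M)"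
proof -
  interpret M: prob_space M by fact
  interpret N: prob_space N by fact
  interpret P: pair_sigma_finite M N ..
  interpret PP: prob_space "M \<Otimes>\<^sub>M N"
    by (rule prob_space_pair) fact+
  obtain x0 where x0: "x0 \<in> space M" using M.not_empty by auto
  obtain y0 where y0: "y0 \<in> space N" using N.not_empty by auto
  have B: "0 \<le> B" using bnd[OF x0 y0] by linarith
  have sq: "(F x y)\<^sup>2 \<le> B\<^sup>2" if "x \<in> space M" "y \<in> space N" for x y
    using bnd[OF that] by (simp add: abs_le_square_iff[symmetric])
  have [measurable]: "F x \<in> borel_measurable N" if "x \<in> space M" for x
    using that by measurable
  have [measurable]: "(\<lambda>x. F x y) \<in> borel_measurable M" if "y \<in> space N" for y
    using that by measurable
  have iM: "integrable M (\<lambda>x. F x y)" if "y \<in> space N" for y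
    using that by (intro M.integrable_bounded[of _ B]) (auto simp: bnd)
  have iM2: "integrable M (\<lambda>x. (F x y)\<^sup>2)" if "y \<in> space N" for y
    using that sq by (intro M.integrable_bounded[of _ "B\<^sup>2"]) (auto simp: abs_le_square_iff)
  have iN: "integrable N (F x)" if "x \<in> space M" for x
    using that by (intro N.integrable_bounded[of _ B]) (auto simp: bnd)
  have iN2: "integrable N (\<lambda>y. (F x y)\<^sup>2)" if "x \<in> space M" for x
    using that sq by (intro N.integrable_bounded[of _ "B\<^sup>2"]) auto
  have bA: "\<bar>\<integral>x. F x y \<partial>M\<bar> \<le> B" if "y \<in> space N" for y
  proof -
    have "\<bar>\<integral>x. F x y \<partial>M\<bar> \<le> (\<integral>x. \<bar>F x y\<bar> \<partial>M)" by (rule integral_abs_bound)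
    also have "\<dots> \<le> B"
      using iM[OF that] bnd that by (intro M.integral_le_const) auto
    finally show ?thesis .
  qed
  have mA [measurable]: "(\<lambda>y. \<integral>x. F x y \<partial>M) \<in> borel_measurable N"
    by measurable
  have mB [measurable]: "(\<lambda>x. \<integral>y. F x y \<partial>N) \<in> borel_measurable M"
    by measurable
  have iA: "integrable N (\<lambda>y. \<integral>x. F x y \<partial>M)"
    by (intro N.integrable_bounded[of _ B]) (auto simp: bA)
  have iA2: "integrable N (\<lambda>y. (\<integral>x. F x y \<partial>M)\<^sup>2)"
    using bA by (intro N.integrable_bounded[of _ "B\<^sup>2"]) (auto simp: abs_le_square_iff[symmetric] B)
  have jensen: "((\<integral>x. F x y \<partial>M) - (\<integral>x. F x y' \<partial>M))\<^sup>2 \<le> (\<integral>x. (F x y - F x y')\<^sup>2 \<partial>M)"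
    if "y \<in> space N" "y' \<in> space N" for y y'
  proof -
    have "((\<integral>x. F x y \<partial>M) - (\<integral>x. F x y' \<partial>M)) = (\<integral>x. F x y - F x y' \<partial>M)"
      using iM that by simp
    moreover have "integrable M (\<lambda>x. (F x y - F x y')\<^sup>2)"
    proof (rule M.integrable_bounded[of _ "(2 * B)\<^sup>2"])
      show "\<bar>(F x y - F x y')\<^sup>2\<bar> \<le> (2 * B)\<^sup>2" if "x \<in> space M" for x
        using square_diff_le_of_abs_le[OF bnd[OF that \<open>y \<in> space N\<close>] bnd[OF that \<open>y' \<in> space N\<close>]]
        by simp
    qed (use that in measurable)
    ultimately show ?thesis
      using iM that M.expectation_square_le[of "\<lambda>x. F x y - F x y'"] by simp
  qed
  have d2: "(F x y - F x y')\<^sup>2 \<le> (2 * B)\<^sup>2" if "x \<in> space M" "y \<in> space N" "y' \<in> space N" for x y y'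
    using that by (intro square_diff_le_of_abs_le bnd)
  have "(\<integral>y. (\<integral>x. F x y \<partial>M)\<^sup>2 \<partial>N) - (\<integral>y. (\<integral>x. F x y \<partial>M) \<partial>N)\<^sup>2
      = (\<integral>y. (\<integral>y'. ((\<integral>x. F x y \<partial>M) - (\<integral>x. F x y' \<partial>M))\<^sup>2 \<partial>N) \<partial>N) / 2"
    by (rule N.variance_eq_double[OF iA iA2])
  also have "\<dots> \<le> (\<integral>y. (\<integral>y'. (\<integral>x. (F x y - F x y')\<^sup>2 \<partial>M) \<partial>N) \<partial>N) / 2"
  proof -
    have b1: "((\<integral>x. F x y \<partial>M) - (\<integral>x. F x y' \<partial>M))\<^sup>2 \<le> (2 * B)\<^sup>2"
      if "y \<in> space N" "y' \<in> space N" for y y'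
      using that by (intro square_diff_le_of_abs_le bA)
    have b2: "(\<integral>x. (F x y - F x y')\<^sup>2 \<partial>M) \<le> (2 * B)\<^sup>2" "0 \<le> (\<integral>x. (F x y - F x y')\<^sup>2 \<partial>M)"
      if "y \<in> space N" "y' \<in> space N" for y y'
    proof -
      have "integrable M (\<lambda>x. (F x y - F x y')\<^sup>2)"
        using that d2 by (intro M.integrable_bounded[of _ "(2 * B)\<^sup>2"]) auto
      then show "(\<integral>x. (F x y - F x y')\<^sup>2 \<partial>M) \<le> (2 * B)\<^sup>2"
        using that d2 by (intro M.integral_le_const) auto
    qed auto
    have i1: "integrable N (\<lambda>y'. ((\<integral>x. F x y \<partial>M) - (\<integral>x. F x y' \<partial>M))\<^sup>2)" if "y \<in> space N" for y
      using that b1 by (intro N.integrable_bounded[of _ "(2 * B)\<^sup>2"]) auto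
    have i2: "integrable N (\<lambda>y'. \<integral>x. (F x y - F x y')\<^sup>2 \<partial>M)" if "y \<in> space N" for y
      using that b2 by (intro N.integrable_bounded[of _ "(2 * B)\<^sup>2"]) auto
    have "(\<integral>y. (\<integral>y'. ((\<integral>x. F x y \<partial>M) - (\<integral>x. F x y' \<partial>M))\<^sup>2 \<partial>N) \<partial>N)
      \<le> (\<integral>y. (\<integral>y'. (\<integral>x. (F x y - F x y')\<^sup>2 \<partial>M) \<partial>N) \<partial>N)"
    proof (rule integral_mono)
      show "integrable N (\<lambda>y. \<integral>y'. ((\<integral>x. F x y \<partial>M) - (\<integral>x. F x y' \<partial>M))\<^sup>2 \<partial>N)"
        using b1 by (intro N.integrable_bounded[of _ "(2 * B)\<^sup>2"])
          (auto intro!: N.integral_le_const i1)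
      show "integrable N (\<lambda>y. \<integral>y'. (\<integral>x. (F x y - F x y')\<^sup>2 \<partial>M) \<partial>N)"
        using b2 by (intro N.integrable_bounded[of _ "(2 * B)\<^sup>2"])
          (auto intro!: N.integral_le_const i2)
    qed (auto intro!: integral_mono i1 i2 jensen)
    then show ?thesis by simp
  qed
  \<comment> \<open>The \<open>x\<close>-integral moves outwards past \<open>y'\<close> and then
    past \<open>y\<close>, so that the inner double integral is again a variance, now of the section
    at fixed \<open>x\<close>.\<close>
  also have "(\<integral>y. (\<integral>y'. (\<integral>x. (F x y - F x y')\<^sup>2 \<partial>M) \<partial>N) \<partial>N)
      = (\<integral>y. (\<integral>x. (\<integral>y'. (F x y - F x y')\<^sup>2 \<partial>N) \<partial>M) \<partial>N)"
  proof (rule Bochner_Integration.integral_cong[OF refl])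
    fix y assume "y \<in> space N"
    then show "(\<integral>y'. (\<integral>x. (F x y - F x y')\<^sup>2 \<partial>M) \<partial>N) = (\<integral>x. (\<integral>y'. (F x y - F x y')\<^sup>2 \<partial>N) \<partial>M)"
      using d2 by (intro P.Fubini_integral PP.integrable_bounded[of _ "(2 * B)\<^sup>2"])
        (auto simp: space_pair_measure split_beta')
  qed
  also have "\<dots> = (\<integral>x. (\<integral>y. (\<integral>y'. (F x y - F x y')\<^sup>2 \<partial>N) \<partial>N) \<partial>M)"
  proof (rule P.Fubini_integral, rule PP.integrable_bounded[of _ "(2 * B)\<^sup>2"])
    fix z assume "z \<in> space (M \<Otimes>\<^sub>M N)"
    then obtain x y where z: "z = (x, y)" "x \<in> space M" "y \<in> space N"
      by (auto simp: space_pair_measure)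
    have "integrable N (\<lambda>y'. (F x y - F x y')\<^sup>2)"
      using z d2 by (intro N.integrable_bounded[of _ "(2 * B)\<^sup>2"]) auto
    then have "(\<integral>y'. (F x y - F x y')\<^sup>2 \<partial>N) \<le> (2 * B)\<^sup>2"
      using z d2 by (intro N.integral_le_const) auto
    then show "\<bar>case z of (x, y) \<Rightarrow> (\<integral>y'. (F x y - F x y')\<^sup>2 \<partial>N)\<bar> \<le> (2 * B)\<^sup>2"
      using z by simp
  qed measurable
  also have "\<dots> / 2 = (\<integral>x. ((\<integral>y. (F x y)\<^sup>2 \<partial>N) - (\<integral>y. F x y \<partial>N)\<^sup>2) \<partial>M)"
    by (auto simp: N.variance_eq_double[OF iN iN2] simp flip: integral_divide_zero
        intro!: Bochner_Integration.integral_cong)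
  finally show ?thesis by simp
qed

text \<open>The Efron-Stein inequality, by induction on the coordinates. The variance is the mean of
  the conditional variance given the new coordinate plus the variance of the conditional mean. The
  induction hypothesis bounds the former, which is why \<open>f\<close> has to vary in the
  induction; convexity of the variance bounds the latter.\<close>

theorem (in product_prob_space) variance_tensorization:
  fixes f :: "('i \<Rightarrow> 'a) \<Rightarrow> real"
  assumes "finite I"
    and "f \<in> borel_measurable (PiM I M)"
    and "\<And>x. x \<in> space (PiM I M) \<Longrightarrow> \<bar>f x\<bar> \<le> B"
  shows "(\<integral>x. (f x)\<^sup>2 \<partial>PiM I M) - (\<integral>x. f x \<partial>PiM I M)\<^sup>2
    \<le> (\<Sum>i\<in>I. \<integral>x. ((\<integral>y. (f (x(i := y)))\<^sup>2 \<partial>M i) - (\<integral>y. f (x(i := y)) \<partial>M i)\<^sup>2) \<partial>PiM I M)"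
  using assms
proof (induction I arbitrary: f rule: finite_induct)
  case empty
  interpret Q: prob_space "PiM {} M" by (intro prob_space_PiM M.prob_space_axioms)
  have "(\<integral>x. h x \<partial>PiM {} M) = h (\<lambda>_. undefined)" for h :: "('i \<Rightarrow> 'a) \<Rightarrow> real"
  proof -
    have "(\<integral>x. h x \<partial>PiM {} M) = (\<integral>x. h (\<lambda>_. undefined) \<partial>PiM {} M)"
      by (intro Bochner_Integration.integral_cong) (auto simp: space_PiM)
    then show ?thesis by (simp add: Q.prob_space)
  qed
  then show ?case by simp
next
  case (insert j I)
  let ?P = "PiM I M" and ?P' = "PiM (insert j I) M"
  interpret Q: prob_space ?P by (intro prob_space_PiM M.prob_space_axioms)
  interpret Q': prob_space ?P' by (intro prob_space_PiM M.prob_space_axioms)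
  interpret QM: pair_prob_space ?P "M j" ..
  note [measurable] = insert.prems(1)
  note bnd = insert.prems(2)
  have j: "j \<notin> I" by fact
  have upd: "x(j := y) \<in> space ?P'" if "x \<in> space ?P" "y \<in> space (M j)" for x y
    using that by (auto simp: space_PiM PiE_iff extensional_def)
  have upd': "x(i := y) \<in> space ?P'" if "x \<in> space ?P'" "y \<in> space (M i)" "i \<in> insert j I" for x y i
    using that by (auto simp: space_PiM PiE_iff extensional_def)
  have updI: "x(i := y) \<in> space ?P" if "x \<in> space ?P" "y \<in> space (M i)" "i \<in> I" for x y i
    using that by (auto simp: space_PiM PiE_iff extensional_def)
  obtain x0 where "x0 \<in> space ?P'" using Q'.not_empty by (meson ex_in_conv)
  then have B: "0 \<le> B" using bnd[of x0] by linarith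
  have sq: "(f x)\<^sup>2 \<le> B\<^sup>2" if "x \<in> space ?P'" for x
    using bnd[OF that] B by (simp add: abs_le_square_iff[symmetric])
  define F where "F x y = f (x(j := y))" for x y
  have F [measurable]: "(\<lambda>(x, y). F x y) \<in> borel_measurable (?P \<Otimes>\<^sub>M M j)"
    unfolding F_def by measurable
  have Fb: "\<bar>F x y\<bar> \<le> B" if "x \<in> space ?P" "y \<in> space (M j)" for x y
    unfolding F_def using bnd upd that by blast
  have Fb2: "(F x y)\<^sup>2 \<le> B\<^sup>2" if "x \<in> space ?P" "y \<in> space (M j)" for x y
    unfolding F_def using sq upd that by blast
  have iF: "integrable ?P (\<lambda>x. F x y)" "integrable ?P (\<lambda>x. (F x y)\<^sup>2)" if "y \<in> space (M j)" for y
    using that Fb Fb2 by (auto intro!: Q.integrable_bounded[of _ B] Q.integrable_bounded[of "\<lambda>x. (F x y)\<^sup>2" "B\<^sup>2"])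
  have le: "(\<integral>x. (F x y)\<^sup>2 \<partial>?P) \<le> B\<^sup>2" if "y \<in> space (M j)" for y
    using iF[OF that] Fb2 that by (intro Q.integral_le_const) auto
  have split: "(\<integral>x. u x \<partial>?P') = (\<integral>y. (\<integral>x. u (x(j := y)) \<partial>?P) \<partial>M j)"
    "(\<integral>x. u x \<partial>?P') = (\<integral>x. (\<integral>y. u (x(j := y)) \<partial>M j) \<partial>?P)"
    if [measurable]: "u \<in> borel_measurable ?P'" and b: "\<And>x. x \<in> space ?P' \<Longrightarrow> \<bar>u x\<bar> \<le> C"
    for u :: "_ \<Rightarrow> real" and C
  proof -
    show 1: "(\<integral>x. u x \<partial>?P') = (\<integral>x. (\<integral>y. u (x(j := y)) \<partial>M j) \<partial>?P)"
      using b insert.hyps by (intro product_integral_insert Q'.integrable_bounded[of _ C]) auto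
    have "(\<integral>y. (\<integral>x. u (x(j := y)) \<partial>?P) \<partial>M j) = (\<integral>x. (\<integral>y. u (x(j := y)) \<partial>M j) \<partial>?P)"
      using b upd by (intro QM.Fubini_integral QM.integrable_bounded[of _ C])
        (auto simp: space_pair_measure split_beta')
    with 1 show "(\<integral>x. u x \<partial>?P') = (\<integral>y. (\<integral>x. u (x(j := y)) \<partial>?P) \<partial>M j)" by simp
  qed
  define D where "D i x = (\<integral>y. (f (x(i := y)))\<^sup>2 \<partial>M i) - (\<integral>y. f (x(i := y)) \<partial>M i)\<^sup>2" for i x
  have mupd [measurable]: "(\<lambda>(x, y). x(i := y)) \<in> measurable (?P' \<Otimes>\<^sub>M M i) ?P'" if "i \<in> insert j I" for i
  proof -
    have "insert i (insert j I) = insert j I" using that by auto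
    then show ?thesis using measurable_add_dim[of i "insert j I" M] by simp
  qed
  have Dm [measurable]: "D i \<in> borel_measurable ?P'" if i: "i \<in> insert j I" for i
  proof -
    have "(\<lambda>(x, y). f (x(i := y))) \<in> borel_measurable (?P' \<Otimes>\<^sub>M M i)"
      using measurable_compose[OF mupd[OF i] insert.prems(1)]
      by (simp add: split_beta' del: fun_upd_apply)
    note [measurable] = this
    show ?thesis unfolding D_def by measurable
  qed
  have Db: "\<bar>D i x\<bar> \<le> B\<^sup>2" if i: "i \<in> insert j I" and x: "x \<in> space ?P'" for i x
  proof -
    have "(\<lambda>y. f (x(i := y))) \<in> borel_measurable (M i)"
      using measurable_compose[OF measurable_Pair1'[OF x] measurable_compose[OF mupd[OF i] insert.prems(1)]]
      by (simp del: fun_upd_apply)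
    note [measurable] = this
    have i1: "integrable (M i) (\<lambda>y. f (x(i := y)))"
      using bnd upd'[OF x _ i] by (intro M.integrable_bounded[where B=B]) auto
    have i2: "integrable (M i) (\<lambda>y. (f (x(i := y)))\<^sup>2)"
      using sq upd'[OF x _ i] by (intro M.integrable_bounded[where B="B\<^sup>2"]) auto
    have "(\<integral>y. (f (x(i := y)))\<^sup>2 \<partial>M i) \<le> B\<^sup>2"
      using sq upd'[OF x _ i] i2 by (intro M.integral_le_const) auto
    then show ?thesis
      using M.expectation_square_le[OF i1 i2] zero_le_power2[of "\<integral>y. f (x(i := y)) \<partial>M i"]
      unfolding D_def by (simp only: abs_le_iff) linarith
  qed
  have Dj: "integrable ?P (\<lambda>x. D i (x(j := y)))" if "i \<in> I" "y \<in> space (M j)" for i y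
    using that Db[OF _ upd] by (intro Q.integrable_bounded[of _ "B\<^sup>2"]) auto
  have bI: "\<bar>\<integral>x. D i (x(j := y)) \<partial>?P\<bar> \<le> B\<^sup>2" if "i \<in> I" "y \<in> space (M j)" for i y
  proof -
    have "\<bar>\<integral>x. D i (x(j := y)) \<partial>?P\<bar> \<le> (\<integral>x. \<bar>D i (x(j := y))\<bar> \<partial>?P)" by (rule integral_abs_bound)
    also have "\<dots> \<le> B\<^sup>2" using Dj[OF that] Db[OF _ upd] that by (intro Q.integral_le_const) auto
    finally show ?thesis .
  qed
  have iD: "integrable (M j) (\<lambda>y. \<integral>x. D i (x(j := y)) \<partial>?P)" if "i \<in> I" for i
    using that bI by (intro M.integrable_bounded[where B="B\<^sup>2"]) auto
  have "(\<integral>x. (f x)\<^sup>2 \<partial>?P') - (\<integral>x. f x \<partial>?P')\<^sup>2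
    = (\<integral>y. (\<integral>x. (F x y)\<^sup>2 \<partial>?P) \<partial>M j) - (\<integral>y. (\<integral>x. F x y \<partial>?P) \<partial>M j)\<^sup>2"
    using split(1)[of f B] split(1)[of "\<lambda>x. (f x)\<^sup>2" "B\<^sup>2"] bnd sq by (simp add: F_def)
  \<comment> \<open>Law of total variance, conditioning on the new coordinate
    \<open>y\<close>.\<close>
  also have "\<dots> = (\<integral>y. ((\<integral>x. (F x y)\<^sup>2 \<partial>?P) - (\<integral>x. F x y \<partial>?P)\<^sup>2) \<partial>M j)
      + ((\<integral>y. (\<integral>x. F x y \<partial>?P)\<^sup>2 \<partial>M j) - (\<integral>y. (\<integral>x. F x y \<partial>?P) \<partial>M j)\<^sup>2)"
  proof -
    have le': "(\<integral>x. F x y \<partial>?P)\<^sup>2 \<le> B\<^sup>2" if "y \<in> space (M j)" for y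
      using Q.expectation_square_le[OF iF[OF that]] le[OF that] by linarith
    have "integrable (M j) (\<lambda>y. \<integral>x. (F x y)\<^sup>2 \<partial>?P)" "integrable (M j) (\<lambda>y. (\<integral>x. F x y \<partial>?P)\<^sup>2)"
      using le le' by (auto intro!: M.integrable_bounded[where B="B\<^sup>2"])
    then show ?thesis by simp
  qed
  also have "\<dots> \<le> (\<integral>y. (\<Sum>i\<in>I. \<integral>x. D i (x(j := y)) \<partial>?P) \<partial>M j) + (\<integral>x. D j x \<partial>?P')"
  proof (rule add_mono)
    have ih: "(\<integral>x. (F x y)\<^sup>2 \<partial>?P) - (\<integral>x. F x y \<partial>?P)\<^sup>2 \<le> (\<Sum>i\<in>I. \<integral>x. D i (x(j := y)) \<partial>?P)"
      if y: "y \<in> space (M j)" for y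
    proof -
      have "(\<lambda>x. F x y) \<in> borel_measurable ?P" using y by measurable
      from insert.IH[OF this] have
        "(\<integral>x. (F x y)\<^sup>2 \<partial>?P) - (\<integral>x. F x y \<partial>?P)\<^sup>2
          \<le> (\<Sum>i\<in>I. \<integral>x. ((\<integral>z. (F (x(i := z)) y)\<^sup>2 \<partial>M i) - (\<integral>z. F (x(i := z)) y \<partial>M i)\<^sup>2) \<partial>?P)"
        using Fb y by blast
      also have "\<dots> = (\<Sum>i\<in>I. \<integral>x. D i (x(j := y)) \<partial>?P)"
      proof (intro sum.cong refl)
        fix i assume "i \<in> I"
        then have "i \<noteq> j" using j by auto
        then show "(\<integral>x. ((\<integral>z. (F (x(i := z)) y)\<^sup>2 \<partial>M i) - (\<integral>z. F (x(i := z)) y \<partial>M i)\<^sup>2) \<partial>?P)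
          = (\<integral>x. D i (x(j := y)) \<partial>?P)"
          by (simp add: F_def D_def fun_upd_twist[of i j])
      qed
      finally show ?thesis .
    qed
    have "integrable (M j) (\<lambda>y. (\<integral>x. (F x y)\<^sup>2 \<partial>?P) - (\<integral>x. F x y \<partial>?P)\<^sup>2)"
    proof (rule M.integrable_bounded[where B="B\<^sup>2"])
      fix y assume "y \<in> space (M j)"
      then have "(\<integral>x. F x y \<partial>?P)\<^sup>2 \<le> (\<integral>x. (F x y)\<^sup>2 \<partial>?P)" "(\<integral>x. (F x y)\<^sup>2 \<partial>?P) \<le> B\<^sup>2"
        using Q.expectation_square_le[OF iF] le[of y] by auto
      then show "\<bar>(\<integral>x. (F x y)\<^sup>2 \<partial>?P) - (\<integral>x. F x y \<partial>?P)\<^sup>2\<bar> \<le> B\<^sup>2"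
        using zero_le_power2[of "\<integral>x. F x y \<partial>?P"] by (simp only: abs_le_iff) linarith
    qed measurable
    then show "(\<integral>y. ((\<integral>x. (F x y)\<^sup>2 \<partial>?P) - (\<integral>x. F x y \<partial>?P)\<^sup>2) \<partial>M j)
      \<le> (\<integral>y. (\<Sum>i\<in>I. \<integral>x. D i (x(j := y)) \<partial>?P) \<partial>M j)"
      using iD ih by (intro integral_mono) auto
    have "(\<integral>x. D j x \<partial>?P') = (\<integral>x. (\<integral>y. D j (x(j := y)) \<partial>M j) \<partial>?P)"
      using Db by (intro split(2)[of _ "B\<^sup>2"]) auto
    also have "\<dots> = (\<integral>x. ((\<integral>y. (F x y)\<^sup>2 \<partial>M j) - (\<integral>y. F x y \<partial>M j)\<^sup>2) \<partial>?P)"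
      by (simp add: D_def F_def M.prob_space)
    finally show "(\<integral>y. (\<integral>x. F x y \<partial>?P)\<^sup>2 \<partial>M j) - (\<integral>y. (\<integral>x. F x y \<partial>?P) \<partial>M j)\<^sup>2 \<le> (\<integral>x. D j x \<partial>?P')"
      using variance_of_section_average_le[OF Q.prob_space_axioms M.prob_space_axioms F Fb] by simp
  qed
  also have "(\<integral>y. (\<Sum>i\<in>I. \<integral>x. D i (x(j := y)) \<partial>?P) \<partial>M j) = (\<Sum>i\<in>I. \<integral>x. D i x \<partial>?P')"
  proof -
    have "(\<integral>x. D i x \<partial>?P') = (\<integral>y. (\<integral>x. D i (x(j := y)) \<partial>?P) \<partial>M j)" if "i \<in> I" for i
      using that Db by (intro split(1)[of _ "B\<^sup>2"]) auto
    with iD show ?thesis by simp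
  qed
  finally show ?case
    using insert.hyps by (simp add: D_def add.commute del: fun_upd_apply)
qed

section \<open>Gaussian integrals\<close>

interpretation std_normal_prob: prob_space std_normal_distribution
  using real_dist_normal_dist by (simp add: real_distribution_def)

interpretation std_normal: product_prob_space "\<lambda>_. std_normal_distribution" I for I
  by unfold_locales

definition gaussian :: "'i set \<Rightarrow> ('i \<Rightarrow> real) measure" where
  "gaussian I = PiM I (\<lambda>_. std_normal_distribution)"

lemma prob_space_gaussian: "prob_space (gaussian I)"
  unfolding gaussian_def by (intro prob_space_PiM std_normal_prob.prob_space_axioms)

lemma sets_gaussian: "sets (gaussian I) = sets (PiM I (\<lambda>_. borel))"
  unfolding gaussian_def by (intro sets_PiM_cong) auto

lemma space_gaussian: "space (gaussian I) = I \<rightarrow>\<^sub>E UNIV"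
  by (simp add: gaussian_def space_PiM)

lemma measurable_gaussian_eq: "borel_measurable (gaussian I) = borel_measurable (PiM I (\<lambda>_. borel))"
  by (intro measurable_cong_sets sets_gaussian refl)

lemma measurable_gaussian_component [measurable (raw)]:
  "e \<in> I \<Longrightarrow> (\<lambda>x. x e) \<in> borel_measurable (gaussian I)"
  by (simp add: measurable_gaussian_eq)

text \<open>Tilting by \<open>exp (a * x)\<close> moves the mean of the Gaussian to \<open>a\<close>
  at the price of a constant factor, so these are the first moments of a unit normal centred at
  \<open>a\<close>.\<close>

lemma std_normal_exp:
  fixes a :: real
  shows "has_bochner_integral std_normal_distribution (\<lambda>x. exp (a * x)) (exp (a\<^sup>2 / 2))"
    and "has_bochner_integral std_normal_distribution (\<lambda>x. x * exp (a * x)) (exp (a\<^sup>2 / 2) * a)"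
    and "has_bochner_integral std_normal_distribution (\<lambda>x. x\<^sup>2 * exp (a * x)) (exp (a\<^sup>2 / 2) * (1 + a\<^sup>2))"
proof -
  have shift: "std_normal_density x * exp (a * x) = exp (a\<^sup>2 / 2) * normal_density a 1 x" for x
  proof -
    have "- (x\<^sup>2) / 2 + a * x = a\<^sup>2 / 2 + - (x - a)\<^sup>2 / 2"
      by (simp add: power2_eq_square field_simps)
    then show ?thesis
      by (simp add: normal_density_def flip: exp_add)
  qed
  have m0: "has_bochner_integral lborel (\<lambda>x. normal_density a 1 x) 1"
    using normal_moment_even[of 1 a 0] by simp
  have m1: "has_bochner_integral lborel (\<lambda>x. normal_density a 1 x * (x - a)) 0"
    using normal_moment_odd[of 1 a 0] by simp
  have m2: "has_bochner_integral lborel (\<lambda>x. normal_density a 1 x * (x - a)\<^sup>2) 1"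
    using normal_moment_even[of 1 a 1] by simp
  have density: "has_bochner_integral std_normal_distribution f r"
    if "has_bochner_integral lborel (\<lambda>x. std_normal_density x * f x) r" "f \<in> borel_measurable borel"
    for f and r :: real
    using that by (intro has_bochner_integral_density) (auto simp: normal_density_nonneg)
  show "has_bochner_integral std_normal_distribution (\<lambda>x. exp (a * x)) (exp (a\<^sup>2 / 2))"
    using has_bochner_integral_mult_right[OF m0, of "exp (a\<^sup>2 / 2)"] by (intro density) (simp_all add: shift)
  have "has_bochner_integral lborel (\<lambda>x. exp (a\<^sup>2 / 2) * (normal_density a 1 x * (x - a) + a * normal_density a 1 x))
    (exp (a\<^sup>2 / 2) * (0 + a * 1))"
    by (intro has_bochner_integral_mult_right has_bochner_integral_add m0 m1)
  also have "(\<lambda>x. exp (a\<^sup>2 / 2) * (normal_density a 1 x * (x - a) + a * normal_density a 1 x))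
    = (\<lambda>x. std_normal_density x * (x * exp (a * x)))"
    using shift by (auto simp: fun_eq_iff algebra_simps)
  finally show "has_bochner_integral std_normal_distribution (\<lambda>x. x * exp (a * x)) (exp (a\<^sup>2 / 2) * a)"
    by (intro density) simp_all
  have "has_bochner_integral lborel (\<lambda>x. exp (a\<^sup>2 / 2) * (normal_density a 1 x * (x - a)\<^sup>2
      + (2 * a) * (normal_density a 1 x * (x - a)) + a\<^sup>2 * normal_density a 1 x))
    (exp (a\<^sup>2 / 2) * (1 + (2 * a) * 0 + a\<^sup>2 * 1))"
    by (intro has_bochner_integral_mult_right has_bochner_integral_add m0 m1 m2)
  also have "(\<lambda>x. exp (a\<^sup>2 / 2) * (normal_density a 1 x * (x - a)\<^sup>2
      + (2 * a) * (normal_density a 1 x * (x - a)) + a\<^sup>2 * normal_density a 1 x))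
    = (\<lambda>x. std_normal_density x * (x\<^sup>2 * exp (a * x)))"
  proof
    fix x
    have "std_normal_density x * (x\<^sup>2 * exp (a * x)) = x\<^sup>2 * (exp (a\<^sup>2 / 2) * normal_density a 1 x)"
      by (simp flip: shift)
    also have "\<dots> = exp (a\<^sup>2 / 2) * (normal_density a 1 x * (x - a)\<^sup>2
      + (2 * a) * (normal_density a 1 x * (x - a)) + a\<^sup>2 * normal_density a 1 x)"
      by (simp add: power2_eq_square algebra_simps)
    finally show "exp (a\<^sup>2 / 2) * (normal_density a 1 x * (x - a)\<^sup>2
      + (2 * a) * (normal_density a 1 x * (x - a)) + a\<^sup>2 * normal_density a 1 x)
      = std_normal_density x * (x\<^sup>2 * exp (a * x))" by simp
  qed
  finally show "has_bochner_integral std_normal_distribution (\<lambda>x. x\<^sup>2 * exp (a * x)) (exp (a\<^sup>2 / 2) * (1 + a\<^sup>2))"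
    by (intro density) simp_all
qed

text \<open>The product of the density with \<open>exp (c * x\<^sup>2)\<close> is \<open>r\<close>
  times a centred normal density of standard deviation \<open>r\<close>. The threshold 1/2 on
  \<open>c\<close> is where the high-temperature condition finally comes from.\<close>

lemma std_normal_square_exponential:
  fixes c :: real
  assumes "c < 1 / 2"
  shows "has_bochner_integral std_normal_distribution (\<lambda>x. exp (c * x\<^sup>2)) (1 / sqrt (1 - 2 * c))"
proof -
  define r where "r = 1 / sqrt (1 - 2 * c)"
  have r: "r > 0" "r\<^sup>2 = 1 / (1 - 2 * c)" using assms by (auto simp: r_def power_divide)
  have "std_normal_density x * exp (c * x\<^sup>2) = r * normal_density 0 r x" for x
  proof -
    have "- x\<^sup>2 / 2 + c * x\<^sup>2 = - x\<^sup>2 / (2 * r\<^sup>2)"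
      using assms by (simp add: r(2) field_simps)
    then have "exp (- x\<^sup>2 / 2) * exp (c * x\<^sup>2) = exp (- x\<^sup>2 / (2 * r\<^sup>2))"
      by (simp flip: exp_add)
    then show ?thesis
      using r(1) by (simp add: normal_density_def real_sqrt_mult)
  qed
  moreover have "has_bochner_integral lborel (\<lambda>x. r * normal_density 0 r x) (r * 1)"
    using normal_moment_even[of r 0 0] r(1) by (intro has_bochner_integral_mult_right) simp
  ultimately show ?thesis
    by (intro has_bochner_integral_density) (auto simp: normal_density_nonneg r_def)
qed

section \<open>Moments of exponentially tilted Gaussian vectors\<close>

lemma gaussian_prod:
  fixes f :: "'i \<Rightarrow> real \<Rightarrow> real"
  assumes "finite I" "\<And>i. i \<in> I \<Longrightarrow> has_bochner_integral std_normal_distribution (f i) (r i)"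
  shows "has_bochner_integral (gaussian I) (\<lambda>x. \<Prod>i\<in>I. f i (x i)) (\<Prod>i\<in>I. r i)"
  unfolding gaussian_def has_bochner_integral_iff
  using assms
  by (auto simp: has_bochner_integral_iff std_normal.product_integral_prod intro!: std_normal.product_integrable_prod)

lemma gaussian_exp:
  assumes "finite I"
  shows "has_bochner_integral (gaussian I) (\<lambda>x. exp (\<Sum>i\<in>I. a i * x i)) (exp ((\<Sum>i\<in>I. (a i)\<^sup>2) / 2))"
  using gaussian_prod[OF assms std_normal_exp(1), of a] assms
  by (simp add: exp_sum sum_divide_distrib)

text \<open>Under the tilt the coordinates are independent unit normals with means
  \<open>a i\<close>; the mean of \<open>x k * x l\<close> is then the product of the means plus the
  covariance \<open>of_bool (k = l)\<close>.\<close>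

lemma gaussian_bilinear_exp_aux:
  assumes I: "finite I" "k \<in> I" "l \<in> I"
  shows "has_bochner_integral (gaussian I) (\<lambda>x. x k * x l * exp (\<Sum>i\<in>I. a i * x i))
    (exp ((\<Sum>i\<in>I. (a i)\<^sup>2) / 2) * (a k * a l + of_bool (k = l)))"
proof -
  \<comment> \<open>\<open>c i\<close> counts the occurrences of coordinate \<open>i\<close> in the
    monomial \<open>x k * x l\<close>, and \<open>q i\<close> is the corresponding moment of a unit
    normal with mean \<open>a i\<close>.\<close>
  define c :: "'a \<Rightarrow> nat" where "c i = of_bool (i = k) + of_bool (i = l)" for i
  define q where "q i = (if i = k \<and> i = l then 1 + (a i)\<^sup>2 else if i = k \<or> i = l then a i else 1)" for i
  have "has_bochner_integral std_normal_distribution (\<lambda>x. x ^ c i * exp (a i * x)) (exp ((a i)\<^sup>2 / 2) * q i)" for i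
    using std_normal_exp[of "a i"] by (auto simp: c_def q_def numeral_2_eq_2)
  from gaussian_prod[OF I(1) this]
  have 1: "has_bochner_integral (gaussian I) (\<lambda>x. \<Prod>i\<in>I. x i ^ c i * exp (a i * x i)) (\<Prod>i\<in>I. exp ((a i)\<^sup>2 / 2) * q i)" .
  have "(\<Prod>i\<in>I. x i ^ c i) = x k * x l" for x :: "'a \<Rightarrow> real"
  proof -
    have "(\<Prod>i\<in>I. x i ^ c i) = (\<Prod>i\<in>I. (if i = k then x i else 1) * (if i = l then x i else 1))"
      by (intro prod.cong) (auto simp: c_def)
    then show ?thesis using I by (simp add: prod.distrib)
  qed
  moreover have "(\<Prod>i\<in>I. q i) = (\<Prod>i\<in>{k, l}. q i)"
    using I by (intro prod.mono_neutral_right) (auto simp: q_def)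
  then have "(\<Prod>i\<in>I. q i) = a k * a l + of_bool (k = l)"
    by (cases "k = l") (auto simp: q_def power2_eq_square)
  ultimately show ?thesis
    using 1 I(1) by (simp add: prod.distrib exp_sum sum_divide_distrib mult.commute)
qed

lemma gaussian_bilinear_exp:
  assumes I: "finite I"
  shows "has_bochner_integral (gaussian I)
    (\<lambda>x. (\<Sum>i\<in>I. u i * x i) * (\<Sum>i\<in>I. w i * x i) * exp (\<Sum>i\<in>I. a i * x i))
    (exp ((\<Sum>i\<in>I. (a i)\<^sup>2) / 2) * ((\<Sum>i\<in>I. u i * a i) * (\<Sum>i\<in>I. w i * a i) + (\<Sum>i\<in>I. u i * w i)))"
proof -
  have "has_bochner_integral (gaussian I)
    (\<lambda>x. \<Sum>k\<in>I. \<Sum>l\<in>I. u k * w l * (x k * x l * exp (\<Sum>i\<in>I. a i * x i)))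
    (\<Sum>k\<in>I. \<Sum>l\<in>I. u k * w l * (exp ((\<Sum>i\<in>I. (a i)\<^sup>2) / 2) * (a k * a l + of_bool (k = l))))"
    using I by (intro has_bochner_integral_sum has_bochner_integral_mult_right gaussian_bilinear_exp_aux)
  moreover have "(\<Sum>k\<in>I. \<Sum>l\<in>I. u k * w l * (E * (a k * a l + of_bool (k = l))))
    = E * ((\<Sum>i\<in>I. u i * a i) * (\<Sum>i\<in>I. w i * a i) + (\<Sum>i\<in>I. u i * w i))" for E
  proof -
    have "(\<Sum>l\<in>I. u k * w l * of_bool (k = l)) = u k * w k" if "k \<in> I" for k
    proof -
      have "(\<Sum>l\<in>I. u k * w l * of_bool (k = l)) = (\<Sum>l\<in>I. if k = l then u k * w l else 0)"
        by (intro sum.cong) auto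
      then show ?thesis using I that by simp
    qed
    then have "(\<Sum>i\<in>I. u i * w i) = (\<Sum>k\<in>I. \<Sum>l\<in>I. u k * w l * of_bool (k = l))" by simp
    moreover have "(\<Sum>k\<in>I. \<Sum>l\<in>I. u k * w l * (E * (a k * a l + of_bool (k = l))))
      = (\<Sum>k\<in>I. \<Sum>l\<in>I. E * (u k * a k * (w l * a l)) + E * (u k * w l * of_bool (k = l)))"
      by (intro sum.cong refl) (simp add: algebra_simps)
    ultimately show ?thesis
      by (simp only: sum_product sum.distrib sum_distrib_left[symmetric] distrib_left)
  qed
  moreover have "(\<Sum>i\<in>I. u i * x i) * (\<Sum>i\<in>I. w i * x i) * E
    = (\<Sum>k\<in>I. \<Sum>l\<in>I. u k * w l * (x k * x l * E))" for x E
  proof -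
    have "(\<Sum>i\<in>I. u i * x i) * (\<Sum>i\<in>I. w i * x i) * E
      = (\<Sum>k\<in>I. \<Sum>l\<in>I. u k * x k * (w l * x l) * E)"
      by (simp only: sum_product sum_distrib_right[of _ _ E])
    then show ?thesis by (simp add: mult_ac)
  qed
  ultimately show ?thesis by simp
qed

lemma gaussian_linear_exp:
  assumes I: "finite I"
  shows "has_bochner_integral (gaussian I)
    (\<lambda>x. (\<Sum>i\<in>I. u i * x i) * exp (\<Sum>i\<in>I. a i * x i))
    (exp ((\<Sum>i\<in>I. (a i)\<^sup>2) / 2) * (\<Sum>i\<in>I. u i * a i))"
proof -
  have lin: "has_bochner_integral (gaussian I) (\<lambda>x. x k * exp (\<Sum>i\<in>I. a i * x i))
    (exp ((\<Sum>i\<in>I. (a i)\<^sup>2) / 2) * a k)" if k: "k \<in> I" for k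
  proof -
    have "has_bochner_integral std_normal_distribution (\<lambda>x. (if i = k then x else 1) * exp (a i * x))
      (exp ((a i)\<^sup>2 / 2) * (if i = k then a i else 1))" for i
      using std_normal_exp[of "a i"] by auto
    from gaussian_prod[OF I, of "\<lambda>i x. (if i = k then x else 1) * exp (a i * x)", OF this] show ?thesis
      using I k by (simp add: prod.distrib exp_sum sum_divide_distrib mult.commute)
  qed
  have "has_bochner_integral (gaussian I)
    (\<lambda>x. \<Sum>k\<in>I. u k * (x k * exp (\<Sum>i\<in>I. a i * x i))) (\<Sum>k\<in>I. u k * (exp ((\<Sum>i\<in>I. (a i)\<^sup>2) / 2) * a k))"
    by (intro has_bochner_integral_sum has_bochner_integral_mult_right lin)
  then show ?thesis
    by (simp add: sum_distrib_right sum_distrib_left mult_ac)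
qed

lemma gaussian_component_square:
  assumes "finite I" "k \<in> I"
  shows "has_bochner_integral (gaussian I) (\<lambda>x. (x k)\<^sup>2) 1"
  using gaussian_bilinear_exp_aux[OF assms assms(2), of "\<lambda>_. 0"] by (simp add: power2_eq_square)

lemma std_normal_moments:
  shows "has_bochner_integral std_normal_distribution (\<lambda>x. x\<^sup>2) 1"
    and "has_bochner_integral std_normal_distribution (\<lambda>x. x ^ 4) 3"
  using std_normal_distribution_even_moments[of 1] std_normal_distribution_even_moments[of 2]
  by (auto simp: has_bochner_integral_iff fact_numeral)

text \<open>
  Two linear forms of a Gaussian vector with common variance \<open>v\<close> and covariance \<open>\<rho>\<close>.  Expanding
  \<open>sinh\<close> and \<open>cosh\<close> into exponentials reduces the two lemmas that follow to this one, and the signs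
  enter only through \<open>\<epsilon> * \<eta>\<close>.
\<close>

lemma gaussian_cavity_exp:
  fixes u w :: "'i \<Rightarrow> real" and \<epsilon> \<eta> \<kappa> v \<rho> :: real
  assumes I: "finite I" and u: "(\<Sum>i\<in>I. (u i)\<^sup>2) = v" and w: "(\<Sum>i\<in>I. (w i)\<^sup>2) = v"
    and uw: "(\<Sum>i\<in>I. u i * w i) = \<rho>"
    and "\<epsilon> \<in> {-1, 1}" "\<eta> \<in> {-1, 1}"
  shows "has_bochner_integral (gaussian I)
    (\<lambda>x. (\<kappa> - \<epsilon> * (\<Sum>i\<in>I. u i * x i)) * (\<kappa> - \<eta> * (\<Sum>i\<in>I. w i * x i))
      * exp (\<epsilon> * (\<Sum>i\<in>I. u i * x i) + \<eta> * (\<Sum>i\<in>I. w i * x i)))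
    (exp (v + \<epsilon> * \<eta> * \<rho>) * ((\<kappa> - v - \<epsilon> * \<eta> * \<rho>)\<^sup>2 + \<epsilon> * \<eta> * \<rho>))"
proof -
  define a where "a i = \<epsilon> * u i + \<eta> * w i" for i
  have sq: "\<epsilon>\<^sup>2 = 1" "\<eta>\<^sup>2 = 1" using assms by auto
  have a2: "(\<Sum>i\<in>I. (a i)\<^sup>2) = 2 * (v + \<epsilon> * \<eta> * \<rho>)"
  proof -
    have "(a i)\<^sup>2 = (u i)\<^sup>2 + (w i)\<^sup>2 + 2 * \<epsilon> * \<eta> * (u i * w i)" for i
      using sq by (simp add: a_def power2_sum power_mult_distrib)
    then show ?thesis
      by (simp add: sum.distrib u w uw flip: sum_distrib_left)
  qed
  have ua: "(\<Sum>i\<in>I. u i * a i) = \<epsilon> * v + \<eta> * \<rho>" and wa: "(\<Sum>i\<in>I. w i * a i) = \<epsilon> * \<rho> + \<eta> * v"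
  proof -
    have "u i * a i = \<epsilon> * (u i)\<^sup>2 + \<eta> * (u i * w i)" "w i * a i = \<epsilon> * (u i * w i) + \<eta> * (w i)\<^sup>2" for i
      by (simp_all add: a_def power2_eq_square algebra_simps)
    then show "(\<Sum>i\<in>I. u i * a i) = \<epsilon> * v + \<eta> * \<rho>" "(\<Sum>i\<in>I. w i * a i) = \<epsilon> * \<rho> + \<eta> * v"
      by (simp_all add: sum.distrib u w uw flip: sum_distrib_left)
  qed
  let ?e = "\<lambda>x. exp (\<Sum>i\<in>I. a i * x i)"
  have ex: "exp (\<epsilon> * (\<Sum>i\<in>I. u i * x i) + \<eta> * (\<Sum>i\<in>I. w i * x i)) = ?e x" for x
    by (simp add: a_def sum.distrib sum_distrib_left algebra_simps)
  have "has_bochner_integral (gaussian I)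
    (\<lambda>x. \<kappa>\<^sup>2 * ?e x - (\<kappa> * \<epsilon>) * ((\<Sum>i\<in>I. u i * x i) * ?e x) - (\<kappa> * \<eta>) * ((\<Sum>i\<in>I. w i * x i) * ?e x)
      + (\<epsilon> * \<eta>) * ((\<Sum>i\<in>I. u i * x i) * (\<Sum>i\<in>I. w i * x i) * ?e x))
    (\<kappa>\<^sup>2 * exp ((\<Sum>i\<in>I. (a i)\<^sup>2) / 2) - (\<kappa> * \<epsilon>) * (exp ((\<Sum>i\<in>I. (a i)\<^sup>2) / 2) * (\<Sum>i\<in>I. u i * a i))
      - (\<kappa> * \<eta>) * (exp ((\<Sum>i\<in>I. (a i)\<^sup>2) / 2) * (\<Sum>i\<in>I. w i * a i))
      + (\<epsilon> * \<eta>) * (exp ((\<Sum>i\<in>I. (a i)\<^sup>2) / 2) * ((\<Sum>i\<in>I. u i * a i) * (\<Sum>i\<in>I. w i * a i) + (\<Sum>i\<in>I. u i * w i))))"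
    using I by (intro has_bochner_integral_add has_bochner_integral_diff has_bochner_integral_mult_right
      gaussian_exp gaussian_linear_exp gaussian_bilinear_exp)
  moreover have "(\<kappa>\<^sup>2 * exp ((\<Sum>i\<in>I. (a i)\<^sup>2) / 2) - (\<kappa> * \<epsilon>) * (exp ((\<Sum>i\<in>I. (a i)\<^sup>2) / 2) * (\<Sum>i\<in>I. u i * a i))
      - (\<kappa> * \<eta>) * (exp ((\<Sum>i\<in>I. (a i)\<^sup>2) / 2) * (\<Sum>i\<in>I. w i * a i))
      + (\<epsilon> * \<eta>) * (exp ((\<Sum>i\<in>I. (a i)\<^sup>2) / 2) * ((\<Sum>i\<in>I. u i * a i) * (\<Sum>i\<in>I. w i * a i) + (\<Sum>i\<in>I. u i * w i))))
    = exp (v + \<epsilon> * \<eta> * \<rho>) * ((\<kappa> - v - \<epsilon> * \<eta> * \<rho>)\<^sup>2 + \<epsilon> * \<eta> * \<rho>)"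
  proof -
    have "exp ((\<Sum>i\<in>I. (a i)\<^sup>2) / 2) = exp (v + \<epsilon> * \<eta> * \<rho>)" by (simp add: a2)
    moreover have "\<kappa>\<^sup>2 * E - (\<kappa> * \<epsilon>) * (E * (\<epsilon> * v + \<eta> * \<rho>)) - (\<kappa> * \<eta>) * (E * (\<epsilon> * \<rho> + \<eta> * v))
      + (\<epsilon> * \<eta>) * (E * ((\<epsilon> * v + \<eta> * \<rho>) * (\<epsilon> * \<rho> + \<eta> * v) + \<rho>))
      = E * ((\<kappa> - v - \<epsilon> * \<eta> * \<rho>)\<^sup>2 + \<epsilon> * \<eta> * \<rho>)" for E
      using assms(5,6) by (auto simp: power2_eq_square algebra_simps)
    ultimately show ?thesis unfolding ua wa uw by simp
  qed
  moreover have "(\<kappa> - \<epsilon> * (\<Sum>i\<in>I. u i * x i)) * (\<kappa> - \<eta> * (\<Sum>i\<in>I. w i * x i)) * ?e x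
    = \<kappa>\<^sup>2 * ?e x - (\<kappa> * \<epsilon>) * ((\<Sum>i\<in>I. u i * x i) * ?e x) - (\<kappa> * \<eta>) * ((\<Sum>i\<in>I. w i * x i) * ?e x)
      + (\<epsilon> * \<eta>) * ((\<Sum>i\<in>I. u i * x i) * (\<Sum>i\<in>I. w i * x i) * ?e x)" for x
    by (simp add: power2_eq_square algebra_simps)
  ultimately show ?thesis unfolding ex by simp
qed

text \<open>Here \<open>\<psi> h\<close> is half the sum over both signs of \<open>\<epsilon> *
  (\<kappa> - \<epsilon> * h) * exp (\<epsilon> * h)\<close>. The product of two such sums carries
  the weights \<open>\<epsilon> * \<eta>\<close>, which makes the result odd in
  \<open>\<rho>\<close>; in the even variant below these weights are absent.\<close>

lemma gaussian_cavity_odd: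
  fixes u w :: "'i \<Rightarrow> real" and \<kappa> :: real
  assumes I: "finite I" and u: "(\<Sum>i\<in>I. (u i)\<^sup>2) = v" and w: "(\<Sum>i\<in>I. (w i)\<^sup>2) = v"
    and uw: "(\<Sum>i\<in>I. u i * w i) = \<rho>"
  defines "\<psi> \<equiv> \<lambda>h. \<kappa> * sinh h - h * cosh (h :: real)"
  shows "has_bochner_integral (gaussian I) (\<lambda>x. \<psi> (\<Sum>i\<in>I. u i * x i) * \<psi> (\<Sum>i\<in>I. w i * x i))
    (exp v * (exp \<rho> * ((\<kappa> - v - \<rho>)\<^sup>2 + \<rho>) - exp (- \<rho>) * ((\<kappa> - v + \<rho>)\<^sup>2 - \<rho>)) / 2)"
proof -
  let ?t = "\<lambda>\<epsilon> \<eta> x. (\<kappa> - \<epsilon> * (\<Sum>i\<in>I. u i * x i)) * (\<kappa> - \<eta> * (\<Sum>i\<in>I. w i * x i))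
      * exp (\<epsilon> * (\<Sum>i\<in>I. u i * x i) + \<eta> * (\<Sum>i\<in>I. w i * x i))"
  let ?r = "\<lambda>\<epsilon> \<eta>. exp (v + \<epsilon> * \<eta> * \<rho>) * ((\<kappa> - v - \<epsilon> * \<eta> * \<rho>)\<^sup>2 + \<epsilon> * \<eta> * \<rho>)"
  have "has_bochner_integral (gaussian I) (\<lambda>x. (?t 1 1 x - ?t 1 (-1) x - ?t (-1) 1 x + ?t (-1) (-1) x) * (1/4))
    ((?r 1 1 - ?r 1 (-1) - ?r (-1) 1 + ?r (-1) (-1)) * (1/4))"
    by (intro has_bochner_integral_mult_left has_bochner_integral_add has_bochner_integral_diff
      gaussian_cavity_exp I u w uw) auto
  moreover have "(?r 1 1 - ?r 1 (-1) - ?r (-1) 1 + ?r (-1) (-1)) * (1/4)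
    = exp v * (exp \<rho> * ((\<kappa> - v - \<rho>)\<^sup>2 + \<rho>) - exp (- \<rho>) * ((\<kappa> - v + \<rho>)\<^sup>2 - \<rho>)) / 2"
    by (simp add: exp_add exp_diff exp_minus field_simps)
  moreover have "(?t 1 1 x - ?t 1 (-1) x - ?t (-1) 1 x + ?t (-1) (-1) x) * (1/4)
    = \<psi> (\<Sum>i\<in>I. u i * x i) * \<psi> (\<Sum>i\<in>I. w i * x i)" for x
    unfolding \<psi>_def sinh_def cosh_def
    by (simp add: exp_add exp_diff exp_minus) (simp add: field_simps)
  ultimately show ?thesis by (simp only:)
qed

lemma gaussian_cavity_even:
  fixes u w :: "'i \<Rightarrow> real" and \<kappa> :: real
  assumes I: "finite I" and u: "(\<Sum>i\<in>I. (u i)\<^sup>2) = v" and w: "(\<Sum>i\<in>I. (w i)\<^sup>2) = v"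
    and uw: "(\<Sum>i\<in>I. u i * w i) = \<rho>"
  defines "\<psi> \<equiv> \<lambda>h. \<kappa> * cosh h - h * sinh (h :: real)"
  shows "has_bochner_integral (gaussian I) (\<lambda>x. \<psi> (\<Sum>i\<in>I. u i * x i) * \<psi> (\<Sum>i\<in>I. w i * x i))
    (exp v * (exp \<rho> * ((\<kappa> - v - \<rho>)\<^sup>2 + \<rho>) + exp (- \<rho>) * ((\<kappa> - v + \<rho>)\<^sup>2 - \<rho>)) / 2)"
proof -
  let ?t = "\<lambda>\<epsilon> \<eta> x. (\<kappa> - \<epsilon> * (\<Sum>i\<in>I. u i * x i)) * (\<kappa> - \<eta> * (\<Sum>i\<in>I. w i * x i))
      * exp (\<epsilon> * (\<Sum>i\<in>I. u i * x i) + \<eta> * (\<Sum>i\<in>I. w i * x i))"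
  let ?r = "\<lambda>\<epsilon> \<eta>. exp (v + \<epsilon> * \<eta> * \<rho>) * ((\<kappa> - v - \<epsilon> * \<eta> * \<rho>)\<^sup>2 + \<epsilon> * \<eta> * \<rho>)"
  have "has_bochner_integral (gaussian I) (\<lambda>x. (?t 1 1 x + ?t 1 (-1) x + ?t (-1) 1 x + ?t (-1) (-1) x) * (1/4))
    ((?r 1 1 + ?r 1 (-1) + ?r (-1) 1 + ?r (-1) (-1)) * (1/4))"
    by (intro has_bochner_integral_mult_left has_bochner_integral_add has_bochner_integral_diff
      gaussian_cavity_exp I u w uw) auto
  moreover have "(?r 1 1 + ?r 1 (-1) + ?r (-1) 1 + ?r (-1) (-1)) * (1/4)
    = exp v * (exp \<rho> * ((\<kappa> - v - \<rho>)\<^sup>2 + \<rho>) + exp (- \<rho>) * ((\<kappa> - v + \<rho>)\<^sup>2 - \<rho>)) / 2"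
    by (simp add: exp_add exp_diff exp_minus field_simps)
  moreover have "(?t 1 1 x + ?t 1 (-1) x + ?t (-1) 1 x + ?t (-1) (-1) x) * (1/4)
    = \<psi> (\<Sum>i\<in>I. u i * x i) * \<psi> (\<Sum>i\<in>I. w i * x i)" for x
    unfolding \<psi>_def sinh_def cosh_def
    by (simp add: exp_add exp_diff exp_minus) (simp add: field_simps)
  ultimately show ?thesis by (simp only:)
qed

section \<open>Spin systems\<close>

lemma abs_tanh_le: "\<bar>tanh x\<bar> \<le> \<bar>x\<bar>" for x :: real
proof -
  have *: "tanh y \<le> y" if "0 \<le> y" for y :: real
  proof -
    have "(\<lambda>x. x - tanh x) 0 \<le> (\<lambda>x. x - tanh x) y"
      using that by (intro DERIV_nonneg_imp_nondecreasing[of 0 y "\<lambda>x. x - tanh x"])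
        (auto intro!: exI derivative_eq_intros simp: cosh_real_nonzero)
    then show ?thesis by simp
  qed
  from *[of "\<bar>x\<bar>"] show ?thesis by simp
qed

text \<open>The sub-Gaussian bound for a fair sign: \<open>ln (cosh x)\<close> has derivative
  \<open>tanh x\<close>, which is at most \<open>x\<close> for nonnegative \<open>x\<close>.\<close>

lemma cosh_le_exp_square: "cosh x \<le> exp (x\<^sup>2 / 2)" for x :: real
proof -
  have *: "cosh y \<le> exp (y\<^sup>2 / 2)" if "0 \<le> y" for y :: real
  proof -
    have "(\<lambda>x. x\<^sup>2 / 2 - ln (cosh x)) 0 \<le> (\<lambda>x. x\<^sup>2 / 2 - ln (cosh x)) y"
    proof (rule DERIV_nonneg_imp_nondecreasing[OF that])
      fix x :: real assume "0 \<le> x"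
      then have "0 \<le> x - tanh x" using abs_tanh_le[of x] by simp
      moreover have "((\<lambda>x. x\<^sup>2 / 2 - ln (cosh x)) has_real_derivative (x - tanh x)) (at x)"
        by (auto intro!: derivative_eq_intros simp: tanh_def cosh_real_pos)
      ultimately show "\<exists>d. ((\<lambda>x. x\<^sup>2 / 2 - ln (cosh x)) has_real_derivative d) (at x) \<and> 0 \<le> d" by blast
    qed
    then have "ln (cosh y) \<le> y\<^sup>2 / 2" by simp
    then show ?thesis by (metis cosh_real_pos exp_le_cancel_iff exp_ln)
  qed
  from *[of "\<bar>x\<bar>"] show ?thesis by simp
qed

definition configs :: "'v set \<Rightarrow> ('v \<Rightarrow> real) set" where
  "configs V = V \<rightarrow>\<^sub>E {-1, 1}"

text \<open>
  Edges are two-element sets of vertices, so that a permutation \<open>\<pi>\<close> of the vertices acts on the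
  disorder by \<open>G (\<pi> ` e)\<close>, without any bookkeeping of the order of the endpoints.
\<close>

definition edges :: "'v set \<Rightarrow> 'v set set" where
  "edges V = {e. e \<subseteq> V \<and> card e = 2}"

definition hamiltonian :: "'v set \<Rightarrow> ('v set \<Rightarrow> real) \<Rightarrow> ('v \<Rightarrow> real) \<Rightarrow> real" where
  "hamiltonian V G \<sigma> = (\<Sum>e\<in>edges V. G e * prod \<sigma> e)"

text \<open>The coupling strength \<open>s\<close> is not tied to the number of spins: the cavity
  method removes a spin but keeps \<open>s\<close> at \<beta> over the square root of the original
  number.\<close>

definition weight :: "real \<Rightarrow> 'v set \<Rightarrow> ('v set \<Rightarrow> real) \<Rightarrow> ('v \<Rightarrow> real) \<Rightarrow> real" where
  "weight s V G \<sigma> = exp (s * hamiltonian V G \<sigma>)"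

definition partition_fn :: "real \<Rightarrow> 'v set \<Rightarrow> ('v set \<Rightarrow> real) \<Rightarrow> real" where
  "partition_fn s V G = (\<Sum>\<sigma>\<in>configs V. weight s V G \<sigma>)"

definition avg :: "real \<Rightarrow> 'v set \<Rightarrow> ('v set \<Rightarrow> real) \<Rightarrow> (('v \<Rightarrow> real) \<Rightarrow> real) \<Rightarrow> real" where
  "avg s V G f = (\<Sum>\<sigma>\<in>configs V. f \<sigma> * weight s V G \<sigma>) / partition_fn s V G"

text \<open>Not normalised: at high temperature it is typically of the order of the square root of
  \<open>card V\<close>.\<close>

definition overlap :: "'v set \<Rightarrow> ('v \<Rightarrow> real) \<Rightarrow> ('v \<Rightarrow> real) \<Rightarrow> real" where
  "overlap V \<sigma> \<tau> = (\<Sum>k\<in>V. \<sigma> k * \<tau> k)"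

definition avg2 :: "real \<Rightarrow> 'v set \<Rightarrow> ('v set \<Rightarrow> real) \<Rightarrow> (('v \<Rightarrow> real) \<Rightarrow> ('v \<Rightarrow> real) \<Rightarrow> real) \<Rightarrow> real" where
  "avg2 s V G F = avg s V G (\<lambda>\<sigma>. avg s V G (F \<sigma>))"

lemma finite_configs [simp, intro]: "finite V \<Longrightarrow> finite (configs V)"
  by (auto simp: configs_def intro!: finite_PiE)

lemma configs_nonempty [simp]: "configs V \<noteq> {}"
  by (auto simp: configs_def PiE_eq_empty_iff)

lemma card_configs: "finite V \<Longrightarrow> card (configs V) = 2 ^ card V"
  by (simp add: configs_def card_PiE numeral_2_eq_2)

lemma config_values: "\<sigma> \<in> configs V \<Longrightarrow> k \<in> V \<Longrightarrow> \<sigma> k = -1 \<or> \<sigma> k = 1"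
  by (auto simp: configs_def PiE_iff)

lemma config_square: "\<sigma> \<in> configs V \<Longrightarrow> k \<in> V \<Longrightarrow> \<sigma> k * \<sigma> k = 1"
  by (auto simp: configs_def PiE_iff)

lemma config_abs: "\<sigma> \<in> configs V \<Longrightarrow> k \<in> V \<Longrightarrow> \<bar>\<sigma> k\<bar> = 1"
  by (auto simp: configs_def PiE_iff)

lemma finite_edges [simp, intro]: "finite V \<Longrightarrow> finite (edges V)"
  by (rule finite_subset[of _ "Pow V"]) (auto simp: edges_def)

lemma edge_prod_values:
  assumes "\<sigma> \<in> configs V" "e \<in> edges V"
  shows "prod \<sigma> e = -1 \<or> prod \<sigma> e = 1"
proof -
  from assms(2) obtain a b where "e = {a, b}" "a \<noteq> b" "a \<in> V" "b \<in> V"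
    by (auto simp: edges_def card_2_iff)
  then show ?thesis using config_values[OF assms(1), of a] config_values[OF assms(1), of b] by auto
qed

lemma edges_insert:
  assumes "i \<notin> V"
  shows "edges (insert i V) = edges V \<union> (\<lambda>k. {i, k}) ` V" (is "?L = ?R")
proof (intro equalityI subsetI)
  fix e assume e: "e \<in> ?L"
  show "e \<in> ?R"
  proof (cases "i \<in> e")
    case True
    with e obtain k where "e = {i, k}" "k \<noteq> i" by (auto simp: edges_def card_2_iff)
    with e show ?thesis by (auto simp: edges_def)
  qed (use e in \<open>auto simp: edges_def\<close>)
next
  fix e assume "e \<in> ?R"
  moreover have "card {i, k} = 2" if "k \<in> V" for k using that assms by (auto simp: card_2_iff)
  ultimately show "e \<in> ?L" by (auto simp: edges_def)
qed

lemma edges_insert_disjoint: "i \<notin> V \<Longrightarrow> edges V \<inter> (\<lambda>k. {i, k}) ` V = {}"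
  by (auto simp: edges_def)

lemma inj_on_star: "inj_on (\<lambda>k. {i, k}) V"
  by (auto simp: inj_on_def doubleton_eq_iff)

lemma sum_edges_insert:
  assumes "finite V" "i \<notin> V"
  shows "(\<Sum>e\<in>edges (insert i V). f e) = (\<Sum>e\<in>edges V. f e) + (\<Sum>k\<in>V. f {i, k})"
  using assms by (simp add: edges_insert edges_insert_disjoint sum.union_disjoint sum.reindex inj_on_star)

lemma sum_square_edges:
  fixes u :: "'v \<Rightarrow> real"
  assumes "finite V"
  shows "(\<Sum>k\<in>V. u k)\<^sup>2 = (\<Sum>k\<in>V. (u k)\<^sup>2) + 2 * (\<Sum>e\<in>edges V. prod u e)"
  using assms
proof (induction V rule: finite_induct)
  case empty
  have "edges ({} :: 'v set) = {}" by (auto simp: edges_def)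
  then show ?case by simp
next
  case (insert i V)
  have "prod u {i, k} = u i * u k" if "k \<in> V" for k
    using that insert.hyps by (subst prod.insert) auto
  then have "(\<Sum>k\<in>V. prod u {i, k}) = u i * (\<Sum>k\<in>V. u k)"
    by (simp add: sum_distrib_left)
  with insert show ?case
    by (simp add: sum_edges_insert power2_sum)
qed

lemma card_edges: "finite V \<Longrightarrow> 2 * real (card (edges V)) = real (card V) * (real (card V) - 1)"
  using sum_square_edges[of V "\<lambda>_. 1"] by (simp add: power2_eq_square algebra_simps)

section \<open>Gibbs averages over one and two replicas\<close>

lemma partition_fn_pos [simp]: "finite V \<Longrightarrow> 0 < partition_fn s V G"
  by (auto simp: partition_fn_def weight_def intro!: sum_pos)

lemma partition_fn_nonzero [simp]: "finite V \<Longrightarrow> partition_fn s V G \<noteq> 0"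
  using partition_fn_pos[of V s G] by linarith

lemma weight_pos [simp]: "0 < weight s V G \<sigma>"
  by (simp add: weight_def)

lemma weight_nonneg [simp]: "0 \<le> weight s V G \<sigma>"
  by (simp add: weight_def)

lemma avg_cong: "(\<And>\<sigma>. \<sigma> \<in> configs V \<Longrightarrow> f \<sigma> = h \<sigma>) \<Longrightarrow> avg s V G f = avg s V G h"
  by (simp add: avg_def)

lemma avg_const [simp]: "finite V \<Longrightarrow> avg s V G (\<lambda>_. c) = c"
  by (simp add: avg_def partition_fn_def[symmetric] flip: sum_distrib_left)

lemma avg_add: "avg s V G (\<lambda>\<sigma>. f \<sigma> + h \<sigma>) = avg s V G f + avg s V G h"
  by (simp add: avg_def algebra_simps sum.distrib add_divide_distrib)

lemma avg_diff: "avg s V G (\<lambda>\<sigma>. f \<sigma> - h \<sigma>) = avg s V G f - avg s V G h"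
  by (simp add: avg_def algebra_simps sum_subtractf diff_divide_distrib)

lemma avg_cmult: "avg s V G (\<lambda>\<sigma>. c * f \<sigma>) = c * avg s V G f"
  by (simp add: avg_def mult.assoc flip: sum_distrib_left)

lemma avg_multc: "avg s V G (\<lambda>\<sigma>. f \<sigma> * c) = avg s V G f * c"
  using avg_cmult[of s V G c f] by (simp add: mult.commute)

lemma avg_sum: "avg s V G (\<lambda>\<sigma>. \<Sum>i\<in>A. f i \<sigma>) = (\<Sum>i\<in>A. avg s V G (f i))"
proof -
  have "(\<Sum>\<sigma>\<in>configs V. (\<Sum>i\<in>A. f i \<sigma>) * weight s V G \<sigma>) = (\<Sum>i\<in>A. \<Sum>\<sigma>\<in>configs V. f i \<sigma> * weight s V G \<sigma>)"
    unfolding sum_distrib_right by (rule sum.swap)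
  then show ?thesis by (simp add: avg_def sum_divide_distrib)
qed

lemma avg_mono:
  assumes "finite V" "\<And>\<sigma>. \<sigma> \<in> configs V \<Longrightarrow> f \<sigma> \<le> h \<sigma>"
  shows "avg s V G f \<le> avg s V G h"
  unfolding avg_def using assms
  by (intro divide_right_mono sum_mono mult_right_mono) (auto intro: less_imp_le)

lemma avg_abs_le:
  assumes "finite V" "\<And>\<sigma>. \<sigma> \<in> configs V \<Longrightarrow> \<bar>f \<sigma>\<bar> \<le> B"
  shows "\<bar>avg s V G f\<bar> \<le> B"
proof -
  have "f \<sigma> \<le> B" "- B \<le> f \<sigma>" if "\<sigma> \<in> configs V" for \<sigma>
    using assms(2)[OF that] by auto
  then have "avg s V G f \<le> avg s V G (\<lambda>_. B)" "avg s V G (\<lambda>_. - B) \<le> avg s V G f"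
    using assms(1) by (blast intro: avg_mono)+
  then show ?thesis using assms(1) by simp
qed

text \<open>Jensen's inequality, obtained by averaging the tangent line of the exponential at the
  mean.\<close>

lemma exp_avg_le:
  assumes "finite V"
  shows "exp (avg s V G f) \<le> avg s V G (\<lambda>\<sigma>. exp (f \<sigma>))"
proof -
  let ?a = "avg s V G f"
  have "exp ?a * (1 + (f \<sigma> - ?a)) \<le> exp (f \<sigma>)" for \<sigma>
    using mult_left_mono[OF exp_ge_add_one_self[of "f \<sigma> - ?a"], of "exp ?a"]
    by (simp flip: exp_add)
  then have "avg s V G (\<lambda>\<sigma>. exp ?a * (1 + (f \<sigma> - ?a))) \<le> avg s V G (\<lambda>\<sigma>. exp (f \<sigma>))"
    using assms by (intro avg_mono)
  then show ?thesis using assms by (simp add: avg_cmult avg_add avg_diff)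
qed

lemma avg2_eq_sum:
  "avg2 s V G F = (\<Sum>\<sigma>\<in>configs V. \<Sum>\<tau>\<in>configs V. F \<sigma> \<tau> * (weight s V G \<sigma> * weight s V G \<tau>)) / (partition_fn s V G)\<^sup>2"
proof -
  have "(\<Sum>\<sigma>\<in>configs V. (\<Sum>\<tau>\<in>configs V. F \<sigma> \<tau> * weight s V G \<tau>) * weight s V G \<sigma>)
    = (\<Sum>\<sigma>\<in>configs V. \<Sum>\<tau>\<in>configs V. F \<sigma> \<tau> * (weight s V G \<sigma> * weight s V G \<tau>))"
    unfolding sum_distrib_right by (simp add: mult_ac)
  then show ?thesis by (simp add: avg2_def avg_def power2_eq_square flip: sum_divide_distrib)
qed

lemma avg2_mono:
  assumes "finite V" "\<And>\<sigma> \<tau>. \<sigma> \<in> configs V \<Longrightarrow> \<tau> \<in> configs V \<Longrightarrow> F \<sigma> \<tau> \<le> H \<sigma> \<tau>"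
  shows "avg2 s V G F \<le> avg2 s V G H"
  unfolding avg2_def using assms by (intro avg_mono) auto

lemma avg2_cmult: "avg2 s V G (\<lambda>\<sigma> \<tau>. c * F \<sigma> \<tau>) = c * avg2 s V G F"
  by (simp add: avg2_def avg_cmult)

lemma avg2_add: "avg2 s V G (\<lambda>\<sigma> \<tau>. F \<sigma> \<tau> + H \<sigma> \<tau>) = avg2 s V G F + avg2 s V G H"
  by (simp add: avg2_def avg_add)

lemma avg2_const [simp]: "finite V \<Longrightarrow> avg2 s V G (\<lambda>_ _. c) = c"
  by (simp add: avg2_def)

lemma avg2_sum: "avg2 s V G (\<lambda>\<sigma> \<tau>. \<Sum>i\<in>A. F i \<sigma> \<tau>) = (\<Sum>i\<in>A. avg2 s V G (F i))"
  by (simp add: avg2_def avg_sum)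

lemma avg2_product: "avg2 s V G (\<lambda>\<sigma> \<tau>. f \<sigma> * h \<tau>) = avg s V G f * avg s V G h"
  by (simp add: avg2_def avg_cmult avg_multc)

lemma avg2_abs_le:
  assumes "finite V" "\<And>\<sigma> \<tau>. \<sigma> \<in> configs V \<Longrightarrow> \<tau> \<in> configs V \<Longrightarrow> \<bar>F \<sigma> \<tau>\<bar> \<le> B"
  shows "\<bar>avg2 s V G F\<bar> \<le> B"
  unfolding avg2_def using assms by (intro avg_abs_le) auto

lemma abs_overlap_le:
  assumes "\<sigma> \<in> configs V" "\<tau> \<in> configs V"
  shows "\<bar>overlap V \<sigma> \<tau>\<bar> \<le> real (card V)"
proof -
  have "\<bar>overlap V \<sigma> \<tau>\<bar> \<le> (\<Sum>k\<in>V. \<bar>\<sigma> k * \<tau> k\<bar>)" unfolding overlap_def by (rule sum_abs)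
  also have "\<dots> = (\<Sum>k\<in>V. 1)" by (intro sum.cong) (auto simp: abs_mult config_abs[OF assms(1)] config_abs[OF assms(2)])
  finally show ?thesis by simp
qed

text \<open>The edge sum is the covariance of the energies of the two replicas. It therefore depends
  on the overlap alone, which makes the annealed two-replica computation one-dimensional.\<close>

lemma overlap_square:
  assumes "finite V" "\<sigma> \<in> configs V" "\<tau> \<in> configs V"
  shows "(overlap V \<sigma> \<tau>)\<^sup>2 = real (card V) + 2 * (\<Sum>e\<in>edges V. prod \<sigma> e * prod \<tau> e)"
proof -
  have "(\<sigma> k * \<tau> k)\<^sup>2 = 1" if "k \<in> V" for k
    using config_values[OF assms(2) that] config_values[OF assms(3) that] by auto
  then show ?thesis
    using sum_square_edges[OF assms(1), of "\<lambda>k. \<sigma> k * \<tau> k"] by (simp add: overlap_def prod.distrib)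
qed

text \<open>Squared edge averages are what the Efron-Stein bound for \<open>ln Z\<close> produces;
  this turns their sum into an overlap moment.\<close>

lemma avg2_overlap_square:
  assumes "finite V"
  shows "avg2 s V G (\<lambda>\<sigma> \<tau>. (overlap V \<sigma> \<tau>)\<^sup>2)
    = real (card V) + 2 * (\<Sum>e\<in>edges V. (avg s V G (\<lambda>\<sigma>. prod \<sigma> e))\<^sup>2)"
proof -
  have "avg2 s V G (\<lambda>\<sigma> \<tau>. (overlap V \<sigma> \<tau>)\<^sup>2)
    = avg2 s V G (\<lambda>\<sigma> \<tau>. real (card V) + 2 * (\<Sum>e\<in>edges V. prod \<sigma> e * prod \<tau> e))"
    unfolding avg2_def by (intro avg_cong) (simp add: overlap_square assms)
  then show ?thesis
    using assms by (simp add: avg2_add avg2_cmult avg2_sum avg2_product power2_eq_square)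
qed

section \<open>Exponential sums over spin configurations\<close>

lemma sum_configs_exp:
  fixes c :: real
  assumes "finite V"
  shows "(\<Sum>\<sigma>\<in>configs V. exp (c * (\<Sum>k\<in>V. \<sigma> k))) = (2 * cosh c) ^ card V"
proof -
  have "(\<Sum>\<sigma>\<in>configs V. exp (c * (\<Sum>k\<in>V. \<sigma> k))) = (\<Sum>\<sigma>\<in>V \<rightarrow>\<^sub>E {-1, 1}. \<Prod>k\<in>V. exp (c * \<sigma> k))"
    using assms by (simp add: configs_def sum_distrib_left exp_sum)
  also have "\<dots> = (\<Prod>k\<in>V. \<Sum>y\<in>{-1, 1}. exp (c * y))"
    using assms by (intro prod_sum_PiE[symmetric]) auto
  also have "(\<Sum>y\<in>{-1, 1}. exp (c * y)) = 2 * cosh c"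
    by (simp add: cosh_def)
  finally show ?thesis by simp
qed

text \<open>The Hubbard-Stratonovich trick: the exponential of a square is a Gaussian average of
  exponentials of linear functions, for which the sum over configurations factorises into powers of
  cosh. The sub-Gaussian bound on cosh leaves a Gaussian integral that converges exactly under the
  third assumption.\<close>

lemma sum_configs_exp_square:
  fixes a :: real
  assumes "finite V" "0 \<le> a" "2 * a * card V < 1"
  shows "(\<Sum>\<sigma>\<in>configs V. exp (a * (\<Sum>k\<in>V. \<sigma> k)\<^sup>2)) \<le> 2 ^ card V / sqrt (1 - 2 * a * card V)"
proof -
  let ?S = "\<lambda>\<sigma>. \<Sum>k\<in>V. \<sigma> k :: real"
  let ?b = "sqrt (2 * a)"
  have "has_bochner_integral std_normal_distribution (\<lambda>z. \<Sum>\<sigma>\<in>configs V. exp (?b * ?S \<sigma> * z))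
    (\<Sum>\<sigma>\<in>configs V. exp ((?b * ?S \<sigma>)\<^sup>2 / 2))"
    by (intro has_bochner_integral_sum std_normal_exp(1))
  moreover have "exp ((?b * ?S \<sigma>)\<^sup>2 / 2) = exp (a * (?S \<sigma>)\<^sup>2)" for \<sigma>
    using assms(2) by (simp add: power_mult_distrib)
  moreover have "(\<Sum>\<sigma>\<in>configs V. exp (?b * ?S \<sigma> * z)) = (2 * cosh (?b * z)) ^ card V" for z
    using sum_configs_exp[OF assms(1), of "?b * z"] by (simp add: mult_ac)
  ultimately have 1: "has_bochner_integral std_normal_distribution (\<lambda>z. (2 * cosh (?b * z)) ^ card V)
    (\<Sum>\<sigma>\<in>configs V. exp (a * (?S \<sigma>)\<^sup>2))" by simp
  have 2: "has_bochner_integral std_normal_distribution (\<lambda>z. 2 ^ card V * exp (a * card V * z\<^sup>2))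
    (2 ^ card V * (1 / sqrt (1 - 2 * (a * card V))))"
    using assms(3) by (intro has_bochner_integral_mult_right std_normal_square_exponential) simp
  have "(2 * cosh (?b * z)) ^ card V \<le> 2 ^ card V * exp (a * card V * z\<^sup>2)" for z
  proof -
    have "cosh (?b * z) ^ card V \<le> exp ((?b * z)\<^sup>2 / 2) ^ card V"
      by (intro power_mono cosh_le_exp_square) auto
    also have "\<dots> = exp (a * card V * z\<^sup>2)"
      using assms(2) by (simp add: power_mult_distrib mult_ac flip: exp_of_nat_mult)
    finally show ?thesis by (simp add: power_mult_distrib)
  qed
  then show ?thesis
    using has_bochner_integral_integral_eq[OF 1] has_bochner_integral_integral_eq[OF 2]
      integral_mono[of std_normal_distribution "\<lambda>z. (2 * cosh (?b * z)) ^ card V" "\<lambda>z. 2 ^ card V * exp (a * card V * z\<^sup>2)"]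
      1 2 by (auto simp: has_bochner_integral_iff mult_ac)
qed

text \<open>A gauge transformation: multiplication by a fixed configuration is an involution of
  \<open>configs V\<close>. It replaces the overlap with \<open>\<tau>\<close> by the plain sum of
  the spins.\<close>

lemma sum_configs_twist:
  assumes "\<tau> \<in> configs V"
  shows "(\<Sum>\<sigma>\<in>configs V. f (\<lambda>k\<in>V. \<sigma> k * \<tau> k)) = (\<Sum>\<sigma>\<in>configs V. f \<sigma>)"
proof (rule sum.reindex_bij_witness[where i = "\<lambda>\<sigma>. \<lambda>k\<in>V. \<sigma> k * \<tau> k" and j = "\<lambda>\<sigma>. \<lambda>k\<in>V. \<sigma> k * \<tau> k"])
  have tw: "(\<lambda>k\<in>V. \<sigma> k * \<tau> k) \<in> configs V" if "\<sigma> \<in> configs V" for \<sigma>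
  proof -
    have "\<sigma> k * \<tau> k \<in> {-1, 1}" if "k \<in> V" for k
      using config_values[OF \<open>\<sigma> \<in> configs V\<close> that] config_values[OF assms that] by auto
    then show ?thesis by (simp add: configs_def PiE_iff)
  qed
  have inv: "(\<lambda>k\<in>V. (\<lambda>k\<in>V. \<sigma> k * \<tau> k) k * \<tau> k) = \<sigma>" if "\<sigma> \<in> configs V" for \<sigma>
  proof
    fix k
    show "(\<lambda>k\<in>V. (\<lambda>k\<in>V. \<sigma> k * \<tau> k) k * \<tau> k) k = \<sigma> k"
      using that config_square[OF assms, of k]
      by (auto simp: mult.assoc configs_def PiE_iff extensional_def)
  qed
  fix \<sigma> assume "\<sigma> \<in> configs V"
  then show "(\<lambda>k\<in>V. (\<lambda>k\<in>V. \<sigma> k * \<tau> k) k * \<tau> k) = \<sigma>" "(\<lambda>k\<in>V. \<sigma> k * \<tau> k) \<in> configs V"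
    "(\<lambda>k\<in>V. (\<lambda>k\<in>V. \<sigma> k * \<tau> k) k * \<tau> k) = \<sigma>" "(\<lambda>k\<in>V. \<sigma> k * \<tau> k) \<in> configs V"
    using tw inv by auto
qed auto

lemma sum_configs_exp_overlap_square:
  fixes a :: real
  assumes "finite V" "0 \<le> a" "2 * a * card V < 1"
  shows "(\<Sum>\<sigma>\<in>configs V. \<Sum>\<tau>\<in>configs V. exp (a * (overlap V \<sigma> \<tau>)\<^sup>2))
    \<le> 4 ^ card V / sqrt (1 - 2 * a * card V)"
proof -
  have "(\<Sum>\<sigma>\<in>configs V. exp (a * (overlap V \<sigma> \<tau>)\<^sup>2)) = (\<Sum>\<sigma>\<in>configs V. exp (a * (\<Sum>k\<in>V. \<sigma> k)\<^sup>2))"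
    if "\<tau> \<in> configs V" for \<tau>
    using sum_configs_twist[OF that, of "\<lambda>\<sigma>. exp (a * (\<Sum>k\<in>V. \<sigma> k)\<^sup>2)"] by (simp add: overlap_def)
  then have "(\<Sum>\<tau>\<in>configs V. \<Sum>\<sigma>\<in>configs V. exp (a * (overlap V \<sigma> \<tau>)\<^sup>2))
    = 2 ^ card V * (\<Sum>\<sigma>\<in>configs V. exp (a * (\<Sum>k\<in>V. \<sigma> k)\<^sup>2))"
    using assms(1) by (simp add: card_configs)
  also have "\<dots> \<le> 2 ^ card V * (2 ^ card V / sqrt (1 - 2 * a * card V))"
    by (intro mult_left_mono sum_configs_exp_square assms) auto
  also have "\<dots> = 4 ^ card V / sqrt (1 - 2 * a * card V)"
    by (simp flip: power_mult_distrib)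
  finally show ?thesis by (subst sum.swap)
qed

section \<open>Dependence on a single coupling\<close>

lemma hamiltonian_upd:
  assumes "finite V" "e \<in> edges V"
  shows "hamiltonian V (G(e := y)) \<sigma> = hamiltonian V (G(e := y')) \<sigma> + (y - y') * prod \<sigma> e"
proof -
  have "hamiltonian V (G(e := y)) \<sigma> = y * prod \<sigma> e + (\<Sum>e\<in>edges V - {e}. G e * prod \<sigma> e)" for y
    using assms by (simp add: hamiltonian_def sum.remove[of _ e])
  then show ?thesis by (simp add: algebra_simps)
qed

lemma weight_upd:
  assumes "finite V" "e \<in> edges V"
  shows "weight s V (G(e := y)) \<sigma> = weight s V (G(e := y')) \<sigma> * exp (s * (y - y') * prod \<sigma> e)"
  by (simp add: weight_def hamiltonian_upd[OF assms, of G y \<sigma> y'] distrib_left mult.assoc flip: exp_add)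

lemma partition_fn_upd:
  assumes "finite V" "e \<in> edges V"
  shows "partition_fn s V (G(e := y))
    = partition_fn s V (G(e := y')) * avg s V (G(e := y')) (\<lambda>\<sigma>. exp (s * (y - y') * prod \<sigma> e))"
  using assms(1) by (simp add: avg_def partition_fn_def[of s V "G(e := y)"] weight_upd[OF assms, of s G y _ y'] mult.commute)

lemma avg_upd:
  assumes "finite V" "e \<in> edges V"
  shows "avg s V (G(e := y)) f
    = avg s V (G(e := y')) (\<lambda>\<sigma>. f \<sigma> * exp (s * (y - y') * prod \<sigma> e))
      / avg s V (G(e := y')) (\<lambda>\<sigma>. exp (s * (y - y') * prod \<sigma> e))"
  using assms(1) unfolding avg_def[of s V "G(e := y)"] partition_fn_upd[OF assms, of s G y y']
  by (simp add: avg_def weight_upd[OF assms, of s G y _ y'] mult_ac)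

text \<open>\<open>ln Z\<close> is convex in each coupling and so lies above its tangents, whose
  slope is \<open>s\<close> times the edge average. Exchanging \<open>y\<close> and
  \<open>y'\<close> yields the matching upper bound.\<close>

lemma ln_partition_fn_upd_ge:
  assumes "finite V" "e \<in> edges V"
  shows "ln (partition_fn s V (G(e := y'))) + s * (y - y') * avg s V (G(e := y')) (\<lambda>\<sigma>. prod \<sigma> e)
    \<le> ln (partition_fn s V (G(e := y)))"
proof -
  let ?A = "avg s V (G(e := y')) (\<lambda>\<sigma>. exp (s * (y - y') * prod \<sigma> e))"
  have "exp (s * (y - y') * avg s V (G(e := y')) (\<lambda>\<sigma>. prod \<sigma> e)) \<le> ?A"
    using exp_avg_le[OF assms(1), of s "G(e := y')" "\<lambda>\<sigma>. s * (y - y') * prod \<sigma> e"] by (simp only: avg_cmult)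
  moreover from this have "0 < ?A" by (meson exp_gt_zero less_le_trans)
  ultimately have "s * (y - y') * avg s V (G(e := y')) (\<lambda>\<sigma>. prod \<sigma> e) \<le> ln ?A"
    by (simp add: ln_ge_iff)
  then show ?thesis
    unfolding partition_fn_upd[OF assms, of s G y y'] using assms(1) \<open>0 < ?A\<close> by (simp add: ln_mult)
qed

lemma abs_avg_edge_le_1:
  assumes "finite V" "e \<in> edges V"
  shows "\<bar>avg s V G (\<lambda>\<sigma>. prod \<sigma> e)\<bar> \<le> 1"
  using edge_prod_values assms by (intro avg_abs_le) force+

text \<open>Since \<open>prod \<sigma> e\<close> is a sign, changing the coupling acts on the edge
  average \<open>c\<close> by the addition formula for tanh. The increment has numerator
  \<open>sinh t * (1 - c\<^sup>2)\<close>, where one factor of \<open>1 - c\<^sup>2\<close> cancels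
  against the denominator and the other, \<open>1 + \<bar>c\<bar>\<close>, gives the 2.\<close>

lemma avg_edge_lipschitz:
  assumes "finite V" "e \<in> edges V"
  shows "\<bar>avg s V (G(e := y)) (\<lambda>\<sigma>. prod \<sigma> e) - avg s V (G(e := y')) (\<lambda>\<sigma>. prod \<sigma> e)\<bar> \<le> 2 * \<bar>s * (y - y')\<bar>"
proof -
  define t where "t = s * (y - y')"
  define c where "c = avg s V (G(e := y')) (\<lambda>\<sigma>. prod \<sigma> e)"
  have c1: "\<bar>c\<bar> \<le> 1" unfolding c_def by (rule abs_avg_edge_le_1[OF assms])
  have D: "avg s V (G(e := y')) (\<lambda>\<sigma>. exp (t * prod \<sigma> e)) = cosh t + c * sinh t"
  proof -
    have "avg s V (G(e := y')) (\<lambda>\<sigma>. exp (t * prod \<sigma> e))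
      = avg s V (G(e := y')) (\<lambda>\<sigma>. cosh t + prod \<sigma> e * sinh t)"
      using edge_prod_values[OF _ assms(2)] by (intro avg_cong) (force simp: cosh_plus_sinh cosh_minus_sinh)
    then show ?thesis using assms(1) by (simp add: avg_add avg_multc c_def)
  qed
  have N: "avg s V (G(e := y')) (\<lambda>\<sigma>. prod \<sigma> e * exp (t * prod \<sigma> e)) = c * cosh t + sinh t"
  proof -
    have "avg s V (G(e := y')) (\<lambda>\<sigma>. prod \<sigma> e * exp (t * prod \<sigma> e))
      = avg s V (G(e := y')) (\<lambda>\<sigma>. prod \<sigma> e * cosh t + sinh t)"
      using edge_prod_values[OF _ assms(2)]
      by (intro avg_cong) (force simp: cosh_plus_sinh[symmetric] cosh_minus_sinh[symmetric])
    then show ?thesis using assms(1) by (simp add: avg_add avg_multc c_def)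
  qed
  have y: "avg s V (G(e := y)) (\<lambda>\<sigma>. prod \<sigma> e) = (c * cosh t + sinh t) / (cosh t + c * sinh t)"
    by (simp only: avg_upd[OF assms, of s G y _ y'] t_def[symmetric] D N)
  have ch: "cosh t > 0" by (simp add: cosh_real_pos)
  have "\<bar>sinh t\<bar> < cosh t" using tanh_real_bounds[of t] ch by (auto simp: tanh_def abs_less_iff field_simps)
  \<comment> \<open>The denominator is bounded below by a multiple of
    \<open>1 - \<bar>c\<bar>\<close>. At \<open>c = 1\<close> and \<open>c = -1\<close>, where this
    degenerates, the quotient does not move at all.\<close>
  show ?thesis
  proof (cases "\<bar>c\<bar> = 1")
    case True
    then have "(c * cosh t + sinh t) / (cosh t + c * sinh t) = c"
    proof -
      have "c = 1 \<or> c = -1" using True by auto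
      then show ?thesis using \<open>\<bar>sinh t\<bar> < cosh t\<close> by (auto simp: field_simps abs_less_iff)
    qed
    then show ?thesis by (simp add: y flip: c_def)
  next
    case False
    with c1 have c: "\<bar>c\<bar> < 1" by simp
    have lower: "(1 - \<bar>c\<bar>) * cosh t \<le> cosh t + c * sinh t"
    proof -
      have "\<bar>c * sinh t\<bar> \<le> \<bar>c\<bar> * cosh t"
        unfolding abs_mult using \<open>\<bar>sinh t\<bar> < cosh t\<close> by (intro mult_left_mono) auto
      then show ?thesis by (simp add: algebra_simps)
    qed
    have pos: "0 < (1 - \<bar>c\<bar>) * cosh t" using c ch by simp
    with lower have D0: "0 < cosh t + c * sinh t" by linarith
    have c2: "c\<^sup>2 < 1" using c by (simp add: abs_square_less_1)
    have "(c * cosh t + sinh t) / (cosh t + c * sinh t) - c = sinh t * (1 - c\<^sup>2) / (cosh t + c * sinh t)"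
      using D0 by (simp add: divide_simps power2_eq_square) (simp add: algebra_simps)
    also have "\<bar>\<dots>\<bar> = \<bar>sinh t\<bar> * (1 - c\<^sup>2) / (cosh t + c * sinh t)"
      using D0 c2 by (simp add: abs_mult)
    also have "\<dots> \<le> \<bar>sinh t\<bar> * (1 - c\<^sup>2) / ((1 - \<bar>c\<bar>) * cosh t)"
      using pos lower c2 D0 by (intro divide_left_mono mult_nonneg_nonneg mult_pos_pos[OF D0 pos]) auto
    also have "\<dots> = (1 + \<bar>c\<bar>) * \<bar>tanh t\<bar>"
    proof -
      have "1 - c\<^sup>2 = (1 - \<bar>c\<bar>) * (1 + \<bar>c\<bar>)" by (simp add: algebra_simps power2_eq_square)
      then show ?thesis using c ch by (simp add: tanh_def abs_divide)
    qed
    also have "\<dots> \<le> 2 * \<bar>t\<bar>"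
      using c abs_tanh_le[of t] by (intro mult_mono) auto
    finally show ?thesis by (simp add: y t_def flip: c_def)
  qed
qed

section \<open>Overlap moments at high temperature\<close>

lemma measurable_weight [measurable]:
  assumes "finite V"
  shows "(\<lambda>G. weight s V G \<sigma>) \<in> borel_measurable (gaussian (edges V))"
  unfolding weight_def hamiltonian_def by measurable

lemma measurable_partition_fn [measurable]:
  assumes "finite V"
  shows "(\<lambda>G. partition_fn s V G) \<in> borel_measurable (gaussian (edges V))"
  unfolding partition_fn_def using assms by measurable

lemma measurable_avg [measurable]:
  assumes "finite V"
  shows "(\<lambda>G. avg s V G f) \<in> borel_measurable (gaussian (edges V))"
  unfolding avg_def using assms by measurable

lemma measurable_avg2 [measurable]:
  assumes "finite V"
  shows "(\<lambda>G. avg2 s V G F) \<in> borel_measurable (gaussian (edges V))"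
  unfolding avg2_eq_sum using assms by measurable

lemma integral_weight:
  assumes "finite V" "\<sigma> \<in> configs V"
  shows "has_bochner_integral (gaussian (edges V)) (\<lambda>G. weight s V G \<sigma>) (exp (s\<^sup>2 * card (edges V) / 2))"
proof -
  have "(s * prod \<sigma> e)\<^sup>2 = s\<^sup>2" if "e \<in> edges V" for e
    using edge_prod_values[OF assms(2) that] by (auto simp: power_mult_distrib)
  then have "(\<Sum>e\<in>edges V. (s * prod \<sigma> e)\<^sup>2) = s\<^sup>2 * card (edges V)" by simp
  moreover have "weight s V G \<sigma> = exp (\<Sum>e\<in>edges V. (s * prod \<sigma> e) * G e)" for G
    by (simp add: weight_def hamiltonian_def sum_distrib_left mult_ac)
  ultimately show ?thesis
    using gaussian_exp[of "edges V" "\<lambda>e. s * prod \<sigma> e"] assms(1) by simp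
qed

text \<open>The exponent is a Gaussian variable whose variance gets
  \<open>2 * s\<^sup>2 * (1 + prod \<sigma> e * prod \<tau> e)\<close> from each edge; the sum of
  the products is read off from the squared overlap.\<close>

lemma integral_weight_weight:
  assumes "finite V" "\<sigma> \<in> configs V" "\<tau> \<in> configs V"
  shows "has_bochner_integral (gaussian (edges V)) (\<lambda>G. weight s V G \<sigma> * weight s V G \<tau>)
    (exp (s\<^sup>2 * card (edges V)) * exp (s\<^sup>2 / 2 * ((overlap V \<sigma> \<tau>)\<^sup>2 - card V)))"
proof -
  have "(s * (prod \<sigma> e + prod \<tau> e))\<^sup>2 = 2 * s\<^sup>2 + 2 * s\<^sup>2 * (prod \<sigma> e * prod \<tau> e)" if "e \<in> edges V" for e
    using edge_prod_values[OF assms(2) that] edge_prod_values[OF assms(3) that]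
    by (auto simp: power_mult_distrib)
  then have "(\<Sum>e\<in>edges V. (s * (prod \<sigma> e + prod \<tau> e))\<^sup>2)
    = 2 * s\<^sup>2 * card (edges V) + 2 * s\<^sup>2 * (\<Sum>e\<in>edges V. prod \<sigma> e * prod \<tau> e)"
    by (simp add: sum.distrib sum_distrib_left)
  also have "\<dots> = 2 * (s\<^sup>2 * card (edges V) + s\<^sup>2 / 2 * ((overlap V \<sigma> \<tau>)\<^sup>2 - card V))"
    by (simp add: overlap_square[OF assms] algebra_simps)
  finally have "exp ((\<Sum>e\<in>edges V. (s * (prod \<sigma> e + prod \<tau> e))\<^sup>2) / 2)
    = exp (s\<^sup>2 * card (edges V)) * exp (s\<^sup>2 / 2 * ((overlap V \<sigma> \<tau>)\<^sup>2 - card V))"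
    by (simp flip: exp_add)
  moreover have "weight s V G \<sigma> * weight s V G \<tau> = exp (\<Sum>e\<in>edges V. (s * (prod \<sigma> e + prod \<tau> e)) * G e)" for G
    by (simp add: weight_def hamiltonian_def sum_distrib_left sum.distrib algebra_simps flip: exp_add)
  ultimately show ?thesis
    using gaussian_exp[of "edges V" "\<lambda>e. s * (prod \<sigma> e + prod \<tau> e)"] assms(1) by simp
qed

lemma ln_le_two_sqrt: "0 < y \<Longrightarrow> ln y \<le> 2 * sqrt y" for y :: real
  using ln_bound[of "sqrt y"] by (simp add: ln_sqrt)

text \<open>A substitute for Jensen's inequality with the square of a logarithm: if
  \<open>exp x\<close> averages to \<open>exp w\<close>, then averaging this bound shows that the
  mean of \<open>x\<^sup>2\<close> is at most \<open>2 * w\<^sup>2 + 4\<close>.\<close>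

lemma square_le_exp_shift:
  fixes x w :: real
  assumes "0 \<le> x" "0 \<le> w"
  shows "x\<^sup>2 \<le> 2 * w\<^sup>2 + 4 * exp (x - w)"
proof (cases "x \<le> w")
  case True
  then have "x\<^sup>2 \<le> w\<^sup>2" using assms by (intro power_mono)
  then show ?thesis using zero_le_power2[of w] exp_gt_zero[of "x - w"] by linarith
next
  case False
  then have "(x - w)\<^sup>2 / 2 \<le> exp (x - w)"
    using exp_lower_Taylor_quadratic[of "x - w"] by simp
  moreover have "x\<^sup>2 \<le> 2 * w\<^sup>2 + 2 * (x - w)\<^sup>2"
    using zero_le_power2[of "x - 2 * w"] by (simp add: power2_eq_square algebra_simps)
  ultimately show ?thesis by simp
qed

lemma clip_lipschitz: "\<bar>min k (max 0 a) - min k (max 0 b)\<bar> \<le> \<bar>a - b\<bar>" for a b k :: real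
  by (simp add: min_def max_def abs_if)

text \<open>The resulting moment constants involve \<open>b\<close> alone. This makes them uniform
  in the number of spins and in \<open>s\<close>, so that they apply to the system with one spin
  removed.\<close>

locale high_temperature =
  fixes V :: "'v set" and s b :: real
  assumes finite_V [simp]: "finite V" and nonempty_V: "V \<noteq> {}"
    and temperature: "s\<^sup>2 * card V \<le> b" and b_less_1: "b < 1"
begin

sublocale prob_space "gaussian (edges V)"
  by (rule prob_space_gaussian)

abbreviation "\<Omega> \<equiv> gaussian (edges V)"

text \<open>
  \<open>lam\<close> is chosen such that the annealed exponent \<open>(s\<^sup>2 / 2 + lam) * (overlap)\<^sup>2\<close> stays below the critical
  value \<open>(overlap)\<^sup>2 / (2 * card V)\<close>, with a margin depending on \<open>b\<close> only.  \<open>Y\<close> is the annealed two-replica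
  sum, and \<open>K\<close> bounds its mean.
\<close>

definition "mean_Z = 2 ^ card V * exp (s\<^sup>2 * card (edges V) / 2)"
definition "rel_Z G = partition_fn s V G / mean_Z"
definition "K = sqrt (2 / (1 - b))"
definition "lam = (1 - b) / (4 * card V)"
definition "Y G = (\<Sum>\<sigma>\<in>configs V. \<Sum>\<tau>\<in>configs V.
  exp (lam * (overlap V \<sigma> \<tau>)\<^sup>2) * (weight s V G \<sigma> * weight s V G \<tau>)) / mean_Z\<^sup>2"

lemma card_V_pos: "1 \<le> real (card V)"
  using nonempty_V card_gt_0_iff[of V] by (simp add: Suc_le_eq)

lemma b_nonneg: "0 \<le> b"
  using temperature by (meson of_nat_0_le_iff order_trans zero_le_mult_iff zero_le_power2)

lemma lam_pos: "0 < lam"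
  using card_V_pos b_less_1 by (simp add: lam_def)

lemma lam_card: "lam * card V = (1 - b) / 4"
proof -
  have "real (card V) \<noteq> 0" using card_V_pos by linarith
  then show ?thesis by (simp add: lam_def)
qed

lemma K_ge_1: "1 \<le> K"
  using b_nonneg b_less_1 by (simp add: K_def le_divide_eq)

lemma mean_Z_pos: "0 < mean_Z"
  by (simp add: mean_Z_def)

lemma rel_Z_pos: "0 < rel_Z G"
  using mean_Z_pos by (simp add: rel_Z_def)

lemma measurable_rel_Z [measurable]: "rel_Z \<in> borel_measurable \<Omega>"
  unfolding rel_Z_def[abs_def] by measurable

section \<open>Annealed moments and the second moment method\<close>

lemma integral_rel_Z: "has_bochner_integral \<Omega> rel_Z 1"
proof -
  have "has_bochner_integral \<Omega> (\<lambda>G. (\<Sum>\<sigma>\<in>configs V. weight s V G \<sigma>) / mean_Z)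
    ((\<Sum>\<sigma>\<in>configs V. exp (s\<^sup>2 * card (edges V) / 2)) / mean_Z)"
    by (intro has_bochner_integral_divide has_bochner_integral_sum integral_weight) auto
  then show ?thesis
    by (simp add: rel_Z_def[abs_def] partition_fn_def[symmetric] mean_Z_def card_configs)
qed

lemma Y_eq: "Y G = avg2 s V G (\<lambda>\<sigma> \<tau>. exp (lam * (overlap V \<sigma> \<tau>)\<^sup>2)) * (rel_Z G)\<^sup>2"
  by (simp add: Y_def avg2_eq_sum rel_Z_def power_divide)

lemma integral_Y: "integrable \<Omega> Y" "expectation Y \<le> K"
proof -
  let ?r = "\<lambda>\<sigma> \<tau>. exp (lam * (overlap V \<sigma> \<tau>)\<^sup>2) *
    (exp (s\<^sup>2 * card (edges V)) * exp (s\<^sup>2 / 2 * ((overlap V \<sigma> \<tau>)\<^sup>2 - card V)))"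
  let ?a = "lam + s\<^sup>2 / 2"
  have Y: "has_bochner_integral \<Omega> Y ((\<Sum>\<sigma>\<in>configs V. \<Sum>\<tau>\<in>configs V. ?r \<sigma> \<tau>) / mean_Z\<^sup>2)"
    unfolding Y_def
    by (intro has_bochner_integral_divide has_bochner_integral_sum has_bochner_integral_mult_right
      integral_weight_weight) auto
  then show "integrable \<Omega> Y" by (simp add: has_bochner_integral_iff)
  \<comment> \<open>The two parts of the exponent contribute at most \<open>(1 - b) / 2\<close> and
    \<open>b\<close>; the remaining gap \<open>(1 - b) / 2\<close> is what \<open>K\<close> is made
    of.\<close>
  have a: "2 * ?a * card V \<le> (1 + b) / 2"
    using lam_card temperature by (simp add: algebra_simps)
  then have a': "(1 - b) / 2 \<le> 1 - 2 * ?a * card V" "2 * ?a * card V < 1"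
    using b_less_1 by (auto simp: field_simps)
  have a0: "0 \<le> ?a" using lam_pos by (simp add: add_nonneg_nonneg)
  have mZ: "mean_Z\<^sup>2 = 4 ^ card V * exp (s\<^sup>2 * card (edges V))"
  proof -
    have "(2 ^ card V)\<^sup>2 = (4::real) ^ card V" by (simp add: power2_eq_square flip: power_mult_distrib)
    moreover have "(exp (x / 2))\<^sup>2 = exp x" for x :: real by (simp add: power2_eq_square flip: exp_add)
    ultimately show ?thesis by (simp add: mean_Z_def power_mult_distrib)
  qed
  \<comment> \<open>The factor \<open>exp (- s\<^sup>2 * card V / 2)\<close>, which stems from the
    diagonal part of the squared overlap, is at most 1 and is discarded.\<close>
  have "?r \<sigma> \<tau> \<le> exp (s\<^sup>2 * card (edges V)) * exp (?a * (overlap V \<sigma> \<tau>)\<^sup>2)" for \<sigma> \<tau>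
    by (simp add: algebra_simps flip: exp_add)
  then have "(\<Sum>\<sigma>\<in>configs V. \<Sum>\<tau>\<in>configs V. ?r \<sigma> \<tau>)
    \<le> (\<Sum>\<sigma>\<in>configs V. \<Sum>\<tau>\<in>configs V. exp (s\<^sup>2 * card (edges V)) * exp (?a * (overlap V \<sigma> \<tau>)\<^sup>2))"
    by (intro sum_mono)
  also have "\<dots> \<le> exp (s\<^sup>2 * card (edges V)) * (4 ^ card V / sqrt (1 - 2 * ?a * card V))"
    unfolding sum_distrib_left[symmetric]
    by (intro mult_left_mono sum_configs_exp_overlap_square a0 a') auto
  also have "\<dots> = mean_Z\<^sup>2 * (1 / sqrt (1 - 2 * ?a * card V))"
    by (simp add: mZ)
  also have "\<dots> \<le> mean_Z\<^sup>2 * K"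
  proof (intro mult_left_mono)
    have "1 / sqrt (1 - 2 * ?a * card V) \<le> 1 / sqrt ((1 - b) / 2)"
      using a'(1) b_less_1 by (intro divide_left_mono real_sqrt_le_mono) auto
    also have "\<dots> = K" by (simp add: K_def real_sqrt_divide)
    finally show "1 / sqrt (1 - 2 * ?a * card V) \<le> K" .
  qed simp
  finally have "(\<Sum>\<sigma>\<in>configs V. \<Sum>\<tau>\<in>configs V. ?r \<sigma> \<tau>) / mean_Z\<^sup>2 \<le> K"
    using mean_Z_pos by (simp add: divide_le_eq mult.commute)
  then show "expectation Y \<le> K"
    using has_bochner_integral_integral_eq[OF Y] by simp
qed

lemma avg2_exp_overlap_ge_1: "1 \<le> avg2 s V G (\<lambda>\<sigma> \<tau>. exp (lam * (overlap V \<sigma> \<tau>)\<^sup>2))"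
proof -
  have "avg2 s V G (\<lambda>_ _. 1) \<le> avg2 s V G (\<lambda>\<sigma> \<tau>. exp (lam * (overlap V \<sigma> \<tau>)\<^sup>2))"
    using lam_pos by (intro avg2_mono) auto
  then show ?thesis by simp
qed

lemma rel_Z_square_le: "(rel_Z G)\<^sup>2 \<le> Y G"
  unfolding Y_eq using mult_right_mono[OF avg2_exp_overlap_ge_1[of G], of "(rel_Z G)\<^sup>2"] by simp

lemma Y_pos: "0 < Y G"
  using rel_Z_square_le[of G] rel_Z_pos[of G] by (meson less_le_trans zero_less_power)

text \<open>
  The Paley-Zygmund inequality, with the Cauchy-Schwarz step replaced by the linear bound
  \<open>2 * x \<le> t * x\<^sup>2 + 1 / t\<close>, optimised at \<open>t = 1 / (2 * K)\<close>.
\<close>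

lemma prob_rel_Z_ge: "1 / (4 * K) \<le> prob {G \<in> space \<Omega>. 1 / 2 \<le> rel_Z G}"
proof -
  define A where "A = {G \<in> space \<Omega>. 1 / 2 \<le> rel_Z G}"
  define t where "t = 1 / (2 * K)"
  define u where "u = 2 * K"
  have tu: "0 < t" "t * u = 1" "t * K = 1 / 2" "0 < u" using K_ge_1 by (auto simp: t_def u_def)
  have sets [measurable]: "A \<in> events" unfolding A_def by measurable
  have iA: "integrable \<Omega> (indicator A :: _ \<Rightarrow> real)"
    by (intro integrable_bounded[of _ 1]) (auto simp: indicator_def)
  have eA: "expectation (indicator A) = prob A"
    by (simp add: sets.Int_space_eq2[OF sets])
  have "rel_Z G \<le> 1 / 2 + (t / 2) * Y G + (u / 2) * indicator A G" if "G \<in> space \<Omega>" for G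
  proof (cases "G \<in> A")
    case True
    have "0 \<le> (t * rel_Z G - 1)\<^sup>2 * u" using tu by simp
    also have "\<dots> = (t * u) * t * (rel_Z G)\<^sup>2 - 2 * (t * u) * rel_Z G + u"
      by (simp add: power2_eq_square algebra_simps)
    also have "\<dots> \<le> t * Y G - 2 * rel_Z G + u"
      using tu rel_Z_square_le[of G] by simp
    finally show ?thesis using True by simp
  next
    case False
    with that have "rel_Z G \<le> 1 / 2" by (simp add: A_def)
    moreover have "0 \<le> t * Y G" using tu Y_pos[of G] by simp
    ultimately show ?thesis using False by simp
  qed
  then have "expectation rel_Z \<le> expectation (\<lambda>G. 1 / 2 + (t / 2) * Y G + (u / 2) * indicator A G)"
    using integral_rel_Z integral_Y(1) iA
    by (intro integral_mono) (auto simp: has_bochner_integral_iff)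
  also have "\<dots> = 1 / 2 + (t / 2) * expectation Y + (u / 2) * prob A"
    using integral_Y(1) iA eA by (simp add: prob_space)
  also have "\<dots> \<le> 1 / 2 + (t / 2) * K + (u / 2) * prob A"
    using integral_Y(2) tu by simp
  finally have "1 \<le> 4 * K * prob A"
    using has_bochner_integral_integral_eq[OF integral_rel_Z] tu(3) by (simp add: u_def)
  then show ?thesis using K_ge_1 unfolding A_def[symmetric] by (simp add: field_simps)
qed

text \<open>
  The truncation makes every random variable bounded.  It costs nothing: at level \<open>k0\<close> below, it
  dominates the deterministic bound on \<open>W\<close>.
\<close>

definition "\<phi> k G = min k (max 0 (- ln (rel_Z G)))" for k :: real

section \<open>Fluctuations of the truncated log partition function\<close>

lemma phi_bounds: "0 \<le> k \<Longrightarrow> 0 \<le> \<phi> k G" "\<phi> k G \<le> k"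
  by (auto simp: \<phi>_def)

lemma measurable_phi [measurable]: "\<phi> k \<in> borel_measurable \<Omega>"
  unfolding \<phi>_def[abs_def] by measurable

text \<open>Clipping does not increase differences, and by convexity the increment of
  \<open>ln Z\<close> lies between its two tangent slopes. The slope at \<open>y\<close> is traded
  for that at 0 through the Lipschitz bound, because the latter is constant when \<open>y\<close> is
  integrated; the squares of \<open>\<bar>s * y\<bar>\<close> picked up on the way give the fourth
  power.\<close>

lemma phi_edge_difference:
  assumes e: "e \<in> edges V"
  shows "(\<phi> k (G(e := y)) - \<phi> k (G(e := 0)))\<^sup>2
    \<le> s\<^sup>2 * (3 * (avg s V (G(e := 0)) (\<lambda>\<sigma>. prod \<sigma> e))\<^sup>2 * y\<^sup>2 + 8 * s\<^sup>2 * y ^ 4)"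
proof -
  let ?f = "\<lambda>y. ln (partition_fn s V (G(e := y)))" and ?c = "\<lambda>y. avg s V (G(e := y)) (\<lambda>\<sigma>. prod \<sigma> e)"
  have ln: "ln (rel_Z (G(e := y))) = ?f y - ln mean_Z" for y
    using mean_Z_pos by (simp add: rel_Z_def ln_div)
  have "\<bar>\<phi> k (G(e := y)) - \<phi> k (G(e := 0))\<bar> \<le> \<bar>?f y - ?f 0\<bar>"
    unfolding \<phi>_def ln using clip_lipschitz[of k "- (?f y - ln mean_Z)" "- (?f 0 - ln mean_Z)"]
    by (simp add: abs_minus_commute)
  moreover have "\<bar>?f y - ?f 0\<bar> \<le> \<bar>s * y\<bar> * max \<bar>?c y\<bar> \<bar>?c 0\<bar>"
  proof -
    have "s * y * ?c 0 \<le> ?f y - ?f 0" "?f y - ?f 0 \<le> s * y * ?c y"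
      using ln_partition_fn_upd_ge[OF finite_V e, of s G 0 y] ln_partition_fn_upd_ge[OF finite_V e, of s G y 0]
      by simp_all
    moreover have "\<bar>s * y * ?c z\<bar> \<le> \<bar>s * y\<bar> * max \<bar>?c y\<bar> \<bar>?c 0\<bar>" if "z = 0 \<or> z = y" for z
      unfolding abs_mult[of "s * y"] using that by (intro mult_left_mono) auto
    ultimately show ?thesis by (smt (verit))
  qed
  ultimately have "\<bar>\<phi> k (G(e := y)) - \<phi> k (G(e := 0))\<bar> \<le> \<bar>\<bar>s * y\<bar> * max \<bar>?c y\<bar> \<bar>?c 0\<bar>\<bar>"
    by linarith
  then have "(\<phi> k (G(e := y)) - \<phi> k (G(e := 0)))\<^sup>2 \<le> (\<bar>s * y\<bar> * max \<bar>?c y\<bar> \<bar>?c 0\<bar>)\<^sup>2"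
    by (rule abs_le_square_iff[THEN iffD1])
  also have "\<dots> \<le> s\<^sup>2 * y\<^sup>2 * ((?c y)\<^sup>2 + (?c 0)\<^sup>2)"
    by (simp add: power_mult_distrib max_def mult_left_mono)
  also have "\<dots> \<le> s\<^sup>2 * y\<^sup>2 * (3 * (?c 0)\<^sup>2 + 8 * s\<^sup>2 * y\<^sup>2)"
  proof -
    have "(?c y - ?c 0)\<^sup>2 \<le> (2 * \<bar>s * y\<bar>)\<^sup>2"
      using avg_edge_lipschitz[OF finite_V e, of s G y 0] by (intro abs_le_square_iff[THEN iffD1]) simp
    then have "(?c y - ?c 0)\<^sup>2 \<le> 4 * s\<^sup>2 * y\<^sup>2" by (simp add: power_mult_distrib)
    moreover have "(?c y)\<^sup>2 \<le> 2 * (?c 0)\<^sup>2 + 2 * (?c y - ?c 0)\<^sup>2"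
      using zero_le_power2[of "?c y - 2 * ?c 0"] by (simp add: power2_eq_square algebra_simps)
    ultimately show ?thesis by (intro mult_left_mono) auto
  qed
  finally show ?thesis by (simp add: algebra_simps power2_eq_square power4_eq_xxxx)
qed

lemma measurable_upd:
  assumes "e \<in> edges V" "G \<in> space \<Omega>"
  shows "(\<lambda>y. G(e := y)) \<in> measurable std_normal_distribution \<Omega>"
proof -
  have "insert e (edges V) = edges V" using assms(1) by auto
  then have "(\<lambda>(G, y). G(e := y)) \<in> measurable (\<Omega> \<Otimes>\<^sub>M std_normal_distribution) \<Omega>"
    unfolding gaussian_def using measurable_add_dim[of e "edges V" "\<lambda>_. std_normal_distribution"] by simp
  from measurable_compose[OF measurable_Pair1'[OF assms(2)] this] show ?thesis by simp
qed

definition "Q = expectation (\<lambda>G. avg2 s V G (\<lambda>\<sigma> \<tau>. (overlap V \<sigma> \<tau>)\<^sup>2))"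

lemma s_square_le: "s\<^sup>2 \<le> 1 / card V"
  using temperature b_less_1 card_V_pos by (simp add: field_simps)

lemma integrable_avg2:
  assumes "\<And>\<sigma> \<tau>. \<sigma> \<in> configs V \<Longrightarrow> \<tau> \<in> configs V \<Longrightarrow> \<bar>F \<sigma> \<tau>\<bar> \<le> B"
  shows "integrable \<Omega> (\<lambda>G. avg2 s V G F)"
  using avg2_abs_le[OF finite_V assms] by (intro integrable_bounded[of _ B]) auto

lemma integrable_avg_edge_square:
  "e \<in> edges V \<Longrightarrow> integrable \<Omega> (\<lambda>G. (avg s V G (\<lambda>\<sigma>. prod \<sigma> e))\<^sup>2)"
  using abs_avg_edge_le_1[OF finite_V] by (intro integrable_bounded[of _ 1]) (auto simp: abs_square_le_1)

lemma Q_eq: "Q = card V + 2 * (\<Sum>e\<in>edges V. expectation (\<lambda>G. (avg s V G (\<lambda>\<sigma>. prod \<sigma> e))\<^sup>2))"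
  unfolding Q_def using integrable_avg_edge_square
  by (simp add: avg2_overlap_square prob_space)

lemma Q_nonneg: "0 \<le> Q"
  unfolding Q_eq by (intro add_nonneg_nonneg mult_nonneg_nonneg sum_nonneg) auto

text \<open>Integrating out the coupling leaves an edge average at coupling 0. It is carried back to
  the actual coupling \<open>G e\<close>, so that the bounds for different edges refer to one and
  the same Gibbs measure and can be summed.\<close>

lemma conditional_variance_phi:
  assumes k: "0 \<le> k" and e: "e \<in> edges V" and G: "G \<in> space \<Omega>"
  shows "(\<integral>y. (\<phi> k (G(e := y)))\<^sup>2 \<partial>std_normal_distribution) - (\<integral>y. \<phi> k (G(e := y)) \<partial>std_normal_distribution)\<^sup>2
    \<le> s\<^sup>2 * (6 * (avg s V G (\<lambda>\<sigma>. prod \<sigma> e))\<^sup>2 + 24 * s\<^sup>2 * (G e)\<^sup>2 + 24 * s\<^sup>2)"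
proof -
  let ?N = "std_normal_distribution"
  let ?c = "avg s V (G(e := 0)) (\<lambda>\<sigma>. prod \<sigma> e)"
  let ?p = "\<lambda>y. \<phi> k (G(e := y))"
  have [measurable]: "?p \<in> borel_measurable ?N"
    by (rule measurable_compose[OF measurable_upd[OF e G] measurable_phi])
  have i1: "integrable ?N ?p"
    using phi_bounds(1)[OF k] phi_bounds(2) by (intro std_normal_prob.integrable_bounded[of _ k]) auto
  have i2: "integrable ?N (\<lambda>y. (?p y)\<^sup>2)"
    using phi_bounds(1)[OF k] phi_bounds(2)
    by (intro std_normal_prob.integrable_bounded[of _ "k\<^sup>2"]) (auto intro!: power_mono simp: power2_abs)
  let ?a = "?p 0"
  \<comment> \<open>The variance is at most the second moment about any point; the point used is the
    value at coupling 0.\<close>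
  have "0 \<le> ((\<integral>y. ?p y \<partial>?N) - ?a)\<^sup>2" by simp
  then have "(\<integral>y. (?p y)\<^sup>2 \<partial>?N) - (\<integral>y. ?p y \<partial>?N)\<^sup>2
    \<le> (\<integral>y. (?p y)\<^sup>2 \<partial>?N) - 2 * ?a * (\<integral>y. ?p y \<partial>?N) + ?a\<^sup>2"
    by (simp add: power2_diff algebra_simps)
  also have "\<dots> = (\<integral>y. (?p y)\<^sup>2 - 2 * ?a * ?p y + ?a\<^sup>2 \<partial>?N)"
    using i1 i2 std_normal_prob.prob_space by simp
  also have "\<dots> = (\<integral>y. (?p y - ?a)\<^sup>2 \<partial>?N)"
    by (simp add: power2_diff algebra_simps)
  also have "\<dots> \<le> (\<integral>y. s\<^sup>2 * (3 * ?c\<^sup>2 * y\<^sup>2 + 8 * s\<^sup>2 * y ^ 4) \<partial>?N)"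
  proof (rule integral_mono)
    show "integrable ?N (\<lambda>y. (?p y - ?a)\<^sup>2)"
      using i1 i2 by (simp add: power2_diff)
    show "integrable ?N (\<lambda>y. s\<^sup>2 * (3 * ?c\<^sup>2 * y\<^sup>2 + 8 * s\<^sup>2 * y ^ 4))"
      using std_normal_moments by (simp add: has_bochner_integral_iff)
  qed (rule phi_edge_difference[OF e])
  also have "\<dots> = s\<^sup>2 * (3 * ?c\<^sup>2 + 24 * s\<^sup>2)"
    using std_normal_moments by (simp add: has_bochner_integral_iff)
  also have "\<dots> \<le> s\<^sup>2 * (6 * (avg s V G (\<lambda>\<sigma>. prod \<sigma> e))\<^sup>2 + 24 * s\<^sup>2 * (G e)\<^sup>2 + 24 * s\<^sup>2)"
  proof -
    let ?d = "avg s V G (\<lambda>\<sigma>. prod \<sigma> e)"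
    have "(?c - ?d)\<^sup>2 \<le> (2 * \<bar>s * G e\<bar>)\<^sup>2"
      using avg_edge_lipschitz[OF finite_V e, of s G 0 "G e"] by (intro abs_le_square_iff[THEN iffD1]) simp
    then have "(?c - ?d)\<^sup>2 \<le> 4 * s\<^sup>2 * (G e)\<^sup>2" by (simp add: power_mult_distrib)
    moreover have "?c\<^sup>2 \<le> 2 * ?d\<^sup>2 + 2 * (?c - ?d)\<^sup>2"
      using zero_le_power2[of "?c - 2 * ?d"] by (simp add: power2_eq_square algebra_simps)
    ultimately have "3 * ?c\<^sup>2 + 24 * s\<^sup>2 \<le> 6 * ?d\<^sup>2 + 24 * s\<^sup>2 * (G e)\<^sup>2 + 24 * s\<^sup>2" by linarith
    then show ?thesis by (intro mult_left_mono) auto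
  qed
  finally show ?thesis .
qed

text \<open>The squared edge averages sum to half of \<open>Q - card V\<close>, and the prefactor
  \<open>s\<^sup>2\<close> is at most \<open>1 / card V\<close>. The error terms carry
  \<open>s\<close> to the fourth power on about half of \<open>(card V)\<^sup>2\<close> edges and
  stay bounded.\<close>

lemma variance_phi:
  assumes k: "0 \<le> k"
  shows "expectation (\<lambda>G. (\<phi> k G)\<^sup>2) - (expectation (\<phi> k))\<^sup>2 \<le> 3 * (Q / card V) + 24"
proof -
  let ?N = "std_normal_distribution"
  let ?D = "\<lambda>e G. (\<integral>y. (\<phi> k (G(e := y)))\<^sup>2 \<partial>?N) - (\<integral>y. \<phi> k (G(e := y)) \<partial>?N)\<^sup>2"
  let ?c = "\<lambda>e G. avg s V G (\<lambda>\<sigma>. prod \<sigma> e)"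
  have "expectation (\<lambda>G. (\<phi> k G)\<^sup>2) - (expectation (\<phi> k))\<^sup>2 \<le> (\<Sum>e\<in>edges V. expectation (?D e))"
    using std_normal.variance_tensorization[of "edges V" "\<phi> k" k] phi_bounds(1)[OF k] phi_bounds(2)
      measurable_phi by (simp add: gaussian_def[symmetric] del: fun_upd_apply)
  also have "\<dots> \<le> (\<Sum>e\<in>edges V. s\<^sup>2 * (6 * expectation (\<lambda>G. (?c e G)\<^sup>2) + 48 * s\<^sup>2))"
  proof (rule sum_mono)
    fix e assume e: "e \<in> edges V"
    have sq: "has_bochner_integral \<Omega> (\<lambda>G. (G e)\<^sup>2) 1"
      using e by (intro gaussian_component_square) auto
    have int: "integrable \<Omega> (\<lambda>G. s\<^sup>2 * (6 * (?c e G)\<^sup>2 + 24 * s\<^sup>2 * (G e)\<^sup>2 + 24 * s\<^sup>2))"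
      using integrable_avg_edge_square[OF e] sq by (auto simp: has_bochner_integral_iff)
    have "expectation (?D e) \<le> expectation (\<lambda>G. s\<^sup>2 * (6 * (?c e G)\<^sup>2 + 24 * s\<^sup>2 * (G e)\<^sup>2 + 24 * s\<^sup>2))"
      using conditional_variance_phi[OF k e] int by (intro integral_mono') auto
    also have "\<dots> = s\<^sup>2 * (6 * expectation (\<lambda>G. (?c e G)\<^sup>2) + 48 * s\<^sup>2)"
      using integrable_avg_edge_square[OF e] sq by (simp add: has_bochner_integral_iff prob_space)
    finally show "expectation (?D e) \<le> s\<^sup>2 * (6 * expectation (\<lambda>G. (?c e G)\<^sup>2) + 48 * s\<^sup>2)" .
  qed
  also have "\<dots> = s\<^sup>2 * (3 * (Q - card V)) + 48 * s\<^sup>2 * s\<^sup>2 * card (edges V)"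
    by (simp add: Q_eq sum.distrib sum_distrib_left algebra_simps)
  also have "\<dots> \<le> 3 * (Q / card V) + 24"
  proof -
    have "s\<^sup>2 * (3 * (Q - card V)) \<le> s\<^sup>2 * (3 * Q)" by (intro mult_left_mono) auto
    also have "\<dots> \<le> 1 / card V * (3 * Q)" using s_square_le Q_nonneg by (intro mult_right_mono) auto
    finally have 1: "s\<^sup>2 * (3 * (Q - card V)) \<le> 3 * (Q / card V)" by simp
    have "2 * real (card (edges V)) \<le> (real (card V))\<^sup>2"
      by (simp add: card_edges power2_eq_square algebra_simps)
    then have "48 * s\<^sup>2 * s\<^sup>2 * card (edges V) \<le> 24 * (s\<^sup>2 * s\<^sup>2) * (real (card V))\<^sup>2"
      using mult_left_mono[of "2 * real (card (edges V))" "(real (card V))\<^sup>2" "24 * (s\<^sup>2 * s\<^sup>2)"] by simp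
    also have "\<dots> = 24 * (s\<^sup>2 * card V)\<^sup>2" by (simp add: power2_eq_square)
    also have "\<dots> \<le> 24 * 1"
      using temperature b_less_1 by (intro mult_left_mono power_le_one) auto
    finally show ?thesis using 1 by linarith
  qed
  finally show ?thesis .
qed

definition "v = Q / card V"
definition "k0 = lam * (real (card V))\<^sup>2"
text \<open>The solution of the linear inequality for \<open>v\<close> in \<open>v_le_C1\<close>;
  the last two summands are \<open>1 / \<epsilon>\<close> and a multiple of
  \<open>\<epsilon>\<close> for the \<open>\<epsilon>\<close> chosen there.\<close>

definition "C1 = 8 / (1 - b) * (K + 192 * K / (1 - b) + (1 - b) / (192 * K) * (2 + 192 * K))"

lemma v_nonneg: "0 \<le> v"
  using Q_nonneg by (simp add: v_def)

lemma k0_nonneg: "0 \<le> k0"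
  using lam_pos by (simp add: k0_def)

lemma integrable_phi: "integrable \<Omega> (\<phi> k0)" "integrable \<Omega> (\<lambda>G. (\<phi> k0 G)\<^sup>2)"
  using phi_bounds(1)[OF k0_nonneg] phi_bounds(2)[of k0]
  by (auto intro!: integrable_bounded[of "\<phi> k0" k0] integrable_bounded[of "\<lambda>G. (\<phi> k0 G)\<^sup>2" "k0\<^sup>2"] power_mono)

text \<open>The second moment method provides an event of probability at least
  \<open>1 / (4 * K)\<close> on which \<open>\<phi> k0\<close> is at most 1. A mean far above 1
  would make this event a large deviation, and the variance bound excludes that.\<close>

lemma expectation_phi_square: "(expectation (\<phi> k0))\<^sup>2 \<le> 2 + 8 * K * (3 * v + 24)"
proof -
  let ?\<mu> = "expectation (\<phi> k0)"
  have \<mu>0: "0 \<le> ?\<mu>" using phi_bounds(1)[OF k0_nonneg] by (intro integral_nonneg_AE) auto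
  show ?thesis
  proof (cases "?\<mu> \<le> 1")
    case True
    then have "?\<mu>\<^sup>2 \<le> 1" using \<mu>0 by (simp add: power_le_one)
    moreover have "0 \<le> K * (3 * v + 24)" using K_ge_1 v_nonneg by simp
    ultimately show ?thesis by simp
  next
    case False
    define A where "A = {G \<in> space \<Omega>. 1 / 2 \<le> rel_Z G}"
    have sets [measurable]: "A \<in> events" unfolding A_def by measurable
    have iA: "integrable \<Omega> (indicator A :: _ \<Rightarrow> real)"
      by (intro integrable_bounded[of _ 1]) (auto simp: indicator_def)
    have eA: "expectation (indicator A) = prob A"
      by (simp add: sets.Int_space_eq2[OF sets])
    have "(?\<mu> - 1)\<^sup>2 * indicator A G \<le> (\<phi> k0 G - ?\<mu>)\<^sup>2" for G
    proof (cases "G \<in> A")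
      case True
      have "1 / 2 \<le> rel_Z G" using True by (simp add: A_def)
      then have "ln (1 / 2) \<le> ln (rel_Z G)" by (intro ln_mono) auto
      moreover have "ln (1 / 2 :: real) = - ln 2" by (simp add: ln_div)
      moreover have "ln (2 :: real) \<le> 1" using ln_le_minus_one[of "2::real"] by simp
      ultimately have "- ln (rel_Z G) \<le> 1" by linarith
      then have "\<phi> k0 G \<le> 1" by (simp add: \<phi>_def)
      then have "(?\<mu> - 1)\<^sup>2 \<le> (?\<mu> - \<phi> k0 G)\<^sup>2" using False by (intro power_mono) auto
      then show ?thesis using True by (simp add: power2_commute)
    qed simp
    then have "expectation (\<lambda>G. (?\<mu> - 1)\<^sup>2 * indicator A G) \<le> expectation (\<lambda>G. (\<phi> k0 G - ?\<mu>)\<^sup>2)"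
      using iA integrable_phi by (intro integral_mono) (auto simp: power2_diff)
    also have "\<dots> = expectation (\<lambda>G. (\<phi> k0 G)\<^sup>2) - ?\<mu>\<^sup>2"
      using integrable_phi by (rule variance_eq)
    also have "\<dots> \<le> 3 * v + 24" using variance_phi[OF k0_nonneg] by (simp add: v_def)
    finally have "(?\<mu> - 1)\<^sup>2 * prob A \<le> 3 * v + 24" using iA eA by simp
    moreover have "(?\<mu> - 1)\<^sup>2 * (1 / (4 * K)) \<le> (?\<mu> - 1)\<^sup>2 * prob A"
      using prob_rel_Z_ge unfolding A_def by (intro mult_left_mono) auto
    ultimately have "(?\<mu> - 1)\<^sup>2 * (1 / (4 * K)) \<le> 3 * v + 24" by linarith
    then have "(?\<mu> - 1)\<^sup>2 \<le> 4 * K * (3 * v + 24)" using K_ge_1 by (simp add: divide_le_eq mult.commute)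
    moreover have "?\<mu>\<^sup>2 \<le> 2 + 2 * (?\<mu> - 1)\<^sup>2"
      using zero_le_power2[of "?\<mu> - 2"] by (simp add: power2_eq_square algebra_simps)
    ultimately show ?thesis by linarith
  qed
qed

text \<open>The quenched logarithmic moment generating function of the squared overlap, taken at
  \<open>lam\<close>.\<close>

definition "W G = ln (avg2 s V G (\<lambda>\<sigma> \<tau>. exp (lam * (overlap V \<sigma> \<tau>)\<^sup>2)))"

lemma exp_W: "exp (W G) = avg2 s V G (\<lambda>\<sigma> \<tau>. exp (lam * (overlap V \<sigma> \<tau>)\<^sup>2))"
  unfolding W_def using avg2_exp_overlap_ge_1[of G] by (intro exp_ln) linarith

lemma W_nonneg: "0 \<le> W G"
  unfolding W_def using avg2_exp_overlap_ge_1[of G] by simp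

lemma measurable_W [measurable]: "W \<in> borel_measurable \<Omega>"
  unfolding W_def[abs_def] by measurable

lemma W_le_k0: "W G \<le> k0"
proof -
  have "avg2 s V G (\<lambda>\<sigma> \<tau>. exp (lam * (overlap V \<sigma> \<tau>)\<^sup>2)) \<le> avg2 s V G (\<lambda>_ _. exp k0)"
  proof (rule avg2_mono)
    fix \<sigma> \<tau> assume "\<sigma> \<in> configs V" "\<tau> \<in> configs V"
    then have "(overlap V \<sigma> \<tau>)\<^sup>2 \<le> (real (card V))\<^sup>2"
      using abs_overlap_le[of \<sigma> V \<tau>] by (intro abs_le_square_iff[THEN iffD1]) simp
    then show "exp (lam * (overlap V \<sigma> \<tau>)\<^sup>2) \<le> exp k0"
      using lam_pos by (simp add: k0_def)
  qed simp
  then have "exp (W G) \<le> exp k0" by (simp add: exp_W)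
  then show ?thesis by simp
qed

text \<open>Taking logarithms in \<open>Y G = exp (W G) * (rel_Z G)\<^sup>2\<close> gives the bound
  as long as the truncation is inactive. When it is active, \<open>\<phi> k0 G\<close> equals
  \<open>k0\<close>, which already dominates \<open>W G\<close>.\<close>

lemma W_le: "W G \<le> max 0 (ln (Y G)) + 2 * \<phi> k0 G"
proof -
  have "Y G = exp (W G) * (rel_Z G)\<^sup>2" by (simp add: Y_eq exp_W)
  then have "ln (Y G) = W G + 2 * ln (rel_Z G)"
    using rel_Z_pos[of G] by (simp add: ln_mult ln_realpow)
  then show ?thesis using W_le_k0[of G] W_nonneg[of G] by (simp add: \<phi>_def min_def max_def)
qed

lemma W_le_Y: "W G \<le> Y G + 2 * \<phi> k0 G"
  using W_le[of G] ln_bound[OF Y_pos[of G]] Y_pos[of G] by linarith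

text \<open>Bounding the logarithm by twice the square root keeps the squared logarithm linear in
  \<open>Y G\<close>, so that a first moment of \<open>Y\<close> suffices.\<close>

lemma W_square_le: "(W G)\<^sup>2 \<le> 8 * Y G + 8 * (\<phi> k0 G)\<^sup>2"
proof -
  let ?l = "max 0 (ln (Y G))"
  have "?l \<le> 2 * sqrt (Y G)" using ln_le_two_sqrt[OF Y_pos[of G]] Y_pos[of G] by simp
  then have "?l\<^sup>2 \<le> (2 * sqrt (Y G))\<^sup>2" by (intro power_mono) auto
  then have l: "?l\<^sup>2 \<le> 4 * Y G" using Y_pos[of G] by (simp add: power_mult_distrib)
  have "(W G)\<^sup>2 \<le> (?l + 2 * \<phi> k0 G)\<^sup>2" using W_le W_nonneg by (intro power_mono) auto
  also have "\<dots> \<le> 2 * ?l\<^sup>2 + 8 * (\<phi> k0 G)\<^sup>2"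
    using zero_le_power2[of "?l - 2 * \<phi> k0 G"] by (simp add: power2_eq_square algebra_simps)
  finally show ?thesis using l by linarith
qed

lemma integrable_W: "integrable \<Omega> W" "integrable \<Omega> (\<lambda>G. (W G)\<^sup>2)"
  using W_nonneg W_le_k0
  by (auto intro!: integrable_bounded[of W k0] integrable_bounded[of "\<lambda>G. (W G)\<^sup>2" "k0\<^sup>2"] power_mono)

text \<open>Jensen's inequality in the form of the tangent bound
  \<open>x \<le> W - 1 + exp (x - W)\<close>: by the choice of \<open>W\<close> the exponential term
  averages to 1.\<close>

lemma overlap_square_le_W: "lam * avg2 s V G (\<lambda>\<sigma> \<tau>. (overlap V \<sigma> \<tau>)\<^sup>2) \<le> W G"
proof -
  have "lam * (overlap V \<sigma> \<tau>)\<^sup>2 \<le> (W G - 1) + exp (- W G) * exp (lam * (overlap V \<sigma> \<tau>)\<^sup>2)" for \<sigma> \<tau>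
  proof -
    have "1 + (lam * (overlap V \<sigma> \<tau>)\<^sup>2 - W G) \<le> exp (lam * (overlap V \<sigma> \<tau>)\<^sup>2 - W G)"
      by (rule exp_ge_add_one_self)
    also have "\<dots> = exp (- W G) * exp (lam * (overlap V \<sigma> \<tau>)\<^sup>2)" by (simp add: mult_exp_exp)
    finally show ?thesis by linarith
  qed
  then have "avg2 s V G (\<lambda>\<sigma> \<tau>. lam * (overlap V \<sigma> \<tau>)\<^sup>2)
    \<le> avg2 s V G (\<lambda>\<sigma> \<tau>. (W G - 1) + exp (- W G) * exp (lam * (overlap V \<sigma> \<tau>)\<^sup>2))"
    by (intro avg2_mono) auto
  also have "\<dots> = (W G - 1) + exp (- W G) * exp (W G)"
    by (simp only: avg2_add avg2_cmult avg2_const[OF finite_V] exp_W)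
  also have "\<dots> = W G" by (simp add: mult_exp_exp)
  finally show ?thesis by (simp add: avg2_cmult)
qed

lemma overlap_fourth_le_W: "lam\<^sup>2 * avg2 s V G (\<lambda>\<sigma> \<tau>. (overlap V \<sigma> \<tau>) ^ 4) \<le> 2 * (W G)\<^sup>2 + 4"
proof -
  have "lam\<^sup>2 * (overlap V \<sigma> \<tau>) ^ 4 \<le> 2 * (W G)\<^sup>2 + 4 * exp (- W G) * exp (lam * (overlap V \<sigma> \<tau>)\<^sup>2)" for \<sigma> \<tau>
  proof -
    have "(lam * (overlap V \<sigma> \<tau>)\<^sup>2)\<^sup>2 \<le> 2 * (W G)\<^sup>2 + 4 * exp (lam * (overlap V \<sigma> \<tau>)\<^sup>2 - W G)"
      using lam_pos W_nonneg by (intro square_le_exp_shift) auto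
    also have "exp (lam * (overlap V \<sigma> \<tau>)\<^sup>2 - W G) = exp (- W G) * exp (lam * (overlap V \<sigma> \<tau>)\<^sup>2)"
      by (simp add: mult_exp_exp)
    finally show ?thesis by (simp add: power_mult_distrib)
  qed
  then have "avg2 s V G (\<lambda>\<sigma> \<tau>. lam\<^sup>2 * (overlap V \<sigma> \<tau>) ^ 4)
    \<le> avg2 s V G (\<lambda>\<sigma> \<tau>. 2 * (W G)\<^sup>2 + 4 * exp (- W G) * exp (lam * (overlap V \<sigma> \<tau>)\<^sup>2))"
    by (intro avg2_mono) auto
  also have "\<dots> = 2 * (W G)\<^sup>2 + 4 * exp (- W G) * exp (W G)"
    by (simp only: avg2_add avg2_cmult avg2_const[OF finite_V] exp_W)
  also have "\<dots> = 2 * (W G)\<^sup>2 + 4" by (simp add: mult_exp_exp)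
  finally show ?thesis by (simp add: avg2_cmult)
qed

lemma overlap_square_integrable: "integrable \<Omega> (\<lambda>G. avg2 s V G (\<lambda>\<sigma> \<tau>. (overlap V \<sigma> \<tau>)\<^sup>2))"
  and overlap_fourth_integrable: "integrable \<Omega> (\<lambda>G. avg2 s V G (\<lambda>\<sigma> \<tau>. (overlap V \<sigma> \<tau>) ^ 4))"
proof -
  have "\<bar>(overlap V \<sigma> \<tau>) ^ j\<bar> \<le> real (card V) ^ j" if "\<sigma> \<in> configs V" "\<tau> \<in> configs V" for \<sigma> \<tau> j
    using abs_overlap_le[OF that] by (simp add: power_abs power_mono)
  then show "integrable \<Omega> (\<lambda>G. avg2 s V G (\<lambda>\<sigma> \<tau>. (overlap V \<sigma> \<tau>)\<^sup>2))"
    "integrable \<Omega> (\<lambda>G. avg2 s V G (\<lambda>\<sigma> \<tau>. (overlap V \<sigma> \<tau>) ^ 4))"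
    by (blast intro: integrable_avg2)+
qed

text \<open>
  A self-bounding argument: the overlap \<open>v\<close> controls the variance of \<open>\<phi> k0\<close> linearly, the variance controls
  the mean of \<open>\<phi> k0\<close>, and this mean controls \<open>v\<close>, but only through a square root.
\<close>

lemma v_le_C1: "v \<le> C1"
proof -
  let ?\<mu> = "expectation (\<phi> k0)"
  \<comment> \<open>With this choice \<open>24 * K * \<epsilon>\<close> is
    \<open>(1 - b) / 8\<close>, half of the coefficient \<open>lam * card V\<close> of
    \<open>v\<close> on the left, so the term in \<open>v\<close> on the right can be
    absorbed.\<close>
  define \<epsilon> where "\<epsilon> = (1 - b) / (192 * K)"
  have \<epsilon>: "0 < \<epsilon>" using b_less_1 K_ge_1 by (simp add: \<epsilon>_def)
  have "expectation (\<lambda>G. lam * avg2 s V G (\<lambda>\<sigma> \<tau>. (overlap V \<sigma> \<tau>)\<^sup>2)) \<le> expectation W"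
    using overlap_square_le_W overlap_square_integrable integrable_W by (intro integral_mono) auto
  then have "lam * Q \<le> expectation W" by (simp add: Q_def)
  also have "expectation W \<le> expectation (\<lambda>G. Y G + 2 * \<phi> k0 G)"
    using W_le_Y integrable_W integral_Y(1) integrable_phi by (intro integral_mono) auto
  also have "\<dots> = expectation Y + 2 * ?\<mu>" using integral_Y(1) integrable_phi by simp
  also have "\<dots> \<le> K + 2 * ?\<mu>" using integral_Y(2) by simp
  also have "2 * ?\<mu> \<le> \<epsilon> * ?\<mu>\<^sup>2 + 1 / \<epsilon>"
  proof -
    have "0 \<le> (\<epsilon> * ?\<mu> - 1)\<^sup>2 / \<epsilon>" using \<epsilon> by simp
    also have "\<dots> = \<epsilon> * ?\<mu>\<^sup>2 - 2 * ?\<mu> + 1 / \<epsilon>" using \<epsilon> by (simp add: power2_eq_square field_simps)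
    finally show ?thesis by simp
  qed
  also have "\<epsilon> * ?\<mu>\<^sup>2 \<le> \<epsilon> * (2 + 8 * K * (3 * v + 24))"
    using expectation_phi_square \<epsilon> by (intro mult_left_mono) auto
  also have "\<dots> = (1 - b) / 8 * v + \<epsilon> * (2 + 192 * K)"
    using K_ge_1 by (simp add: \<epsilon>_def field_simps)
  finally have 1: "lam * Q \<le> K + (((1 - b) / 8 * v + \<epsilon> * (2 + 192 * K)) + 1 / \<epsilon>)" by simp
  have "lam * Q = (lam * card V) * v" using nonempty_V by (simp add: v_def)
  also have "\<dots> = (1 - b) / 4 * v" by (simp only: lam_card)
  finally have "lam * Q = (1 - b) / 4 * v" .
  with 1 have "(1 - b) / 8 * v \<le> K + 1 / \<epsilon> + \<epsilon> * (2 + 192 * K)" by (simp add: field_simps)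
  then have "v \<le> 8 / (1 - b) * (K + 1 / \<epsilon> + \<epsilon> * (2 + 192 * K))"
    using b_less_1 by (simp add: field_simps)
  then show ?thesis by (simp add: C1_def \<epsilon>_def)
qed

text \<open>The prefactor is the inverse of \<open>(lam * card V)\<^sup>2\<close>; the bracket
  bounds twice the second moment of \<open>W\<close> plus 4.\<close>

definition "C2 = 16 / (1 - b)\<^sup>2 * (4 + 16 * K + 16 * (2 + (8 * K + 1) * (3 * C1 + 24)))"

lemma overlap_square_moment:
  "expectation (\<lambda>G. avg2 s V G (\<lambda>\<sigma> \<tau>. (overlap V \<sigma> \<tau>)\<^sup>2)) \<le> C1 * card V"
  using v_le_C1 card_V_pos by (simp add: v_def Q_def divide_le_eq)

lemma overlap_fourth_moment:
  "expectation (\<lambda>G. avg2 s V G (\<lambda>\<sigma> \<tau>. (overlap V \<sigma> \<tau>) ^ 4)) \<le> C2 * (real (card V))\<^sup>2"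
proof -
  let ?R = "expectation (\<lambda>G. avg2 s V G (\<lambda>\<sigma> \<tau>. (overlap V \<sigma> \<tau>) ^ 4))"
  have "expectation (\<lambda>G. lam\<^sup>2 * avg2 s V G (\<lambda>\<sigma> \<tau>. (overlap V \<sigma> \<tau>) ^ 4))
      \<le> expectation (\<lambda>G. 2 * (W G)\<^sup>2 + 4)"
    using overlap_fourth_le_W overlap_fourth_integrable integrable_W by (intro integral_mono) auto
  then have "lam\<^sup>2 * ?R \<le> 2 * expectation (\<lambda>G. (W G)\<^sup>2) + 4" using integrable_W by (simp add: prob_space)
  also have "expectation (\<lambda>G. (W G)\<^sup>2) \<le> expectation (\<lambda>G. 8 * Y G + 8 * (\<phi> k0 G)\<^sup>2)"
    using W_square_le integrable_W integral_Y(1) integrable_phi by (intro integral_mono) auto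
  also have "\<dots> = 8 * expectation Y + 8 * expectation (\<lambda>G. (\<phi> k0 G)\<^sup>2)"
    using integral_Y(1) integrable_phi by simp
  also have "\<dots> \<le> 8 * K + 8 * (2 + (8 * K + 1) * (3 * C1 + 24))"
  proof -
    have "expectation (\<lambda>G. (\<phi> k0 G)\<^sup>2) \<le> 2 + (8 * K + 1) * (3 * v + 24)"
    proof -
      have "(8 * K + 1) * (3 * v + 24) = 8 * K * (3 * v + 24) + (3 * v + 24)" by (simp add: algebra_simps)
      then show ?thesis
        using variance_phi[OF k0_nonneg] expectation_phi_square unfolding v_def[symmetric] by linarith
    qed
    also have "\<dots> \<le> 2 + (8 * K + 1) * (3 * C1 + 24)"
      using v_le_C1 K_ge_1 by (intro add_left_mono mult_left_mono) auto
    finally show ?thesis using integral_Y(2) by simp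
  qed
  finally have "lam\<^sup>2 * ?R \<le> 4 + 16 * K + 16 * (2 + (8 * K + 1) * (3 * C1 + 24))" by simp
  then have "lam\<^sup>2 * ?R * (16 / (1 - b)\<^sup>2 * (real (card V))\<^sup>2)
      \<le> (4 + 16 * K + 16 * (2 + (8 * K + 1) * (3 * C1 + 24))) * (16 / (1 - b)\<^sup>2 * (real (card V))\<^sup>2)"
    by (intro mult_right_mono) auto
  also have "\<dots> = C2 * (real (card V))\<^sup>2" unfolding C2_def by (simp only: mult_ac)
  finally have "lam\<^sup>2 * ?R * (16 / (1 - b)\<^sup>2 * (real (card V))\<^sup>2) \<le> C2 * (real (card V))\<^sup>2" .
  moreover have *: "lam\<^sup>2 * (16 / (1 - b)\<^sup>2 * (real (card V))\<^sup>2) = 1"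
    using nonempty_V b_less_1 by (simp add: lam_def power_divide power_mult_distrib)
  have "lam\<^sup>2 * ?R * (16 / (1 - b)\<^sup>2 * (real (card V))\<^sup>2) = ?R * (lam\<^sup>2 * (16 / (1 - b)\<^sup>2 * (real (card V))\<^sup>2))"
    by (simp only: mult_ac)
  then have "lam\<^sup>2 * ?R * (16 / (1 - b)\<^sup>2 * (real (card V))\<^sup>2) = ?R"
    unfolding * by simp
  ultimately show ?thesis by simp
qed

end

theorem overlap_moments:
  fixes b :: real
  assumes "b < 1"
  obtains C where "0 \<le> C"
    "\<And>(V :: 'v set) (s :: real). finite V \<Longrightarrow> s\<^sup>2 * card V \<le> b \<Longrightarrow>
      (\<integral>G. avg2 s V G (\<lambda>\<sigma> \<tau>. (overlap V \<sigma> \<tau>)\<^sup>2) \<partial>gaussian (edges V)) \<le> C * real (card V)"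
    "\<And>(V :: 'v set) (s :: real). finite V \<Longrightarrow> s\<^sup>2 * card V \<le> b \<Longrightarrow>
      (\<integral>G. avg2 s V G (\<lambda>\<sigma> \<tau>. (overlap V \<sigma> \<tau>) ^ 4) \<partial>gaussian (edges V)) \<le> C * (real (card V))\<^sup>2"
proof -
  \<comment> \<open>The constants are repeated outside the locale because they must be fixed before
    \<open>V\<close> and \<open>s\<close> are chosen.\<close>
  define K where "K = sqrt (2 / (1 - b))"
  define C1 where "C1 = 8 / (1 - b) * (K + 192 * K / (1 - b) + (1 - b) / (192 * K) * (2 + 192 * K))"
  define C2 where "C2 = 16 / (1 - b)\<^sup>2 * (4 + 16 * K + 16 * (2 + (8 * K + 1) * (3 * C1 + 24)))"
  show ?thesis
  proof (rule that[of "max 0 (max C1 C2)"])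
    fix V :: "'v set" and s :: real
    assume V: "finite V" "s\<^sup>2 * card V \<le> b"
    show "(\<integral>G. avg2 s V G (\<lambda>\<sigma> \<tau>. (overlap V \<sigma> \<tau>)\<^sup>2) \<partial>gaussian (edges V)) \<le> max 0 (max C1 C2) * real (card V)"
    proof (cases "V = {}")
      case True
      then show ?thesis by (simp add: overlap_def)
    next
      case False
      then interpret H: high_temperature V s b
        using V assms by unfold_locales
      have "H.C1 = C1" by (simp add: H.C1_def C1_def H.K_def K_def)
      then have "(\<integral>G. avg2 s V G (\<lambda>\<sigma> \<tau>. (overlap V \<sigma> \<tau>)\<^sup>2) \<partial>gaussian (edges V)) \<le> C1 * real (card V)"
        using H.overlap_square_moment by simp
      also have "\<dots> \<le> max 0 (max C1 C2) * real (card V)" by (intro mult_right_mono) auto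
      finally show ?thesis .
    qed
    show "(\<integral>G. avg2 s V G (\<lambda>\<sigma> \<tau>. (overlap V \<sigma> \<tau>) ^ 4) \<partial>gaussian (edges V)) \<le> max 0 (max C1 C2) * (real (card V))\<^sup>2"
    proof (cases "V = {}")
      case True
      then show ?thesis by (simp add: overlap_def)
    next
      case False
      then interpret H: high_temperature V s b
        using V assms by unfold_locales
      have "H.C2 = C2" by (simp add: H.C1_def C1_def H.K_def K_def C2_def H.C2_def)
      then have "(\<integral>G. avg2 s V G (\<lambda>\<sigma> \<tau>. (overlap V \<sigma> \<tau>) ^ 4) \<partial>gaussian (edges V)) \<le> C2 * (real (card V))\<^sup>2"
        using H.overlap_fourth_moment by simp
      also have "\<dots> \<le> max 0 (max C1 C2) * (real (card V))\<^sup>2" by (intro mult_right_mono) auto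
      finally show ?thesis .
    qed
  qed simp
qed

section \<open>The cavity method\<close>

lemma weight_cong:
  assumes "\<And>e. e \<in> edges V \<Longrightarrow> G e = G' e"
  shows "weight s V G = weight s V G'"
  unfolding weight_def hamiltonian_def using assms by (intro ext arg_cong[where f = "\<lambda>x. exp (s * x)"] sum.cong) auto

lemma avg_cong_disorder:
  assumes "\<And>e. e \<in> edges V \<Longrightarrow> G e = G' e"
  shows "avg s V G = avg s V G'"
  by (intro ext) (simp add: avg_def partition_fn_def weight_cong[OF assms])

definition cavity_field :: "real \<Rightarrow> 'v set \<Rightarrow> 'v \<Rightarrow> ('v set \<Rightarrow> real) \<Rightarrow> ('v \<Rightarrow> real) \<Rightarrow> real" where
  "cavity_field s V i G \<sigma> = s * (\<Sum>k\<in>V. G {i, k} * \<sigma> k)"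

lemma weight_insert:
  assumes "finite V" "i \<notin> V"
  shows "weight s (insert i V) G (\<sigma>(i := \<epsilon>)) = weight s V G \<sigma> * exp (\<epsilon> * cavity_field s V i G \<sigma>)"
proof -
  have "prod (\<sigma>(i := \<epsilon>)) e = prod \<sigma> e" if "e \<in> edges V" for e
    using that assms(2) by (intro prod.cong) (auto simp: edges_def)
  moreover have "prod (\<sigma>(i := \<epsilon>)) {i, k} = \<epsilon> * \<sigma> k" if "k \<in> V" for k
    using that assms(2) by (subst prod.insert) auto
  ultimately have "hamiltonian (insert i V) G (\<sigma>(i := \<epsilon>))
    = hamiltonian V G \<sigma> + \<epsilon> * (\<Sum>k\<in>V. G {i, k} * \<sigma> k)"
    using assms by (simp add: hamiltonian_def sum_edges_insert sum_distrib_left mult_ac del: fun_upd_apply)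
  then show ?thesis
    by (simp add: weight_def cavity_field_def distrib_left mult_ac flip: exp_add)
qed

lemma sum_configs_insert:
  assumes "finite V" "i \<notin> V"
  shows "(\<Sum>\<sigma>\<in>configs (insert i V). F \<sigma>) = (\<Sum>\<sigma>\<in>configs V. F (\<sigma>(i := 1)) + F (\<sigma>(i := -1)))"
proof -
  have "(\<Sum>\<sigma>\<in>configs (insert i V). F \<sigma>) = (\<Sum>(y, \<sigma>)\<in>{-1, 1} \<times> configs V. F (\<sigma>(i := y)))"
    unfolding configs_def PiE_insert_eq
    using inj_combinator[OF assms(2), of "\<lambda>_. {-1, 1 :: real}"]
    by (subst sum.reindex) (auto simp: split_beta' simp del: fun_upd_apply)
  also have "\<dots> = (\<Sum>y\<in>{-1, 1}. \<Sum>\<sigma>\<in>configs V. F (\<sigma>(i := y)))"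
    by (simp add: sum.cartesian_product)
  finally show ?thesis by (simp add: sum.distrib add.commute)
qed

lemma avg_cosh_ge_1: "finite V \<Longrightarrow> 1 \<le> avg s V G (\<lambda>\<sigma>. cosh (f \<sigma>))"
  using avg_mono[of V "\<lambda>_. 1" "\<lambda>\<sigma>. cosh (f \<sigma>)" s G] cosh_real_ge_1 by simp

text \<open>The spin at \<open>i\<close> is summed out. Its two values weight the remaining
  configuration by the exponentials of plus and minus the cavity field, and the partition function
  contributes their mean, a cosh.\<close>

lemma avg_insert:
  assumes "finite V" "i \<notin> V"
  shows "avg s (insert i V) G F
    = avg s V G (\<lambda>\<sigma>. (F (\<sigma>(i := 1)) * exp (cavity_field s V i G \<sigma>) + F (\<sigma>(i := -1)) * exp (- cavity_field s V i G \<sigma>)) / 2)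
      / avg s V G (\<lambda>\<sigma>. cosh (cavity_field s V i G \<sigma>))"
proof -
  let ?h = "cavity_field s V i G"
  have sum: "(\<Sum>\<sigma>\<in>configs (insert i V). F \<sigma> * weight s (insert i V) G \<sigma>)
    = (\<Sum>\<sigma>\<in>configs V. (F (\<sigma>(i := 1)) * exp (?h \<sigma>) + F (\<sigma>(i := -1)) * exp (- ?h \<sigma>)) * weight s V G \<sigma>)" for F
    by (simp add: sum_configs_insert[OF assms] weight_insert[OF assms] algebra_simps del: fun_upd_apply)
  have avg2: "(\<Sum>\<sigma>\<in>configs V. f \<sigma> * weight s V G \<sigma>) = 2 * partition_fn s V G * avg s V G (\<lambda>\<sigma>. f \<sigma> / 2)" for f
    using assms(1) avg_cmult[of s V G "1/2" f] by (simp add: avg_def)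
  have "partition_fn s (insert i V) G = 2 * partition_fn s V G * avg s V G (\<lambda>\<sigma>. cosh (?h \<sigma>))"
    using sum[of "\<lambda>_. 1"] unfolding avg2 by (simp add: partition_fn_def[of s "insert i V"] cosh_def)
  moreover have "(\<Sum>\<sigma>\<in>configs (insert i V). F \<sigma> * weight s (insert i V) G \<sigma>)
    = 2 * partition_fn s V G * avg s V G (\<lambda>\<sigma>. (F (\<sigma>(i := 1)) * exp (?h \<sigma>) + F (\<sigma>(i := -1)) * exp (- ?h \<sigma>)) / 2)"
    unfolding sum avg2 ..
  ultimately show ?thesis
    unfolding avg_def[of s "insert i V"] using assms(1) by simp
qed

text \<open>Summing out the spin at \<open>i\<close> turns \<open>\<sigma> i\<close> into sinh of
  the field and a function of the other spins into cosh. The couplings in the row then reassemble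
  the field itself, as a factor in front of cosh.\<close>

lemma cavity_row:
  assumes V: "finite V" "i \<notin> V" and j: "j \<in> V"
  shows "\<kappa> * avg s (insert i V) G (\<lambda>\<sigma>. \<sigma> i * \<sigma> j) - s * (\<Sum>k\<in>V. G {i, k} * avg s (insert i V) G (\<lambda>\<sigma>. \<sigma> k * \<sigma> j))
    = avg s V G (\<lambda>\<sigma>. \<sigma> j * (\<kappa> * sinh (cavity_field s V i G \<sigma>) - cavity_field s V i G \<sigma> * cosh (cavity_field s V i G \<sigma>)))
      / avg s V G (\<lambda>\<sigma>. cosh (cavity_field s V i G \<sigma>))"
proof -
  let ?h = "cavity_field s V i G"
  let ?D = "avg s V G (\<lambda>\<sigma>. cosh (?h \<sigma>))"
  have ij: "avg s (insert i V) G (\<lambda>\<sigma>. \<sigma> i * \<sigma> j) = avg s V G (\<lambda>\<sigma>. \<sigma> j * sinh (?h \<sigma>)) / ?D"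
    unfolding avg_insert[OF V] using V j
    by (intro arg_cong2[where f = "(/)"] avg_cong) (auto simp: sinh_def algebra_simps diff_divide_distrib)
  have kj: "avg s (insert i V) G (\<lambda>\<sigma>. \<sigma> k * \<sigma> j) = avg s V G (\<lambda>\<sigma>. \<sigma> k * \<sigma> j * cosh (?h \<sigma>)) / ?D" if "k \<in> V" for k
    unfolding avg_insert[OF V] using V j that
    by (intro arg_cong2[where f = "(/)"] avg_cong) (auto simp: cosh_def algebra_simps add_divide_distrib)
  have "s * (\<Sum>k\<in>V. G {i, k} * avg s (insert i V) G (\<lambda>\<sigma>. \<sigma> k * \<sigma> j))
    = avg s V G (\<lambda>\<sigma>. s * (\<Sum>k\<in>V. G {i, k} * (\<sigma> k * \<sigma> j * cosh (?h \<sigma>)))) / ?D"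
    by (simp add: kj avg_cmult avg_sum flip: sum_divide_distrib)
  also have "(\<lambda>\<sigma>. s * (\<Sum>k\<in>V. G {i, k} * (\<sigma> k * \<sigma> j * cosh (?h \<sigma>)))) = (\<lambda>\<sigma>. \<sigma> j * (?h \<sigma> * cosh (?h \<sigma>)))"
    by (simp add: cavity_field_def sum_distrib_left sum_distrib_right mult_ac)
  finally have row: "s * (\<Sum>k\<in>V. G {i, k} * avg s (insert i V) G (\<lambda>\<sigma>. \<sigma> k * \<sigma> j))
    = avg s V G (\<lambda>\<sigma>. \<sigma> j * (?h \<sigma> * cosh (?h \<sigma>))) / ?D" .
  have "(\<lambda>\<sigma>. \<sigma> j * (\<kappa> * sinh (?h \<sigma>) - ?h \<sigma> * cosh (?h \<sigma>)))
    = (\<lambda>\<sigma>. \<kappa> * (\<sigma> j * sinh (?h \<sigma>)) - \<sigma> j * (?h \<sigma> * cosh (?h \<sigma>)))"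
    by (simp add: algebra_simps)
  then show ?thesis
    by (simp add: ij row avg_diff avg_cmult diff_divide_distrib)
qed

text \<open>For the column of the removed spin, each product \<open>\<sigma> k * \<sigma> i\<close>
  contains that spin once, so here the reassembled field multiplies sinh.\<close>

lemma cavity_diagonal:
  assumes V: "finite V" "i \<notin> V"
  shows "\<kappa> - s * (\<Sum>k\<in>V. G {i, k} * avg s (insert i V) G (\<lambda>\<sigma>. \<sigma> k * \<sigma> i))
    = avg s V G (\<lambda>\<sigma>. \<kappa> * cosh (cavity_field s V i G \<sigma>) - cavity_field s V i G \<sigma> * sinh (cavity_field s V i G \<sigma>))
      / avg s V G (\<lambda>\<sigma>. cosh (cavity_field s V i G \<sigma>))"
proof -
  let ?h = "cavity_field s V i G"
  let ?D = "avg s V G (\<lambda>\<sigma>. cosh (?h \<sigma>))"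
  have D: "?D \<noteq> 0" using avg_cosh_ge_1[OF V(1), of s G ?h] by linarith
  have ki: "avg s (insert i V) G (\<lambda>\<sigma>. \<sigma> k * \<sigma> i) = avg s V G (\<lambda>\<sigma>. \<sigma> k * sinh (?h \<sigma>)) / ?D" if "k \<in> V" for k
    unfolding avg_insert[OF V] using V that
    by (intro arg_cong2[where f = "(/)"] avg_cong) (auto simp: sinh_def algebra_simps diff_divide_distrib)
  have "s * (\<Sum>k\<in>V. G {i, k} * avg s (insert i V) G (\<lambda>\<sigma>. \<sigma> k * \<sigma> i))
    = avg s V G (\<lambda>\<sigma>. s * (\<Sum>k\<in>V. G {i, k} * (\<sigma> k * sinh (?h \<sigma>)))) / ?D"
    by (simp add: ki avg_cmult avg_sum flip: sum_divide_distrib)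
  also have "(\<lambda>\<sigma>. s * (\<Sum>k\<in>V. G {i, k} * (\<sigma> k * sinh (?h \<sigma>)))) = (\<lambda>\<sigma>. ?h \<sigma> * sinh (?h \<sigma>))"
    by (simp add: cavity_field_def sum_distrib_left sum_distrib_right mult_ac)
  finally show ?thesis
    using D by (simp add: avg_diff diff_divide_distrib avg_cmult)
qed

section \<open>Bounds for the integrated cavity terms\<close>

lemma cosh_le_2_sinh_le:
  fixes r :: real
  assumes "\<bar>r\<bar> \<le> 1"
  shows "cosh r \<le> 2" "\<bar>sinh r\<bar> \<le> 2 * \<bar>r\<bar>"
proof -
  have r2: "r\<^sup>2 \<le> 1" using assms by (simp add: abs_square_le_1)
  then have "exp (r\<^sup>2 / 2) \<le> 1 + r\<^sup>2 / 2 + (r\<^sup>2 / 2)\<^sup>2"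
    by (intro exp_bound) auto
  moreover have "(r\<^sup>2 / 2)\<^sup>2 \<le> 1 / 4" using r2 power_mono[of "r\<^sup>2 / 2" "1 / 2" 2] by (simp add: power_divide)
  moreover note r2
  ultimately show c: "cosh r \<le> 2" using cosh_le_exp_square[of r] by linarith
  have "sinh r = tanh r * cosh r" by (simp add: tanh_def)
  then have "\<bar>sinh r\<bar> = \<bar>tanh r\<bar> * cosh r" by (simp add: abs_mult)
  also have "\<dots> \<le> \<bar>r\<bar> * 2" using abs_tanh_le[of r] c by (intro mult_mono) auto
  finally show "\<bar>sinh r\<bar> \<le> 2 * \<bar>r\<bar>" by simp
qed

text \<open>The linear terms cancel: \<open>x * cosh x - sinh x\<close> has derivative
  \<open>x * sinh x\<close>, which is of second order at 0.\<close>

lemma abs_sinh_minus_id_cosh_le: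
  fixes r :: real
  assumes "\<bar>r\<bar> \<le> 1"
  shows "\<bar>sinh r - r * cosh r\<bar> \<le> 2 * \<bar>r\<bar> ^ 3"
proof -
  have pos: "\<bar>sinh y - y * cosh y\<bar> \<le> 2 * y ^ 3" if y: "0 \<le> y" "y \<le> 1" for y :: real
  proof -
    have "(\<lambda>x. 2 * x ^ 3 - (x * cosh x - sinh x)) 0 \<le> (\<lambda>x. 2 * x ^ 3 - (x * cosh x - sinh x)) y"
    proof (rule DERIV_nonneg_imp_nondecreasing[OF y(1)])
      fix x :: real assume x: "0 \<le> x" "x \<le> y"
      have "x * sinh x \<le> x * (2 * x)" using cosh_le_2_sinh_le(2)[of x] x y by (intro mult_left_mono) auto
      also have "\<dots> \<le> 6 * x\<^sup>2" by (simp add: power2_eq_square)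
      finally have "0 \<le> 6 * x\<^sup>2 - x * sinh x" by simp
      moreover have "((\<lambda>x. 2 * x ^ 3 - (x * cosh x - sinh x)) has_real_derivative (6 * x\<^sup>2 - x * sinh x)) (at x)"
        by (auto intro!: derivative_eq_intros)
      ultimately show "\<exists>d. ((\<lambda>x. 2 * x ^ 3 - (x * cosh x - sinh x)) has_real_derivative d) (at x) \<and> 0 \<le> d"
        by blast
    qed
    moreover have "sinh y \<le> y * cosh y"
      using abs_tanh_le[of y] y(1) cosh_real_pos[of y] by (simp add: tanh_def divide_le_eq)
    ultimately show ?thesis by simp
  qed
  show ?thesis
  proof (cases "0 \<le> r")
    case False
    then have "\<bar>sinh (- r) - (- r) * cosh (- r)\<bar> \<le> 2 * (- r) ^ 3" using assms by (intro pos) auto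
    then show ?thesis using False by (simp add: abs_minus_commute)
  qed (use pos[of r] assms in auto)
qed

text \<open>
  With \<open>1 + \<delta>\<close> for \<open>1 + \<beta>\<^sup>2 - v\<close>, the contribution linear in \<open>\<rho>\<close> carries the factor \<open>\<delta>\<^sup>2\<close>, and \<open>\<delta> = \<beta>\<^sup>2 / n\<close>.
  This cancellation is specific to the coefficient \<open>1 + \<beta>\<^sup>2\<close> in the theorem.
\<close>

lemma cavity_odd_bound:
  fixes \<rho> \<delta> v :: real
  assumes "\<bar>\<rho>\<bar> \<le> 1" "0 \<le> \<delta>" "\<delta> \<le> 1" "v \<le> 1"
  shows "\<bar>exp v * (exp \<rho> * ((1 + \<delta> - \<rho>)\<^sup>2 + \<rho>) - exp (- \<rho>) * ((1 + \<delta> + \<rho>)\<^sup>2 - \<rho>)) / 2\<bar>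
    \<le> 32 * \<bar>\<rho>\<bar> ^ 3 + 8 * \<delta>\<^sup>2 * \<bar>\<rho>\<bar>"
proof -
  \<comment> \<open>Sorting by sinh and cosh isolates
    \<open>sinh \<rho> - \<rho> * cosh \<rho>\<close>, which is of third order; only
    \<open>\<delta>\<^sup>2 * sinh \<rho>\<close> retains a linear part.\<close>
  have "exp \<rho> * ((1 + \<delta> - \<rho>)\<^sup>2 + \<rho>) - exp (- \<rho>) * ((1 + \<delta> + \<rho>)\<^sup>2 - \<rho>)
    = 2 * (1 + 2 * \<delta>) * (sinh \<rho> - \<rho> * cosh \<rho>) + 2 * (\<delta>\<^sup>2 + \<rho>\<^sup>2) * sinh \<rho>"
    unfolding sinh_def cosh_def by (simp add: power2_eq_square field_simps)
  also have "\<bar>\<dots>\<bar> \<le> \<bar>2 * (1 + 2 * \<delta>) * (sinh \<rho> - \<rho> * cosh \<rho>)\<bar> + \<bar>2 * (\<delta>\<^sup>2 + \<rho>\<^sup>2) * sinh \<rho>\<bar>"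
    by (rule abs_triangle_ineq)
  also have "\<bar>2 * (1 + 2 * \<delta>) * (sinh \<rho> - \<rho> * cosh \<rho>)\<bar> \<le> 6 * (2 * \<bar>\<rho>\<bar> ^ 3)"
    unfolding abs_mult using assms abs_sinh_minus_id_cosh_le[OF assms(1)] by (intro mult_mono) auto
  also have "\<bar>2 * (\<delta>\<^sup>2 + \<rho>\<^sup>2) * sinh \<rho>\<bar> \<le> 2 * (\<delta>\<^sup>2 + \<rho>\<^sup>2) * (2 * \<bar>\<rho>\<bar>)"
    unfolding abs_mult using cosh_le_2_sinh_le(2)[OF assms(1)] by (intro mult_mono) auto
  also have "6 * (2 * \<bar>\<rho>\<bar> ^ 3) + 2 * (\<delta>\<^sup>2 + \<rho>\<^sup>2) * (2 * \<bar>\<rho>\<bar>) = 16 * \<bar>\<rho>\<bar> ^ 3 + 4 * \<delta>\<^sup>2 * \<bar>\<rho>\<bar>"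
    by (simp add: power2_eq_square power3_eq_cube abs_if algebra_simps)
  finally have *: "\<bar>exp \<rho> * ((1 + \<delta> - \<rho>)\<^sup>2 + \<rho>) - exp (- \<rho>) * ((1 + \<delta> + \<rho>)\<^sup>2 - \<rho>)\<bar>
    \<le> 16 * \<bar>\<rho>\<bar> ^ 3 + 4 * \<delta>\<^sup>2 * \<bar>\<rho>\<bar>" by simp
  have "exp v \<le> exp 1" using assms by simp
  then have "exp v \<le> 4" using exp_le by linarith
  then have "exp v * \<bar>exp \<rho> * ((1 + \<delta> - \<rho>)\<^sup>2 + \<rho>) - exp (- \<rho>) * ((1 + \<delta> + \<rho>)\<^sup>2 - \<rho>)\<bar>
    \<le> 4 * (16 * \<bar>\<rho>\<bar> ^ 3 + 4 * \<delta>\<^sup>2 * \<bar>\<rho>\<bar>)"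
    using * by (intro mult_mono) auto
  then show ?thesis by (simp add: abs_mult)
qed

text \<open>The expression is even in \<open>\<rho>\<close>, so besides the constant of order
  \<open>\<delta>\<^sup>2\<close> only terms of order \<open>\<rho>\<^sup>2\<close> appear.\<close>

lemma cavity_even_bound:
  fixes \<rho> \<delta> v :: real
  assumes "\<bar>\<rho>\<bar> \<le> 1" "0 \<le> \<delta>" "\<delta> \<le> 1" "v \<le> 1"
  shows "exp v * (exp \<rho> * ((\<delta> - \<rho>)\<^sup>2 + \<rho>) + exp (- \<rho>) * ((\<delta> + \<rho>)\<^sup>2 - \<rho>)) / 2
    \<le> 8 * \<delta>\<^sup>2 + 16 * \<rho>\<^sup>2"
proof -
  have "exp \<rho> * ((\<delta> - \<rho>)\<^sup>2 + \<rho>) + exp (- \<rho>) * ((\<delta> + \<rho>)\<^sup>2 - \<rho>)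
    = 2 * (\<delta>\<^sup>2 + \<rho>\<^sup>2) * cosh \<rho> + 2 * (1 - 2 * \<delta>) * (\<rho> * sinh \<rho>)"
    unfolding sinh_def cosh_def by (simp add: power2_eq_square field_simps)
  also have "2 * (\<delta>\<^sup>2 + \<rho>\<^sup>2) * cosh \<rho> \<le> 2 * (\<delta>\<^sup>2 + \<rho>\<^sup>2) * 2"
    using cosh_le_2_sinh_le(1)[OF assms(1)] by (intro mult_left_mono) auto
  also have "2 * (1 - 2 * \<delta>) * (\<rho> * sinh \<rho>) \<le> 2 * (\<bar>\<rho>\<bar> * (2 * \<bar>\<rho>\<bar>))"
  proof -
    have "2 * (1 - 2 * \<delta>) * (\<rho> * sinh \<rho>) \<le> \<bar>2 * (1 - 2 * \<delta>)\<bar> * (\<bar>\<rho>\<bar> * \<bar>sinh \<rho>\<bar>)"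
      unfolding abs_mult[symmetric] by (rule abs_ge_self)
    also have "\<dots> \<le> 2 * (\<bar>\<rho>\<bar> * (2 * \<bar>\<rho>\<bar>))"
      using assms cosh_le_2_sinh_le(2)[OF assms(1)] by (intro mult_mono) auto
    finally show ?thesis .
  qed
  finally have *: "exp \<rho> * ((\<delta> - \<rho>)\<^sup>2 + \<rho>) + exp (- \<rho>) * ((\<delta> + \<rho>)\<^sup>2 - \<rho>) \<le> 4 * \<delta>\<^sup>2 + 8 * \<rho>\<^sup>2"
    by (simp add: power2_eq_square algebra_simps)
  have "exp v \<le> exp 1" using assms by simp
  then have "exp v \<le> 4" using exp_le by linarith
  have "exp v * (exp \<rho> * ((\<delta> - \<rho>)\<^sup>2 + \<rho>) + exp (- \<rho>) * ((\<delta> + \<rho>)\<^sup>2 - \<rho>)) \<le> exp v * (4 * \<delta>\<^sup>2 + 8 * \<rho>\<^sup>2)"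
    using * by (intro mult_left_mono) auto
  also have "\<dots> \<le> 4 * (4 * \<delta>\<^sup>2 + 8 * \<rho>\<^sup>2)"
    using \<open>exp v \<le> 4\<close> by (intro mult_right_mono) auto
  finally show ?thesis by simp
qed

text \<open>Exchangeability of the sites holds only after averaging over the disorder. Swapping two
  sites preserves the law of the couplings and the overlap, and carries the Gibbs measure of the
  permuted disorder to the original one.\<close>

lemma expectation_avg2_transpose:
  fixes a b :: 'v
  assumes V: "finite V" and ab: "a \<in> V" "b \<in> V"
  shows "(\<integral>G. avg2 s V G (\<lambda>\<sigma> \<tau>. \<sigma> a * \<tau> a * F (overlap V \<sigma> \<tau>)) \<partial>gaussian (edges V))
    = (\<integral>G. avg2 s V G (\<lambda>\<sigma> \<tau>. \<sigma> b * \<tau> b * F (overlap V \<sigma> \<tau>)) \<partial>gaussian (edges V))"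
proof -
  let ?\<pi> = "Transposition.transpose a b"
  let ?R = "\<lambda>G. \<lambda>e\<in>edges V. G (?\<pi> ` e)"
  define T :: "('v \<Rightarrow> real) \<Rightarrow> 'v \<Rightarrow> real" where "T \<sigma> = (\<lambda>k\<in>V. \<sigma> (?\<pi> k))" for \<sigma>
  have \<pi>V: "?\<pi> k \<in> V" if "k \<in> V" for k using that ab by (auto simp: Transposition.transpose_def)
  have \<pi>e: "?\<pi> ` e \<in> edges V" if "e \<in> edges V" for e
    using that \<pi>V by (auto simp: edges_def card_image)
  have \<pi>\<pi>: "?\<pi> ` (?\<pi> ` e) = e" for e by (simp add: image_image)
  have bij: "bij_betw ((`) ?\<pi>) (edges V) (edges V)"
    by (rule bij_betwI[where g = "(`) ?\<pi>"]) (auto simp: \<pi>e \<pi>\<pi>)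
  have T: "T \<sigma> \<in> configs V" if "\<sigma> \<in> configs V" for \<sigma>
    using that \<pi>V by (auto simp: T_def configs_def PiE_iff)
  have TT: "T (T \<sigma>) = \<sigma>" if "\<sigma> \<in> configs V" for \<sigma>
    using that \<pi>V by (auto simp: T_def configs_def PiE_iff extensional_def)
  have ham: "hamiltonian V (?R G) \<sigma> = hamiltonian V G (T \<sigma>)" for G \<sigma>
  proof -
    have "hamiltonian V G (T \<sigma>) = (\<Sum>e\<in>edges V. G (?\<pi> ` e) * prod (T \<sigma>) (?\<pi> ` e))"
      unfolding hamiltonian_def by (rule sum.reindex_bij_betw[OF bij, symmetric])
    also have "\<dots> = (\<Sum>e\<in>edges V. ?R G e * prod \<sigma> e)"
    proof (intro sum.cong refl)
      fix e assume e: "e \<in> edges V"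
      then have "prod (T \<sigma>) (?\<pi> ` e) = prod \<sigma> e"
        using \<pi>V by (subst prod.reindex) (auto simp: T_def edges_def intro!: prod.cong)
      then show "G (?\<pi> ` e) * prod (T \<sigma>) (?\<pi> ` e) = ?R G e * prod \<sigma> e" using e by simp
    qed
    finally show ?thesis by (simp add: hamiltonian_def)
  qed
  have swap: "(\<Sum>\<sigma>\<in>configs V. f \<sigma>) = (\<Sum>\<sigma>\<in>configs V. f (T \<sigma>))" for f :: "_ \<Rightarrow> real"
    by (rule sum.reindex_bij_witness[where i = T and j = T]) (auto simp: T TT)
  have avgR: "avg s V (?R G) f = avg s V G (\<lambda>\<sigma>. f (T \<sigma>))" for G f
  proof -
    have "(\<Sum>\<sigma>\<in>configs V. f \<sigma> * weight s V (?R G) \<sigma>) = (\<Sum>\<sigma>\<in>configs V. f (T \<sigma>) * weight s V G \<sigma>)" for f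
      unfolding weight_def ham by (subst swap) (simp add: TT)
    from this[of f] this[of "\<lambda>_. 1"] show ?thesis by (simp add: avg_def partition_fn_def)
  qed
  have ov: "overlap V (T \<sigma>) (T \<tau>) = overlap V \<sigma> \<tau>" for \<sigma> \<tau>
    unfolding overlap_def T_def
    by (rule sum.reindex_bij_witness[where i = ?\<pi> and j = ?\<pi>]) (auto simp: \<pi>V)
  have "distr (gaussian (edges V)) (gaussian (edges V)) ?R = gaussian (edges V)"
    unfolding gaussian_def using \<pi>e bij_betw_imp_inj_on[OF bij]
    by (intro distr_PiM_reindex) (auto intro: std_normal_prob.prob_space_axioms)
  moreover have "?R \<in> measurable (gaussian (edges V)) (gaussian (edges V))"
    unfolding gaussian_def using \<pi>e
    by (intro measurable_restrict measurable_component_singleton) auto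
  ultimately have "(\<integral>G. H G \<partial>gaussian (edges V)) = (\<integral>G. H (?R G) \<partial>gaussian (edges V))"
    if "H \<in> borel_measurable (gaussian (edges V))" for H :: "_ \<Rightarrow> real"
    using integral_distr[OF _ that, of ?R "gaussian (edges V)"] by simp
  note this[OF measurable_avg2[OF V], of s "\<lambda>\<sigma> \<tau>. \<sigma> a * \<tau> a * F (overlap V \<sigma> \<tau>)"]
  moreover have "T \<sigma> a = \<sigma> b" for \<sigma> by (simp add: T_def ab)
  then have "avg2 s V (?R G) (\<lambda>\<sigma> \<tau>. \<sigma> a * \<tau> a * F (overlap V \<sigma> \<tau>))
    = avg2 s V G (\<lambda>\<sigma> \<tau>. \<sigma> b * \<tau> b * F (overlap V \<sigma> \<tau>))" for G
    unfolding avg2_def avgR by (simp only: ov)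
  ultimately show ?thesis by simp
qed

section \<open>Integrating out the couplings of one site\<close>

abbreviation star :: "'v set \<Rightarrow> 'v \<Rightarrow> 'v set set" where
  "star V i \<equiv> (\<lambda>k. {i, k}) ` V"

lemma integral_gaussian_insert:
  fixes f :: "('v set \<Rightarrow> real) \<Rightarrow> real"
  assumes V: "finite V" "i \<notin> V" and f: "integrable (gaussian (edges (insert i V))) f"
  shows "(\<integral>G. f G \<partial>gaussian (edges (insert i V)))
    = (\<integral>x. (\<integral>y. f (merge (edges V) (star V i) (x, y)) \<partial>gaussian (star V i)) \<partial>gaussian (edges V))"
  using f V unfolding gaussian_def edges_insert[OF V(2)]
  by (intro std_normal.product_integral_fold edges_insert_disjoint) auto

lemma cavity_field_merge:
  assumes "i \<notin> V"
  shows "cavity_field s V i (merge (edges V) (star V i) (x, y)) = cavity_field s V i y"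
proof -
  have "{i, k} \<notin> edges V" for k using assms by (auto simp: edges_def)
  then show ?thesis by (auto simp: cavity_field_def merge_def intro!: ext sum.cong)
qed

lemma avg_merge: "avg s V (merge (edges V) J (x, y)) = avg s V x"
  by (intro avg_cong_disorder) (auto simp: merge_def)

text \<open>
  The denominator \<open>\<langle>cosh h\<rangle>\<close> is at least 1 and is simply dropped; the square of the numerator is then an
  average over two replicas, in which the Gaussian field can be integrated out.
\<close>

lemma cavity_second_moment:
  assumes V: "finite V" "i \<notin> V"
    and int: "integrable (gaussian (edges (insert i V)))
      (\<lambda>G. (avg s V G (\<lambda>\<sigma>. f \<sigma> (cavity_field s V i G \<sigma>)) / avg s V G (\<lambda>\<sigma>. cosh (cavity_field s V i G \<sigma>)))\<^sup>2)"
    and \<Phi>: "\<And>\<sigma> \<tau>. \<sigma> \<in> configs V \<Longrightarrow> \<tau> \<in> configs V \<Longrightarrow> has_bochner_integral (gaussian (star V i))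
      (\<lambda>y. f \<sigma> (cavity_field s V i y \<sigma>) * f \<tau> (cavity_field s V i y \<tau>)) (\<Phi> \<sigma> \<tau>)"
  shows "(\<integral>G. (avg s V G (\<lambda>\<sigma>. f \<sigma> (cavity_field s V i G \<sigma>)) / avg s V G (\<lambda>\<sigma>. cosh (cavity_field s V i G \<sigma>)))\<^sup>2
      \<partial>gaussian (edges (insert i V))) \<le> (\<integral>G. avg2 s V G \<Phi> \<partial>gaussian (edges V))"
proof -
  let ?N = "\<lambda>x y. avg s V x (\<lambda>\<sigma>. f \<sigma> (cavity_field s V i y \<sigma>))"
  let ?D = "\<lambda>x y. avg s V x (\<lambda>\<sigma>. cosh (cavity_field s V i y \<sigma>))"
  have N: "has_bochner_integral (gaussian (star V i)) (\<lambda>y. (?N x y)\<^sup>2) (avg2 s V x \<Phi>)" for x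
  proof -
    have "(?N x y)\<^sup>2 = avg2 s V x (\<lambda>\<sigma> \<tau>. f \<sigma> (cavity_field s V i y \<sigma>) * f \<tau> (cavity_field s V i y \<tau>))" for y
      using avg2_product[of s V x "\<lambda>\<sigma>. f \<sigma> (cavity_field s V i y \<sigma>)" "\<lambda>\<tau>. f \<tau> (cavity_field s V i y \<tau>)"]
      by (simp add: power2_eq_square)
    then show ?thesis
      unfolding avg2_eq_sum
      by (simp only:) (intro has_bochner_integral_divide has_bochner_integral_sum has_bochner_integral_mult_left \<Phi>)
  qed
  have "(?N x y / ?D x y)\<^sup>2 \<le> (?N x y)\<^sup>2" for x y
  proof -
    have "1 \<le> ?D x y" by (rule avg_cosh_ge_1[OF V(1)])
    then have "1 \<le> (?D x y)\<^sup>2" by (simp add: one_le_power)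
    then have "(?N x y)\<^sup>2 / (?D x y)\<^sup>2 \<le> (?N x y)\<^sup>2 / 1" by (intro divide_left_mono) auto
    then show ?thesis by (simp add: power_divide)
  qed
  then have inner: "(\<integral>y. (?N x y / ?D x y)\<^sup>2 \<partial>gaussian (star V i)) \<le> avg2 s V x \<Phi>" for x
    using N[of x] integral_mono'[of "gaussian (star V i)" "\<lambda>y. (?N x y)\<^sup>2" "\<lambda>y. (?N x y / ?D x y)\<^sup>2"]
    by (auto simp: has_bochner_integral_iff)
  have nonneg: "0 \<le> avg2 s V x \<Phi>" for x
    unfolding has_bochner_integral_integral_eq[OF N[of x], symmetric] by simp
  interpret prob_space "gaussian (edges V)" by (rule prob_space_gaussian)
  \<comment> \<open>There are finitely many configurations, so this crude sum bounds
    \<open>\<Phi>\<close> and makes the replica average integrable.\<close>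
  define B where "B = (\<Sum>\<sigma>\<in>configs V. \<Sum>\<tau>\<in>configs V. \<bar>\<Phi> \<sigma> \<tau>\<bar>)"
  have "\<bar>\<Phi> \<sigma> \<tau>\<bar> \<le> B" if "\<sigma> \<in> configs V" "\<tau> \<in> configs V" for \<sigma> \<tau>
  proof -
    have "\<bar>\<Phi> \<sigma> \<tau>\<bar> \<le> (\<Sum>\<tau>\<in>configs V. \<bar>\<Phi> \<sigma> \<tau>\<bar>)"
      using that V by (intro member_le_sum) auto
    also have "\<dots> \<le> B" unfolding B_def
      using that V by (intro member_le_sum[of \<sigma> _ "\<lambda>\<sigma>. \<Sum>\<tau>\<in>configs V. \<bar>\<Phi> \<sigma> \<tau>\<bar>"]) (auto intro: sum_nonneg)
    finally show ?thesis .
  qed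
  then have "integrable (gaussian (edges V)) (\<lambda>G. avg2 s V G \<Phi>)"
    using avg2_abs_le[OF V(1), of \<Phi> B] V(1) by (intro integrable_bounded[of _ B]) auto
  then have "(\<integral>x. (\<integral>y. (?N x y / ?D x y)\<^sup>2 \<partial>gaussian (star V i)) \<partial>gaussian (edges V))
    \<le> (\<integral>x. avg2 s V x \<Phi> \<partial>gaussian (edges V))"
    using inner nonneg by (intro integral_mono') auto
  then show ?thesis
    unfolding integral_gaussian_insert[OF V int] by (simp add: avg_merge cavity_field_merge[OF V(2)])
qed

text \<open>The field as a linear form in the couplings at \<open>i\<close>. Its coefficients are
  indexed by edges, and \<open>prod \<sigma> (e - {i})\<close> recovers the spin at the other
  endpoint. The second identity gives the covariance of the fields seen by two replicas.\<close>

lemma cavity_field_star: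
  assumes V: "finite V" "i \<notin> V"
  shows "cavity_field s V i y \<sigma> = (\<Sum>e\<in>star V i. (s * prod \<sigma> (e - {i})) * y e)"
    and "(\<Sum>e\<in>star V i. (s * prod \<sigma> (e - {i})) * (s * prod \<tau> (e - {i}))) = s\<^sup>2 * overlap V \<sigma> \<tau>"
proof -
  have p: "prod \<rho> ({i, k} - {i}) = \<rho> k" if "k \<in> V" for k and \<rho> :: "'a \<Rightarrow> real"
  proof -
    have "{i, k} - {i} = {k}" using that V by auto
    then show ?thesis by simp
  qed
  have star: "(\<Sum>e\<in>star V i. f e) = (\<Sum>k\<in>V. f {i, k})" for f :: "_ \<Rightarrow> real"
    by (subst sum.reindex[OF inj_on_star]) simp
  have "(\<Sum>e\<in>star V i. (s * prod \<sigma> (e - {i})) * y e) = (\<Sum>k\<in>V. s * \<sigma> k * y {i, k})"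
    unfolding star by (intro sum.cong refl) (simp only: p)
  then show "cavity_field s V i y \<sigma> = (\<Sum>e\<in>star V i. (s * prod \<sigma> (e - {i})) * y e)"
    by (simp add: cavity_field_def sum_distrib_left mult_ac)
  have "(\<Sum>e\<in>star V i. (s * prod \<sigma> (e - {i})) * (s * prod \<tau> (e - {i}))) = (\<Sum>k\<in>V. s * \<sigma> k * (s * \<tau> k))"
    unfolding star by (intro sum.cong refl) (simp only: p)
  then show "(\<Sum>e\<in>star V i. (s * prod \<sigma> (e - {i})) * (s * prod \<tau> (e - {i}))) = s\<^sup>2 * overlap V \<sigma> \<tau>"
    by (simp add: overlap_def sum_distrib_left power2_eq_square mult_ac)
qed

lemma overlap_self: "\<sigma> \<in> configs V \<Longrightarrow> overlap V \<sigma> \<sigma> = card V"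
  by (simp add: overlap_def config_square)

lemma cavity_field_squares:
  assumes V: "finite V" "i \<notin> V" and "\<sigma> \<in> configs V"
  shows "(\<Sum>e\<in>star V i. (s * prod \<sigma> (e - {i}))\<^sup>2) = s\<^sup>2 * card V"
  using cavity_field_star(2)[OF V, of s \<sigma> \<sigma>] assms(3) by (simp add: power2_eq_square overlap_self)

text \<open>The Gibbs averages are bounded, so Cauchy-Schwarz leaves a constant plus a sum of
  squared Gaussian couplings as an integrable majorant.\<close>

lemma integrable_cavity_row:
  assumes V: "finite V" "i \<notin> V"
    and [measurable]: "a \<in> borel_measurable (gaussian (edges (insert i V)))"
      "\<And>k. k \<in> V \<Longrightarrow> c k \<in> borel_measurable (gaussian (edges (insert i V)))"
    and a: "\<And>G. \<bar>a G\<bar> \<le> A" and c: "\<And>k G. k \<in> V \<Longrightarrow> \<bar>c k G\<bar> \<le> 1"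
  shows "integrable (gaussian (edges (insert i V))) (\<lambda>G. (a G - s * (\<Sum>k\<in>V. G {i, k} * c k G))\<^sup>2)"
proof -
  let ?M = "gaussian (edges (insert i V))"
  have e: "{i, k} \<in> edges (insert i V)" if "k \<in> V" for k
    using that V(2) by (simp add: edges_insert)
  have sq: "integrable ?M (\<lambda>G. (G {i, k})\<^sup>2)" if "k \<in> V" for k
    using gaussian_component_square[of "edges (insert i V)" "{i, k}"] e[OF that] V(1)
    by (simp add: has_bochner_integral_iff)
  have bound: "integrable ?M (\<lambda>G. 2 * A\<^sup>2 + 2 * s\<^sup>2 * card V * (\<Sum>k\<in>V. (G {i, k})\<^sup>2))"
    using sq prob_space.emeasure_space_1[OF prob_space_gaussian]
    by (intro Bochner_Integration.integrable_add integrable_mult_right Bochner_Integration.integrable_sum)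
      (auto intro: finite_measure.integrable_const prob_space.finite_measure prob_space_gaussian)
  show ?thesis
  proof (rule Bochner_Integration.integrable_bound[OF bound])
    show "(\<lambda>G. (a G - s * (\<Sum>k\<in>V. G {i, k} * c k G))\<^sup>2) \<in> borel_measurable ?M"
      using e by measurable
    have "(a G - s * (\<Sum>k\<in>V. G {i, k} * c k G))\<^sup>2 \<le> 2 * A\<^sup>2 + 2 * s\<^sup>2 * card V * (\<Sum>k\<in>V. (G {i, k})\<^sup>2)" for G
    proof -
      let ?t = "\<Sum>k\<in>V. G {i, k} * c k G"
      have "(a G - s * ?t)\<^sup>2 \<le> 2 * (a G)\<^sup>2 + 2 * (s * ?t)\<^sup>2"
        using zero_le_power2[of "a G + s * ?t"] by (simp add: power2_eq_square algebra_simps)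
      moreover have "(a G)\<^sup>2 \<le> A\<^sup>2" using a[of G] by (intro abs_le_square_iff[THEN iffD1]) simp
      moreover have "(s * ?t)\<^sup>2 \<le> s\<^sup>2 * ((\<Sum>k\<in>V. (G {i, k})\<^sup>2) * card V)"
      proof -
        have "?t\<^sup>2 \<le> (\<Sum>k\<in>V. (G {i, k})\<^sup>2) * (\<Sum>k\<in>V. (c k G)\<^sup>2)" by (rule Cauchy_Schwarz_ineq_sum)
        also have "\<dots> \<le> (\<Sum>k\<in>V. (G {i, k})\<^sup>2) * (\<Sum>k\<in>V. 1)"
          using c by (intro mult_left_mono sum_mono sum_nonneg) (auto simp: abs_square_le_1)
        finally show ?thesis by (simp add: power_mult_distrib mult_left_mono)
      qed
      ultimately show ?thesis by (simp add: mult_ac)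
    qed
    then show "AE G in ?M. norm ((a G - s * (\<Sum>k\<in>V. G {i, k} * c k G))\<^sup>2)
      \<le> norm (2 * A\<^sup>2 + 2 * s\<^sup>2 * card V * (\<Sum>k\<in>V. (G {i, k})\<^sup>2))"
      by (intro AE_I2) (simp add: order_trans[OF _ abs_ge_self])
  qed
qed

section \<open>Second moments of the matrix entries\<close>

lemma abs_avg_pair_le_1:
  assumes "finite U" "k \<in> U" "j \<in> U"
  shows "\<bar>avg s U G (\<lambda>\<sigma>. \<sigma> k * \<sigma> j)\<bar> \<le> 1"
  using assms by (intro avg_abs_le) (auto simp: abs_mult config_abs[of _ U])

text \<open>The matrix entry in terms of couplings on edges; the vertex \<open>i\<close> is left out
  of the sum because the diagonal of the disorder vanishes.\<close>

definition row_residual :: "real \<Rightarrow> real \<Rightarrow> 'v set \<Rightarrow> 'v \<Rightarrow> 'v \<Rightarrow> ('v set \<Rightarrow> real) \<Rightarrow> real" where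
  "row_residual \<beta> s U i j G = (1 + \<beta>\<^sup>2) * avg s U G (\<lambda>\<sigma>. \<sigma> i * \<sigma> j)
    - s * (\<Sum>k\<in>U - {i}. G {i, k} * avg s U G (\<lambda>\<sigma>. \<sigma> k * \<sigma> j)) - of_bool (i = j)"

lemma integrable_row:
  assumes V: "finite V" "i \<notin> V" and j: "j \<in> insert i V"
  shows "integrable (gaussian (edges (insert i V))) (\<lambda>G. (row_residual \<beta> s (insert i V) i j G)\<^sup>2)"
proof -
  let ?U = "insert i V"
  have U: "finite ?U" using V by simp
  let ?a = "\<lambda>G. (1 + \<beta>\<^sup>2) * avg s ?U G (\<lambda>\<sigma>. \<sigma> i * \<sigma> j) - of_bool (i = j)"
  have a: "\<bar>?a G\<bar> \<le> (1 + \<beta>\<^sup>2) + 1" for G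
  proof -
    have "\<bar>?a G\<bar> \<le> \<bar>(1 + \<beta>\<^sup>2) * avg s ?U G (\<lambda>\<sigma>. \<sigma> i * \<sigma> j)\<bar> + 1" by (auto simp: abs_if)
    also have "\<bar>(1 + \<beta>\<^sup>2) * avg s ?U G (\<lambda>\<sigma>. \<sigma> i * \<sigma> j)\<bar> \<le> (1 + \<beta>\<^sup>2) * 1"
      unfolding abs_mult using abs_avg_pair_le_1[OF U _ j, of i s G] by (intro mult_mono) auto
    finally show ?thesis by simp
  qed
  have "(\<lambda>G. avg s ?U G (\<lambda>\<sigma>. \<sigma> i * \<sigma> j)) \<in> borel_measurable (gaussian (edges ?U))"
    by (rule measurable_avg[OF U])
  then have "integrable (gaussian (edges ?U))
    (\<lambda>G. (?a G - s * (\<Sum>k\<in>V. G {i, k} * avg s ?U G (\<lambda>\<sigma>. \<sigma> k * \<sigma> j)))\<^sup>2)"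
    using abs_avg_pair_le_1[OF U _ j]
    by (intro integrable_cavity_row[OF V, where A = "(1 + \<beta>\<^sup>2) + 1"] a measurable_avg[OF U]) auto
  moreover have "V - {i} = V" using V by auto
  ultimately show ?thesis
    by (simp add: row_residual_def diff_diff_eq add.commute)
qed

text \<open>The power count: exchangeability bounds \<open>card V\<close> times the second moment by
  the sixth power of \<open>s\<close> times the fourth overlap moment, up to lower order. With
  \<open>s\<^sup>2\<close> of order 1/n this is of order 1/n, and division by \<open>card V\<close>
  gives the rate.\<close>

lemma row_offdiagonal_second_moment:
  fixes V :: "'v set" and s \<beta> :: real
  assumes V: "finite V" "i \<notin> V" and j: "j \<in> V"
    and s: "s\<^sup>2 * (card V + 1) = \<beta>\<^sup>2" and \<beta>: "\<beta>\<^sup>2 < 1" and C: "0 \<le> C"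
    and m2: "(\<integral>G. avg2 s V G (\<lambda>\<sigma> \<tau>. (overlap V \<sigma> \<tau>)\<^sup>2) \<partial>gaussian (edges V)) \<le> C * real (card V)"
    and m4: "(\<integral>G. avg2 s V G (\<lambda>\<sigma> \<tau>. (overlap V \<sigma> \<tau>) ^ 4) \<partial>gaussian (edges V)) \<le> C * (real (card V))\<^sup>2"
  shows "(\<integral>G. (row_residual \<beta> s (insert i V) i j G)\<^sup>2 \<partial>gaussian (edges (insert i V))) \<le> 40 * C / (card V + 1)\<^sup>2"
proof -
  let ?m = "real (card V)" and ?U = "insert i V"
  define v where "v = s\<^sup>2 * ?m"
  define \<psi> where "\<psi> h = (1 + \<beta>\<^sup>2) * sinh h - h * cosh h" for h :: real
  define \<phi> where "\<phi> x = exp v * (exp (s\<^sup>2 * x) * ((1 + s\<^sup>2 - s\<^sup>2 * x)\<^sup>2 + s\<^sup>2 * x)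
    - exp (- (s\<^sup>2 * x)) * ((1 + s\<^sup>2 + s\<^sup>2 * x)\<^sup>2 - s\<^sup>2 * x)) / 2" for x
  have ij: "i \<noteq> j" "V - {i} = V" using V j by auto
  \<comment> \<open>The field of \<open>card V\<close> spins has variance
    \<open>v = \<beta>\<^sup>2 - s\<^sup>2\<close>, so the parameter \<open>\<delta>\<close> of the
    kernel bound is \<open>s\<^sup>2\<close>.\<close>
  have \<kappa>: "1 + \<beta>\<^sup>2 - v = 1 + s\<^sup>2" using s by (simp add: v_def algebra_simps)
  have m1: "1 \<le> ?m" using V j by (metis One_nat_def Suc_leI card_gt_0_iff empty_iff of_nat_1 of_nat_mono)
  have s2: "s\<^sup>2 \<le> 1 / (?m + 1)" using s \<beta> m1 by (simp add: field_simps)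
  have "s\<^sup>2 * ?m + s\<^sup>2 = \<beta>\<^sup>2" using s by (simp add: algebra_simps)
  moreover have "0 \<le> s\<^sup>2 * ?m" "0 \<le> s\<^sup>2" by simp_all
  ultimately have sm: "s\<^sup>2 * ?m \<le> 1" and s1: "s\<^sup>2 \<le> 1" using \<beta> by linarith+
  have row: "row_residual \<beta> s ?U i j G = avg s V G (\<lambda>\<sigma>. \<sigma> j * \<psi> (cavity_field s V i G \<sigma>)) / avg s V G (\<lambda>\<sigma>. cosh (cavity_field s V i G \<sigma>))" for G
    using cavity_row[OF V j, of "1 + \<beta>\<^sup>2" s G] ij by (simp add: row_residual_def \<psi>_def)
  have bi: "has_bochner_integral (gaussian (star V i))
      (\<lambda>y. (\<sigma> j * \<psi> (cavity_field s V i y \<sigma>)) * (\<tau> j * \<psi> (cavity_field s V i y \<tau>))) (\<sigma> j * \<tau> j * \<phi> (overlap V \<sigma> \<tau>))"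
    if \<sigma>\<tau>: "\<sigma> \<in> configs V" "\<tau> \<in> configs V" for \<sigma> \<tau>
  proof -
    have "has_bochner_integral (gaussian (star V i))
      (\<lambda>y. \<psi> (cavity_field s V i y \<sigma>) * \<psi> (cavity_field s V i y \<tau>)) (\<phi> (overlap V \<sigma> \<tau>))"
      using gaussian_cavity_odd[OF _ cavity_field_squares[OF V \<sigma>\<tau>(1), of s] cavity_field_squares[OF V \<sigma>\<tau>(2), of s]
        cavity_field_star(2)[OF V, of s \<sigma> \<tau>], of "1 + \<beta>\<^sup>2"] V(1)
      unfolding cavity_field_star(1)[OF V] \<phi>_def \<psi>_def v_def[symmetric] \<kappa> by simp
    from has_bochner_integral_mult_right[OF this, of "\<sigma> j * \<tau> j"] show ?thesis
      by (simp add: mult_ac)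
  qed
  have 1: "(\<integral>G. (row_residual \<beta> s ?U i j G)\<^sup>2 \<partial>gaussian (edges ?U))
    \<le> (\<integral>G. avg2 s V G (\<lambda>\<sigma> \<tau>. \<sigma> j * \<tau> j * \<phi> (overlap V \<sigma> \<tau>)) \<partial>gaussian (edges V))" (is "_ \<le> ?I j")
    using integrable_row[OF V, of j \<beta> s] V j bi unfolding row
    by (intro cavity_second_moment) auto
  interpret prob_space "gaussian (edges V)" by (rule prob_space_gaussian)
  have bnd: "\<bar>s\<^sup>2 * overlap V \<sigma> \<tau>\<bar> \<le> 1" if "\<sigma> \<in> configs V" "\<tau> \<in> configs V" for \<sigma> \<tau>
  proof -
    have "\<bar>s\<^sup>2 * overlap V \<sigma> \<tau>\<bar> \<le> s\<^sup>2 * ?m" unfolding abs_mult using abs_overlap_le[OF that] by (intro mult_mono) auto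
    then show ?thesis using sm by simp
  qed
  \<comment> \<open>With \<open>\<rho> = s\<^sup>2 * x\<close> and
    \<open>\<delta> = s\<^sup>2\<close>, the cubic and the linear part of the kernel bound both
    carry the sixth power of \<open>s\<close>; the extra overlap factor makes the powers of the
    overlap even.\<close>
  have \<phi>b: "overlap V \<sigma> \<tau> * \<phi> (overlap V \<sigma> \<tau>) \<le> s ^ 6 * (32 * overlap V \<sigma> \<tau> ^ 4 + 8 * (overlap V \<sigma> \<tau>)\<^sup>2)"
    if "\<sigma> \<in> configs V" "\<tau> \<in> configs V" for \<sigma> \<tau>
  proof -
    let ?x = "overlap V \<sigma> \<tau>"
    have "?x * \<phi> ?x \<le> \<bar>?x\<bar> * \<bar>\<phi> ?x\<bar>" by (metis abs_ge_self abs_mult)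
    also have "\<dots> \<le> \<bar>?x\<bar> * (32 * \<bar>s\<^sup>2 * ?x\<bar> ^ 3 + 8 * (s\<^sup>2)\<^sup>2 * \<bar>s\<^sup>2 * ?x\<bar>)"
      unfolding \<phi>_def using bnd[OF that] s1 sm by (intro mult_left_mono cavity_odd_bound) (auto simp: v_def)
    also have "\<dots> = s ^ 6 * (32 * ?x ^ 4 + 8 * ?x\<^sup>2)"
    proof -
      have "y * (32 * (t * y) ^ 3 + 8 * t\<^sup>2 * (t * y)) = t ^ 3 * (32 * y ^ 4 + 8 * y\<^sup>2)" for y t :: real
        by (simp add: power2_eq_square power3_eq_cube power4_eq_xxxx algebra_simps)
      from this[of "\<bar>?x\<bar>" "s\<^sup>2"] show ?thesis by (simp add: abs_mult flip: power_mult)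
    qed
    finally show ?thesis .
  qed
  have ov_int: "integrable (gaussian (edges V)) (\<lambda>G. avg2 s V G (\<lambda>\<sigma> \<tau>. (overlap V \<sigma> \<tau>) ^ p))" for p
  proof (rule integrable_bounded[of _ "?m ^ p"])
    show "\<bar>avg2 s V G (\<lambda>\<sigma> \<tau>. (overlap V \<sigma> \<tau>) ^ p)\<bar> \<le> ?m ^ p" for G
      using abs_overlap_le[of _ V] by (intro avg2_abs_le V(1)) (simp add: power_abs power_mono)
  qed (use V in measurable)
  have \<phi>int: "integrable (gaussian (edges V)) (\<lambda>G. avg2 s V G (\<lambda>\<sigma> \<tau>. \<sigma> k * \<tau> k * \<phi> (overlap V \<sigma> \<tau>)))" if k: "k \<in> V" for k
  proof -
    have "\<bar>\<sigma> k * \<tau> k * \<phi> (overlap V \<sigma> \<tau>)\<bar> \<le> 32 + 8" if "\<sigma> \<in> configs V" "\<tau> \<in> configs V" for \<sigma> \<tau>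
    proof -
      let ?r = "\<bar>s\<^sup>2 * overlap V \<sigma> \<tau>\<bar>"
      have "\<bar>\<phi> (overlap V \<sigma> \<tau>)\<bar> \<le> 32 * ?r ^ 3 + 8 * (s\<^sup>2)\<^sup>2 * ?r"
        unfolding \<phi>_def using bnd[OF that] s1 sm by (intro cavity_odd_bound) (auto simp: v_def)
      also have "\<dots> \<le> 32 + 8"
      proof -
        have "?r ^ 3 \<le> 1" using bnd[OF that] by (intro power_le_one) auto
        moreover have "(s\<^sup>2)\<^sup>2 \<le> 1" by (rule power_le_one[OF zero_le_power2 s1])
        then have "(s\<^sup>2)\<^sup>2 * ?r \<le> 1 * 1" using bnd[OF that] by (intro mult_mono) auto
        ultimately show ?thesis by linarith
      qed
      finally show ?thesis using config_abs[OF that(1) k] config_abs[OF that(2) k] by (simp add: abs_mult)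
    qed
    then show ?thesis
      using avg2_abs_le[OF V(1)] V(1) by (intro integrable_bounded[of _ "32 + 8"]) auto
  qed
  txt \<open>Averaging over \<open>j\<close> turns \<open>\<sigma> j * \<tau> j\<close> into a further factor of the overlap.\<close>
  have "?m * ?I j = (\<Sum>k\<in>V. ?I k)"
    using expectation_avg2_transpose[OF V(1) _ j] by simp
  also have "\<dots> = (\<integral>G. avg2 s V G (\<lambda>\<sigma> \<tau>. overlap V \<sigma> \<tau> * \<phi> (overlap V \<sigma> \<tau>)) \<partial>gaussian (edges V))"
    using \<phi>int by (simp add: overlap_def sum_distrib_right avg2_sum)
  also have "\<dots> \<le> (\<integral>G. s ^ 6 * (32 * avg2 s V G (\<lambda>\<sigma> \<tau>. overlap V \<sigma> \<tau> ^ 4) + 8 * avg2 s V G (\<lambda>\<sigma> \<tau>. (overlap V \<sigma> \<tau>)\<^sup>2)) \<partial>gaussian (edges V))"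
  proof (rule integral_mono')
    show "integrable (gaussian (edges V)) (\<lambda>G. s ^ 6 * (32 * avg2 s V G (\<lambda>\<sigma> \<tau>. overlap V \<sigma> \<tau> ^ 4) + 8 * avg2 s V G (\<lambda>\<sigma> \<tau>. (overlap V \<sigma> \<tau>)\<^sup>2)))"
      using ov_int[of 4] ov_int[of 2] by simp
    have ge: "0 \<le> avg2 s V G (\<lambda>\<sigma> \<tau>. overlap V \<sigma> \<tau> ^ p)" if "even p" for G p
      using avg2_mono[OF V(1), of "\<lambda>_ _. 0" "\<lambda>\<sigma> \<tau>. overlap V \<sigma> \<tau> ^ p" s G] that V(1) by (simp add: zero_le_even_power)
    show "0 \<le> s ^ 6 * (32 * avg2 s V G (\<lambda>\<sigma> \<tau>. overlap V \<sigma> \<tau> ^ 4) + 8 * avg2 s V G (\<lambda>\<sigma> \<tau>. (overlap V \<sigma> \<tau>)\<^sup>2))" for G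
      using ge[of 4 G] ge[of 2 G] by (simp add: zero_le_even_power)
    show "avg2 s V G (\<lambda>\<sigma> \<tau>. overlap V \<sigma> \<tau> * \<phi> (overlap V \<sigma> \<tau>))
      \<le> s ^ 6 * (32 * avg2 s V G (\<lambda>\<sigma> \<tau>. overlap V \<sigma> \<tau> ^ 4) + 8 * avg2 s V G (\<lambda>\<sigma> \<tau>. (overlap V \<sigma> \<tau>)\<^sup>2))" for G
    proof -
      have "avg2 s V G (\<lambda>\<sigma> \<tau>. overlap V \<sigma> \<tau> * \<phi> (overlap V \<sigma> \<tau>))
        \<le> avg2 s V G (\<lambda>\<sigma> \<tau>. s ^ 6 * (32 * overlap V \<sigma> \<tau> ^ 4 + 8 * (overlap V \<sigma> \<tau>)\<^sup>2))"
        by (intro avg2_mono V(1) \<phi>b)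
      then show ?thesis by (simp add: avg2_cmult avg2_add)
    qed
  qed
  also have "\<dots> = s ^ 6 * (32 * (\<integral>G. avg2 s V G (\<lambda>\<sigma> \<tau>. overlap V \<sigma> \<tau> ^ 4) \<partial>gaussian (edges V))
      + 8 * (\<integral>G. avg2 s V G (\<lambda>\<sigma> \<tau>. (overlap V \<sigma> \<tau>)\<^sup>2) \<partial>gaussian (edges V)))"
    using ov_int[of 4] ov_int[of 2] by simp
  also have "\<dots> \<le> s ^ 6 * (32 * (C * ?m\<^sup>2) + 8 * (C * ?m))"
    using m2 m4 by (intro mult_left_mono add_mono) (auto simp: zero_le_even_power)
  also have "\<dots> \<le> s ^ 6 * (32 * (C * ?m\<^sup>2) + 8 * (C * ?m\<^sup>2))"
    using C m1 by (intro mult_left_mono add_mono) (auto simp: zero_le_even_power power2_eq_square)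
  \<comment> \<open>One factor \<open>s\<^sup>2 * ?m\<close> is at most 1, and the other two factors
    \<open>s\<^sup>2\<close> supply the square of \<open>1 / (?m + 1)\<close>.\<close>
  also have "\<dots> = ?m * (40 * C * (s\<^sup>2)\<^sup>2 * (s\<^sup>2 * ?m))"
  proof -
    have "s ^ 6 = (s\<^sup>2)\<^sup>2 * s\<^sup>2" by (simp flip: power_mult power_add)
    then show ?thesis by (simp add: power2_eq_square algebra_simps)
  qed
  also have "\<dots> \<le> ?m * (40 * C * (1 / (?m + 1))\<^sup>2 * 1)"
    using s2 sm C by (intro mult_left_mono mult_mono power_mono) auto
  finally have "?I j \<le> 40 * C * (1 / (?m + 1))\<^sup>2" using m1 by simp
  with 1 show ?thesis by (simp add: power_divide add.commute)
qed

text \<open>Subtracting the identity lowers the coefficient to \<open>\<beta>\<^sup>2\<close>, so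
  the even kernel is of second order in \<open>\<delta> = s\<^sup>2\<close> and
  \<open>s\<^sup>2\<close> times the overlap. The second overlap moment then gives order 1/n, which
  is enough for n diagonal entries.\<close>

lemma row_diagonal_second_moment:
  fixes V :: "'v set" and s \<beta> :: real
  assumes V: "finite V" "i \<notin> V"
    and s: "s\<^sup>2 * (card V + 1) = \<beta>\<^sup>2" and \<beta>: "\<beta>\<^sup>2 < 1" and C: "0 \<le> C"
    and m2: "(\<integral>G. avg2 s V G (\<lambda>\<sigma> \<tau>. (overlap V \<sigma> \<tau>)\<^sup>2) \<partial>gaussian (edges V)) \<le> C * real (card V)"
  shows "(\<integral>G. (row_residual \<beta> s (insert i V) i i G)\<^sup>2 \<partial>gaussian (edges (insert i V))) \<le> (8 + 16 * C) / (card V + 1)"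
proof -
  let ?m = "real (card V)" and ?U = "insert i V"
  define v where "v = s\<^sup>2 * ?m"
  define \<psi> where "\<psi> h = \<beta>\<^sup>2 * cosh h - h * sinh h" for h :: real
  define \<phi> where "\<phi> x = exp v * (exp (s\<^sup>2 * x) * ((s\<^sup>2 - s\<^sup>2 * x)\<^sup>2 + s\<^sup>2 * x)
    + exp (- (s\<^sup>2 * x)) * ((s\<^sup>2 + s\<^sup>2 * x)\<^sup>2 - s\<^sup>2 * x)) / 2" for x
  have Vi: "V - {i} = V" using V by auto
  have \<kappa>: "\<beta>\<^sup>2 - v = s\<^sup>2" using s by (simp add: v_def algebra_simps)
  have s2: "s\<^sup>2 \<le> 1 / (?m + 1)" using s \<beta> by (simp add: field_simps)
  have "s\<^sup>2 * ?m + s\<^sup>2 = \<beta>\<^sup>2" using s by (simp add: algebra_simps)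
  moreover have "0 \<le> s\<^sup>2 * ?m" "0 \<le> s\<^sup>2" by simp_all
  ultimately have sm: "s\<^sup>2 * ?m \<le> 1" and s1: "s\<^sup>2 \<le> 1" using \<beta> by linarith+
  have row: "row_residual \<beta> s ?U i i G = avg s V G (\<lambda>\<sigma>. \<psi> (cavity_field s V i G \<sigma>)) / avg s V G (\<lambda>\<sigma>. cosh (cavity_field s V i G \<sigma>))" for G
  proof -
    have "avg s ?U G (\<lambda>\<sigma>. \<sigma> i * \<sigma> i) = avg s ?U G (\<lambda>_. 1)"
      by (intro avg_cong) (simp add: config_square)
    then have "row_residual \<beta> s ?U i i G = \<beta>\<^sup>2 - s * (\<Sum>k\<in>V. G {i, k} * avg s ?U G (\<lambda>\<sigma>. \<sigma> k * \<sigma> i))"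
      using V Vi by (simp add: row_residual_def)
    then show ?thesis using cavity_diagonal[OF V, of "\<beta>\<^sup>2" s G] by (simp add: \<psi>_def)
  qed
  have bi: "has_bochner_integral (gaussian (star V i))
      (\<lambda>y. \<psi> (cavity_field s V i y \<sigma>) * \<psi> (cavity_field s V i y \<tau>)) (\<phi> (overlap V \<sigma> \<tau>))"
    if \<sigma>\<tau>: "\<sigma> \<in> configs V" "\<tau> \<in> configs V" for \<sigma> \<tau>
    using gaussian_cavity_even[OF _ cavity_field_squares[OF V \<sigma>\<tau>(1), of s] cavity_field_squares[OF V \<sigma>\<tau>(2), of s]
        cavity_field_star(2)[OF V, of s \<sigma> \<tau>], of "\<beta>\<^sup>2"] V(1)
    unfolding cavity_field_star(1)[OF V] \<phi>_def \<psi>_def v_def[symmetric] \<kappa> by simp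
  have 1: "(\<integral>G. (row_residual \<beta> s ?U i i G)\<^sup>2 \<partial>gaussian (edges ?U))
    \<le> (\<integral>G. avg2 s V G (\<lambda>\<sigma> \<tau>. \<phi> (overlap V \<sigma> \<tau>)) \<partial>gaussian (edges V))"
    using integrable_row[OF V, of i \<beta> s] V bi unfolding row
    by (intro cavity_second_moment[where f = "\<lambda>_. \<psi>"]) auto
  interpret prob_space "gaussian (edges V)" by (rule prob_space_gaussian)
  have \<phi>b: "\<phi> (overlap V \<sigma> \<tau>) \<le> 8 * (s\<^sup>2)\<^sup>2 + 16 * (s\<^sup>2)\<^sup>2 * (overlap V \<sigma> \<tau>)\<^sup>2"
    if "\<sigma> \<in> configs V" "\<tau> \<in> configs V" for \<sigma> \<tau>
  proof -
    have "\<bar>s\<^sup>2 * overlap V \<sigma> \<tau>\<bar> \<le> s\<^sup>2 * ?m" unfolding abs_mult using abs_overlap_le[OF that] by (intro mult_mono) auto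
    then have "\<bar>s\<^sup>2 * overlap V \<sigma> \<tau>\<bar> \<le> 1" using sm by simp
    then have "\<phi> (overlap V \<sigma> \<tau>) \<le> 8 * (s\<^sup>2)\<^sup>2 + 16 * (s\<^sup>2 * overlap V \<sigma> \<tau>)\<^sup>2"
      unfolding \<phi>_def using s1 sm by (intro cavity_even_bound) (auto simp: v_def)
    then show ?thesis by (simp add: power_mult_distrib)
  qed
  have ov_int: "integrable (gaussian (edges V)) (\<lambda>G. avg2 s V G (\<lambda>\<sigma> \<tau>. (overlap V \<sigma> \<tau>)\<^sup>2))"
  proof (rule integrable_bounded[of _ "?m\<^sup>2"])
    show "\<bar>avg2 s V G (\<lambda>\<sigma> \<tau>. (overlap V \<sigma> \<tau>)\<^sup>2)\<bar> \<le> ?m\<^sup>2" for G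
      using abs_overlap_le[of _ V] by (intro avg2_abs_le V(1)) (simp add: abs_le_square_iff[symmetric])
  qed (use V in measurable)
  have ge: "0 \<le> avg2 s V G (\<lambda>\<sigma> \<tau>. (overlap V \<sigma> \<tau>)\<^sup>2)" for G
    using avg2_mono[OF V(1), of "\<lambda>_ _. 0" "\<lambda>\<sigma> \<tau>. (overlap V \<sigma> \<tau>)\<^sup>2" s G] V(1) by simp
  have "(\<integral>G. avg2 s V G (\<lambda>\<sigma> \<tau>. \<phi> (overlap V \<sigma> \<tau>)) \<partial>gaussian (edges V))
    \<le> (\<integral>G. 8 * (s\<^sup>2)\<^sup>2 + 16 * (s\<^sup>2)\<^sup>2 * avg2 s V G (\<lambda>\<sigma> \<tau>. (overlap V \<sigma> \<tau>)\<^sup>2) \<partial>gaussian (edges V))"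
  proof (rule integral_mono')
    show "avg2 s V G (\<lambda>\<sigma> \<tau>. \<phi> (overlap V \<sigma> \<tau>)) \<le> 8 * (s\<^sup>2)\<^sup>2 + 16 * (s\<^sup>2)\<^sup>2 * avg2 s V G (\<lambda>\<sigma> \<tau>. (overlap V \<sigma> \<tau>)\<^sup>2)" for G
    proof -
      have "avg2 s V G (\<lambda>\<sigma> \<tau>. \<phi> (overlap V \<sigma> \<tau>))
        \<le> avg2 s V G (\<lambda>\<sigma> \<tau>. 8 * (s\<^sup>2)\<^sup>2 + 16 * (s\<^sup>2)\<^sup>2 * (overlap V \<sigma> \<tau>)\<^sup>2)"
        by (intro avg2_mono V(1) \<phi>b)
      then show ?thesis using V(1) by (simp add: avg2_cmult avg2_add)
    qed
  qed (use ov_int ge in auto)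
  also have "\<dots> = 8 * (s\<^sup>2)\<^sup>2 + 16 * (s\<^sup>2)\<^sup>2 * (\<integral>G. avg2 s V G (\<lambda>\<sigma> \<tau>. (overlap V \<sigma> \<tau>)\<^sup>2) \<partial>gaussian (edges V))"
    using ov_int by (simp add: prob_space)
  also have "\<dots> \<le> 8 * (s\<^sup>2)\<^sup>2 + 16 * (s\<^sup>2)\<^sup>2 * (C * ?m)"
    using m2 by (intro add_left_mono mult_left_mono) auto
  also have "\<dots> = s\<^sup>2 * (8 * s\<^sup>2 + 16 * C * (s\<^sup>2 * ?m))"
    by (simp add: power2_eq_square algebra_simps)
  also have "\<dots> \<le> 1 / (?m + 1) * (8 * 1 + 16 * C * 1)"
    using s2 s1 sm C by (intro mult_mono add_mono mult_left_mono) auto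
  finally show ?thesis using 1 by (simp add: add.commute)
qed

section \<open>The Sherrington--Kirkpatrick disorder\<close>

lemma nat_edge_cases:
  fixes n :: nat
  assumes "e \<in> edges {..<n}"
  obtains i j where "i < j" "j < n" "e = {i, j}"
proof -
  from assms obtain a b where "e = {a, b}" "a \<noteq> b" "a < n" "b < n"
    by (auto simp: edges_def card_2_iff)
  then show thesis using that[of a b] that[of b a] by (cases "a < b") (auto simp: insert_commute)
qed

lemma bij_betw_pairs_edges:
  fixes n :: nat
  shows "bij_betw (\<lambda>(j, i). {i, j}) (SIGMA j:{..<n}. {..<j}) (edges {..<n})"
proof (rule bij_betwI[where g = "\<lambda>e. (Max e, Min e)"])
  show "(\<lambda>(j, i). {i, j}) \<in> (SIGMA j:{..<n}. {..<j}) \<rightarrow> edges {..<n}"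
    by (auto simp: edges_def card_2_iff)
  show "(\<lambda>e. (Max e, Min e)) \<in> edges {..<n} \<rightarrow> (SIGMA j:{..<n}. {..<j})"
    by (auto elim!: nat_edge_cases simp: min_def max_def)
  show "(\<lambda>e. (Max e, Min e)) ((\<lambda>(j, i). {i, j}) p) = p" if "p \<in> (SIGMA j:{..<n}. {..<j})" for p
    using that by (auto simp: min_def max_def)
  show "(\<lambda>(j, i). {i, j}) ((\<lambda>e. (Max e, Min e)) e) = e" if "e \<in> edges {..<n}" for e
    using that by (auto elim!: nat_edge_cases simp: min_def max_def)
qed

context sk_disorder
begin

text \<open>The restriction to edges makes the value a point of the product space that carries
  \<open>gaussian\<close>.\<close>

definition disorder :: "'a \<Rightarrow> nat set \<Rightarrow> real" where
  "disorder \<omega> = (\<lambda>e\<in>edges {..<n}. g (Min e) (Max e) \<omega>)"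

lemma disorder_pair:
  assumes "\<omega> \<in> space M" "i < n" "k < n" "i \<noteq> k"
  shows "disorder \<omega> {i, k} = g i k \<omega>"
proof -
  have "{i, k} \<in> edges {..<n}" using assms by (auto simp: edges_def)
  then show ?thesis
    using assms symmetric[of i k \<omega>] symmetric[of k i \<omega>] by (auto simp: disorder_def min_def max_def)
qed

lemma hamiltonian_disorder:
  assumes "\<omega> \<in> space M"
  shows "(\<Sum>j<n. \<Sum>i<j. g i j \<omega> * \<sigma> i * \<sigma> j) = hamiltonian {..<n} (disorder \<omega>) \<sigma>"
proof -
  have "(\<Sum>j<n. \<Sum>i<j. g i j \<omega> * \<sigma> i * \<sigma> j)
    = (\<Sum>(j, i)\<in>(SIGMA j:{..<n}. {..<j}). g i j \<omega> * \<sigma> i * \<sigma> j)"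
    by (rule sum.Sigma) auto
  also have "\<dots> = (\<Sum>p\<in>(SIGMA j:{..<n}. {..<j}). disorder \<omega> (case p of (j, i) \<Rightarrow> {i, j}) * prod \<sigma> (case p of (j, i) \<Rightarrow> {i, j}))"
    using assms by (intro sum.cong refl) (auto simp: disorder_pair)
  also have "\<dots> = hamiltonian {..<n} (disorder \<omega>) \<sigma>"
    unfolding hamiltonian_def by (rule sum.reindex_bij_betw[OF bij_betw_pairs_edges])
  finally show ?thesis .
qed

lemma sk_avg_eq_avg:
  assumes "\<omega> \<in> space M"
  shows "sk_avg n \<beta> (\<lambda>i j. g i j \<omega>) f = avg (\<beta> / sqrt n) {..<n} (disorder \<omega>) f"
proof -
  have w: "sk_weight n \<beta> (\<lambda>i j. g i j \<omega>) = weight (\<beta> / sqrt n) {..<n} (disorder \<omega>)"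
    by (intro ext) (simp add: sk_weight_def weight_def hamiltonian_disorder[OF assms])
  have c: "spin_configs n = configs {..<n}" by (simp add: spin_configs_def configs_def)
  have Z: "sk_partition n \<beta> (\<lambda>i j. g i j \<omega>) = partition_fn (\<beta> / sqrt n) {..<n} (disorder \<omega>)"
    by (simp add: sk_partition_def partition_fn_def w c)
  show ?thesis
    unfolding sk_avg_def sk_gibbs_def w Z c
    by (subst lebesgue_integral_point_measure_finite)
      (auto simp: avg_def sum_divide_distrib mult.commute intro!: divide_nonneg_pos)
qed

text \<open>Independence makes the joint law of the entries above the diagonal a product of standard
  normals; reindexing ordered pairs by edges turns it into \<open>gaussian\<close>.\<close>

lemma measurable_disorder [measurable]: "disorder \<in> measurable M (gaussian (edges {..<n}))"
  and distr_disorder: "distr M (gaussian (edges {..<n})) disorder = gaussian (edges {..<n})"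
proof -
  let ?E = "edges {..<n}" and ?P = "{(i, j). i < j \<and> j < n}"
  let ?h = "\<lambda>e. (Min e, Max e) :: nat \<times> nat"
  have h: "inj_on ?h ?E" "?h \<in> ?E \<rightarrow> ?P"
    by (auto intro!: inj_onI elim!: nat_edge_cases simp: min_def max_def)
  have rv: "random_variable borel (g i j)" if "i < j" "j < n" for i j
    using distributed_measurable[OF std_gaussian[OF that]] by simp
  have gm: "g (Min e) (Max e) \<in> borel_measurable M" if "e \<in> ?E" for e
    using h(2) that by (intro rv) auto
  then show m: "disorder \<in> measurable M (gaussian ?E)"
    unfolding disorder_def[abs_def] gaussian_def by (intro measurable_restrict) auto
  have law: "distr M borel (g i j) = std_normal_distribution" if "i < j" "j < n" for i j
    using distributed_distr_eq_density[OF std_gaussian[OF that]] by (simp cong: distr_cong)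
  show "distr M (gaussian ?E) disorder = gaussian ?E"
  proof (cases "?E = {}")
    \<comment> \<open>For \<open>n \<le> 1\<close> there are no edges, and both measures are
      probability measures on a one-point space; the independence criterion of the other case is
      applied to a nonempty index set.\<close>
    case True
    interpret Q: prob_space "gaussian ({} :: nat set set)" by (rule prob_space_gaussian)
    have m0: "disorder \<in> measurable M (gaussian {})" using m True by simp
    interpret D: prob_space "distr M (gaussian {}) disorder" by (rule prob_space_distr[OF m0])
    have sp: "space (gaussian ({} :: nat set set)) = {\<lambda>_. undefined}" by (simp add: space_gaussian)
    have "distr M (gaussian {}) disorder = gaussian {}"
    proof (rule measure_eqI)
      fix A assume "A \<in> sets (distr M (gaussian {}) disorder)"
      then have "A \<subseteq> space (gaussian {})" using sets.sets_into_space[of A "gaussian {}"] by simp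
      then have "A = {} \<or> A = space (gaussian {})" unfolding sp by auto
      then show "emeasure (distr M (gaussian {}) disorder) A = emeasure (gaussian {}) A"
        using D.emeasure_space_1 Q.emeasure_space_1 by auto
    qed simp
    then show ?thesis using True by simp
  next
    case False
    then have P: "?P \<noteq> {}" using h(2) by auto
    let ?X = "\<lambda>\<omega>. \<lambda>p\<in>?P. (case p of (i, j) \<Rightarrow> g i j) \<omega>"
    have "distr M (PiM ?P (\<lambda>_. borel)) ?X = PiM ?P (\<lambda>p. distr M borel (case p of (i, j) \<Rightarrow> g i j))"
      using indep rv by (subst indep_vars_iff_distr_eq_PiM'[OF P, symmetric]) auto
    also have "\<dots> = gaussian ?P"
      unfolding gaussian_def by (intro PiM_cong) (auto simp: law)
    finally have X: "distr M (PiM ?P (\<lambda>_. borel)) ?X = gaussian ?P" .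
    have Xm: "?X \<in> measurable M (PiM ?P (\<lambda>_. borel))"
      using rv by (intro measurable_restrict) auto
    let ?R = "\<lambda>x. \<lambda>e\<in>?E. x (?h e)"
    have Rm: "?R \<in> measurable (PiM ?P (\<lambda>_. borel)) (gaussian ?E)"
    proof -
      have "(\<lambda>x. x (?h e)) \<in> measurable (PiM ?P (\<lambda>_. borel)) (borel :: real measure)" if "e \<in> ?E" for e
        by (rule measurable_component_singleton) (use h(2) that in auto)
      then have "(\<lambda>x. x (?h e)) \<in> measurable (PiM ?P (\<lambda>_. borel)) std_normal_distribution" if "e \<in> ?E" for e
        using that by simp
      then show ?thesis unfolding gaussian_def by (rule measurable_restrict)
    qed
    have "gaussian ?E = distr (gaussian ?P) (gaussian ?E) ?R"
      unfolding gaussian_def using h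
      by (intro distr_PiM_reindex[symmetric]) (auto intro: std_normal_prob.prob_space_axioms)
    also have "\<dots> = distr M (gaussian ?E) (?R \<circ> ?X)"
      unfolding X[symmetric] by (rule distr_distr[OF Rm Xm])
    also have "?R \<circ> ?X = disorder"
      using h(2) by (auto simp: disorder_def fun_eq_iff)
    finally show ?thesis ..
  qed
qed

text \<open>Agreement is asked only on \<open>space M\<close>, since symmetry and the zero diagonal
  of \<open>g\<close> are assumed only there.\<close>

lemma transfer_disorder:
  fixes f :: "(nat set \<Rightarrow> real) \<Rightarrow> real"
  assumes "integrable (gaussian (edges {..<n})) f"
    and "\<And>\<omega>. \<omega> \<in> space M \<Longrightarrow> h \<omega> = f (disorder \<omega>)"
  shows "integrable M h" "expectation h = (\<integral>G. f G \<partial>gaussian (edges {..<n}))"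
proof -
  have m: "f \<in> borel_measurable (gaussian (edges {..<n}))" using assms(1) by auto
  have "integrable M (\<lambda>\<omega>. f (disorder \<omega>))"
    using assms(1) integrable_distr[OF measurable_disorder, of f] by (simp add: distr_disorder)
  then show "integrable M h" using assms(2) by (simp cong: Bochner_Integration.integrable_cong)
  have "expectation h = expectation (\<lambda>\<omega>. f (disorder \<omega>))"
    using assms(2) by (intro Bochner_Integration.integral_cong) auto
  also have "\<dots> = (\<integral>G. f G \<partial>distr M (gaussian (edges {..<n})) disorder)"
    by (rule integral_distr[symmetric, OF measurable_disorder m])
  finally show "expectation h = (\<integral>G. f G \<partial>gaussian (edges {..<n}))" by (simp add: distr_disorder)
qed

definition residual :: "real \<Rightarrow> 'a \<Rightarrow> nat \<Rightarrow> nat \<Rightarrow> real" where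
  "residual \<beta> \<omega> i j = (1 + \<beta>\<^sup>2) * sk_avg n \<beta> (\<lambda>i j. g i j \<omega>) (\<lambda>\<sigma>. \<sigma> i * \<sigma> j)
    - \<beta> / sqrt n * (\<Sum>k<n. g i k \<omega> * sk_avg n \<beta> (\<lambda>i j. g i j \<omega>) (\<lambda>\<sigma>. \<sigma> k * \<sigma> j)) - of_bool (i = j)"

lemma residual_eq_row:
  assumes "\<omega> \<in> space M" "i < n"
  shows "residual \<beta> \<omega> i j = row_residual \<beta> (\<beta> / sqrt n) {..<n} i j (disorder \<omega>)"
proof -
  have "(\<Sum>k<n. g i k \<omega> * avg (\<beta> / sqrt n) {..<n} (disorder \<omega>) (\<lambda>\<sigma>. \<sigma> k * \<sigma> j))
    = (\<Sum>k\<in>{..<n} - {i}. disorder \<omega> {i, k} * avg (\<beta> / sqrt n) {..<n} (disorder \<omega>) (\<lambda>\<sigma>. \<sigma> k * \<sigma> j))"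
    using assms by (intro sum.mono_neutral_cong_right) (auto simp: zero_diagonal disorder_pair)
  then show ?thesis
    by (simp add: residual_def row_residual_def sk_avg_eq_avg[OF assms(1)])
qed

lemma matrix_residual_entry:
  assumes "\<omega> \<in> space M" "i < n" "j < n"
  shows "(((1 + \<beta>\<^sup>2) \<cdot>\<^sub>m 1\<^sub>m n - \<beta> \<cdot>\<^sub>m sk_matrix n (\<lambda>i j. g i j \<omega>))
      * sk_cov n \<beta> (\<lambda>i j. g i j \<omega>) - 1\<^sub>m n) $$ (i, j) = residual \<beta> \<omega> i j"
proof -
  let ?c = "\<lambda>k j. sk_avg n \<beta> (\<lambda>i j. g i j \<omega>) (\<lambda>\<sigma>. \<sigma> k * \<sigma> j)"
  have "(((1 + \<beta>\<^sup>2) \<cdot>\<^sub>m 1\<^sub>m n - \<beta> \<cdot>\<^sub>m sk_matrix n (\<lambda>i j. g i j \<omega>))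
      * sk_cov n \<beta> (\<lambda>i j. g i j \<omega>) - 1\<^sub>m n) $$ (i, j)
    = (\<Sum>k<n. ((1 + \<beta>\<^sup>2) * (if i = k then 1 else 0) - \<beta> * (g i k \<omega> / sqrt n)) * ?c k j) - of_bool (i = j)"
    using assms by (simp add: sk_matrix_def sk_cov_def scalar_prod_def lessThan_atLeast0)
  also have "(\<Sum>k<n. ((1 + \<beta>\<^sup>2) * (if i = k then 1 else 0) - \<beta> * (g i k \<omega> / sqrt n)) * ?c k j)
    = (\<Sum>k<n. if i = k then (1 + \<beta>\<^sup>2) * ?c k j else 0) - (\<Sum>k<n. \<beta> / sqrt n * (g i k \<omega> * ?c k j))"
    unfolding sum_subtractf[symmetric] by (intro sum.cong) (auto simp: algebra_simps)
  finally show ?thesis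
    using assms by (simp add: residual_def sum_distrib_left)
qed

lemma frobenius_norm_residual:
  assumes "\<omega> \<in> space M"
  shows "(frobenius_norm (((1 + \<beta>\<^sup>2) \<cdot>\<^sub>m 1\<^sub>m n - \<beta> \<cdot>\<^sub>m sk_matrix n (\<lambda>i j. g i j \<omega>))
      * sk_cov n \<beta> (\<lambda>i j. g i j \<omega>) - 1\<^sub>m n))\<^sup>2 = (\<Sum>i<n. \<Sum>j<n. (residual \<beta> \<omega> i j)\<^sup>2)"
proof -
  let ?D = "((1 + \<beta>\<^sup>2) \<cdot>\<^sub>m 1\<^sub>m n - \<beta> \<cdot>\<^sub>m sk_matrix n (\<lambda>i j. g i j \<omega>))
      * sk_cov n \<beta> (\<lambda>i j. g i j \<omega>) - 1\<^sub>m n"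
  have dim: "dim_row ?D = n" "dim_col ?D = n" by (simp_all add: sk_matrix_def sk_cov_def)
  have "(frobenius_norm ?D)\<^sup>2 = (\<Sum>i<n. \<Sum>j<n. (?D $$ (i, j))\<^sup>2)"
    unfolding frobenius_norm_def dim by (intro real_sqrt_pow2 sum_nonneg) auto
  also have "\<dots> = (\<Sum>i<n. \<Sum>j<n. (residual \<beta> \<omega> i j)\<^sup>2)"
    using matrix_residual_entry[OF assms] by (intro sum.cong refl) (simp only: lessThan_iff)
  finally show ?thesis .
qed

lemma residual_second_moment:
  assumes \<beta>: "\<beta>\<^sup>2 < 1" and C: "0 \<le> C"
    and m2: "\<forall>(V :: nat set) (s :: real). finite V \<longrightarrow> s\<^sup>2 * card V \<le> \<beta>\<^sup>2 \<longrightarrow>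
      (\<integral>G. avg2 s V G (\<lambda>\<sigma> \<tau>. (overlap V \<sigma> \<tau>)\<^sup>2) \<partial>gaussian (edges V)) \<le> C * real (card V)"
    and m4: "\<forall>(V :: nat set) (s :: real). finite V \<longrightarrow> s\<^sup>2 * card V \<le> \<beta>\<^sup>2 \<longrightarrow>
      (\<integral>G. avg2 s V G (\<lambda>\<sigma> \<tau>. (overlap V \<sigma> \<tau>) ^ 4) \<partial>gaussian (edges V)) \<le> C * (real (card V))\<^sup>2"
    and ij: "i < n" "j < n"
  shows "integrable M (\<lambda>\<omega>. (residual \<beta> \<omega> i j)\<^sup>2)"
    and "i \<noteq> j \<Longrightarrow> expectation (\<lambda>\<omega>. (residual \<beta> \<omega> i j)\<^sup>2) \<le> 40 * C / (real n)\<^sup>2"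
    and "i = j \<Longrightarrow> expectation (\<lambda>\<omega>. (residual \<beta> \<omega> i j)\<^sup>2) \<le> (8 + 16 * C) / real n"
proof -
  \<comment> \<open>The cavity system has \<open>n - 1\<close> spins while the coupling strength
    stays at \<beta> over the square root of \<open>n\<close>; hence the shift by one in
    \<open>s\<close> below.\<close>
  define V where "V = {..<n} - {i}"
  let ?s = "\<beta> / sqrt n"
  have V: "finite V" "i \<notin> V" "insert i V = {..<n}" using ij by (auto simp: V_def)
  have "card V + 1 = card (insert i V)" using V(1,2) by simp
  then have card: "card V + 1 = n" by (simp add: V(3))
  have s: "?s\<^sup>2 * (card V + 1) = \<beta>\<^sup>2"
    using ij unfolding card by (simp add: power_divide)
  have "?s\<^sup>2 * card V \<le> ?s\<^sup>2 * (card V + 1)" by (intro mult_left_mono) auto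
  then have s': "?s\<^sup>2 * card V \<le> \<beta>\<^sup>2" unfolding s .
  have int: "integrable (gaussian (edges {..<n})) (\<lambda>G. (row_residual \<beta> ?s {..<n} i j G)\<^sup>2)"
    using integrable_row[OF V(1,2), of j \<beta> ?s] ij V(3) by simp
  have eq: "(residual \<beta> \<omega> i j)\<^sup>2 = (row_residual \<beta> ?s {..<n} i j (disorder \<omega>))\<^sup>2" if "\<omega> \<in> space M" for \<omega>
    using residual_eq_row[OF that ij(1)] by simp
  note tr = transfer_disorder[OF int, of "\<lambda>\<omega>. (residual \<beta> \<omega> i j)\<^sup>2", OF eq]
  show "integrable M (\<lambda>\<omega>. (residual \<beta> \<omega> i j)\<^sup>2)" using tr(1) by blast
  show "expectation (\<lambda>\<omega>. (residual \<beta> \<omega> i j)\<^sup>2) \<le> 40 * C / (real n)\<^sup>2" if "i \<noteq> j"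
  proof -
    have "j \<in> V" using that ij by (auto simp: V_def)
    from row_offdiagonal_second_moment[OF V(1,2) this s \<beta> C m2[rule_format, OF V(1) s'] m4[rule_format, OF V(1) s']]
    have "(\<integral>G. (row_residual \<beta> ?s {..<n} i j G)\<^sup>2 \<partial>gaussian (edges {..<n})) \<le> 40 * C / (real n)\<^sup>2"
      unfolding V(3) card by simp
    then show ?thesis using tr(2) by simp
  qed
  show "expectation (\<lambda>\<omega>. (residual \<beta> \<omega> i j)\<^sup>2) \<le> (8 + 16 * C) / real n" if "i = j"
  proof -
    from row_diagonal_second_moment[OF V(1,2) s \<beta> C m2[rule_format, OF V(1) s']]
    have "(\<integral>G. (row_residual \<beta> ?s {..<n} i j G)\<^sup>2 \<partial>gaussian (edges {..<n})) \<le> (8 + 16 * C) / real n"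
      unfolding V(3) card using that by simp
    then show ?thesis using tr(2) by simp
  qed
qed

end

theorem theorem1p3:
  fixes \<beta> :: real
  assumes "0 \<le> \<beta>" and "\<beta> < 1"
  shows
    "(\<exists>C::real. \<forall>n\<ge>1. \<forall>(M :: 'a measure) g. sk_disorder M n g \<longrightarrow>
        (let D = (\<lambda>\<omega>. ((1 + \<beta>\<^sup>2) \<cdot>\<^sub>m 1\<^sub>m n - \<beta> \<cdot>\<^sub>m sk_matrix n (\<lambda>i j. g i j \<omega>))
                        * sk_cov n \<beta> (\<lambda>i j. g i j \<omega>) - 1\<^sub>m n)
         in integrable M (\<lambda>\<omega>. (frobenius_norm (D \<omega>))\<^sup>2)
            \<and> prob_space.expectation M (\<lambda>\<omega>. (frobenius_norm (D \<omega>))\<^sup>2) \<le> C))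
     \<and>
     (\<exists>C::real. \<forall>n\<ge>1. \<forall>(M :: 'a measure) g. sk_disorder M n g \<longrightarrow>
        (\<forall>i<n. \<forall>j<n. i \<noteq> j \<longrightarrow>
          (let X = (\<lambda>\<omega>. (1 + \<beta>\<^sup>2) * sk_avg n \<beta> (\<lambda>i j. g i j \<omega>) (\<lambda>\<sigma>. \<sigma> i * \<sigma> j)
                   - \<beta> / sqrt (real n) *
                     (\<Sum>k<n. g i k \<omega> * sk_avg n \<beta> (\<lambda>i j. g i j \<omega>) (\<lambda>\<sigma>. \<sigma> k * \<sigma> j)))
           in integrable M (\<lambda>\<omega>. (X \<omega>)\<^sup>2)
              \<and> prob_space.expectation M (\<lambda>\<omega>. (X \<omega>)\<^sup>2) \<le> C / (real n)\<^sup>2)))"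
proof -
  have \<beta>: "\<beta>\<^sup>2 < 1" using assms by (simp add: abs_square_less_1)
  obtain C where C: "0 \<le> C"
    and m2: "\<forall>(V :: nat set) (s :: real). finite V \<longrightarrow> s\<^sup>2 * card V \<le> \<beta>\<^sup>2 \<longrightarrow>
      (\<integral>G. avg2 s V G (\<lambda>\<sigma> \<tau>. (overlap V \<sigma> \<tau>)\<^sup>2) \<partial>gaussian (edges V)) \<le> C * real (card V)"
    and m4: "\<forall>(V :: nat set) (s :: real). finite V \<longrightarrow> s\<^sup>2 * card V \<le> \<beta>\<^sup>2 \<longrightarrow>
      (\<integral>G. avg2 s V G (\<lambda>\<sigma> \<tau>. (overlap V \<sigma> \<tau>) ^ 4) \<partial>gaussian (edges V)) \<le> C * (real (card V))\<^sup>2"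
    \<comment> \<open>Applied with \<open>b = \<beta>\<^sup>2\<close>, so the constant is fixed
      before \<open>n\<close>, \<open>M\<close> and \<open>g\<close>.\<close>
    using overlap_moments[OF \<beta>, where 'v = nat] by blast
  show ?thesis
  proof (intro conjI)
    show "\<exists>C::real. \<forall>n\<ge>1. \<forall>(M :: 'a measure) g. sk_disorder M n g \<longrightarrow>
        (let D = (\<lambda>\<omega>. ((1 + \<beta>\<^sup>2) \<cdot>\<^sub>m 1\<^sub>m n - \<beta> \<cdot>\<^sub>m sk_matrix n (\<lambda>i j. g i j \<omega>))
                        * sk_cov n \<beta> (\<lambda>i j. g i j \<omega>) - 1\<^sub>m n)
         in integrable M (\<lambda>\<omega>. (frobenius_norm (D \<omega>))\<^sup>2)
            \<and> prob_space.expectation M (\<lambda>\<omega>. (frobenius_norm (D \<omega>))\<^sup>2) \<le> C)"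
    proof (intro exI allI impI)
      fix n :: nat and M :: "'a measure" and g
      assume n: "1 \<le> n" and "sk_disorder M n g"
      then interpret sk_disorder M n g by simp
      let ?F = "\<lambda>\<omega>. (frobenius_norm (((1 + \<beta>\<^sup>2) \<cdot>\<^sub>m 1\<^sub>m n - \<beta> \<cdot>\<^sub>m sk_matrix n (\<lambda>i j. g i j \<omega>))
                        * sk_cov n \<beta> (\<lambda>i j. g i j \<omega>) - 1\<^sub>m n))\<^sup>2"
      note sm = residual_second_moment[OF \<beta> C m2 m4]
      have int: "integrable M (\<lambda>\<omega>. \<Sum>i<n. \<Sum>j<n. (residual \<beta> \<omega> i j)\<^sup>2)"
        by (intro Bochner_Integration.integrable_sum sm(1)) auto
      have "integrable M ?F"
        using int by (simp add: frobenius_norm_residual cong: Bochner_Integration.integrable_cong)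
      moreover have "expectation ?F \<le> 40 * C + (8 + 16 * C)"
      proof -
        have "expectation ?F = expectation (\<lambda>\<omega>. \<Sum>i<n. \<Sum>j<n. (residual \<beta> \<omega> i j)\<^sup>2)"
          by (intro Bochner_Integration.integral_cong) (simp_all add: frobenius_norm_residual)
        also have "\<dots> = (\<Sum>i<n. \<Sum>j<n. expectation (\<lambda>\<omega>. (residual \<beta> \<omega> i j)\<^sup>2))"
        proof -
          have "expectation (\<lambda>\<omega>. \<Sum>i<n. \<Sum>j<n. (residual \<beta> \<omega> i j)\<^sup>2)
            = (\<Sum>i<n. expectation (\<lambda>\<omega>. \<Sum>j<n. (residual \<beta> \<omega> i j)\<^sup>2))"
            by (intro Bochner_Integration.integral_sum Bochner_Integration.integrable_sum sm(1)) auto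
          also have "\<dots> = (\<Sum>i<n. \<Sum>j<n. expectation (\<lambda>\<omega>. (residual \<beta> \<omega> i j)\<^sup>2))"
            by (intro sum.cong refl Bochner_Integration.integral_sum sm(1)) auto
          finally show ?thesis .
        qed
        \<comment> \<open>The off-diagonal bound is charged to all pairs, diagonal ones included, so
          that the double sum evaluates to \<open>40 * C\<close> plus n times the diagonal
          bound.\<close>
        also have "\<dots> \<le> (\<Sum>i<n. \<Sum>j<n. 40 * C / (real n)\<^sup>2 + (if i = j then (8 + 16 * C) / real n else 0))"
        proof (intro sum_mono)
          fix i j assume "i \<in> {..<n}" "j \<in> {..<n}"
          then show "expectation (\<lambda>\<omega>. (residual \<beta> \<omega> i j)\<^sup>2)
            \<le> 40 * C / (real n)\<^sup>2 + (if i = j then (8 + 16 * C) / real n else 0)"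
            using sm(2)[of i j] sm(3)[of i j] C by (cases "i = j") (simp_all add: add_increasing)
        qed
        also have "\<dots> = 40 * C + (8 + 16 * C)"
          using n by (simp add: sum.distrib power2_eq_square distrib_left add_divide_distrib)
        finally show ?thesis .
      qed
      ultimately show "let D = (\<lambda>\<omega>. ((1 + \<beta>\<^sup>2) \<cdot>\<^sub>m 1\<^sub>m n - \<beta> \<cdot>\<^sub>m sk_matrix n (\<lambda>i j. g i j \<omega>))
                        * sk_cov n \<beta> (\<lambda>i j. g i j \<omega>) - 1\<^sub>m n)
         in integrable M (\<lambda>\<omega>. (frobenius_norm (D \<omega>))\<^sup>2)
            \<and> expectation (\<lambda>\<omega>. (frobenius_norm (D \<omega>))\<^sup>2) \<le> 40 * C + (8 + 16 * C)"
        by simp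
    qed
    show "\<exists>C::real. \<forall>n\<ge>1. \<forall>(M :: 'a measure) g. sk_disorder M n g \<longrightarrow>
        (\<forall>i<n. \<forall>j<n. i \<noteq> j \<longrightarrow>
          (let X = (\<lambda>\<omega>. (1 + \<beta>\<^sup>2) * sk_avg n \<beta> (\<lambda>i j. g i j \<omega>) (\<lambda>\<sigma>. \<sigma> i * \<sigma> j)
                   - \<beta> / sqrt (real n) *
                     (\<Sum>k<n. g i k \<omega> * sk_avg n \<beta> (\<lambda>i j. g i j \<omega>) (\<lambda>\<sigma>. \<sigma> k * \<sigma> j)))
           in integrable M (\<lambda>\<omega>. (X \<omega>)\<^sup>2)
              \<and> prob_space.expectation M (\<lambda>\<omega>. (X \<omega>)\<^sup>2) \<le> C / (real n)\<^sup>2))"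
    proof (intro exI allI impI)
      fix n :: nat and M :: "'a measure" and g and i j :: nat
      assume "sk_disorder M n g" and ij: "i < n" "j < n" "i \<noteq> j"
      then interpret sk_disorder M n g by simp
      note sm = residual_second_moment[OF \<beta> C m2 m4 ij(1,2)]
      show "let X = (\<lambda>\<omega>. (1 + \<beta>\<^sup>2) * sk_avg n \<beta> (\<lambda>i j. g i j \<omega>) (\<lambda>\<sigma>. \<sigma> i * \<sigma> j)
                   - \<beta> / sqrt (real n) *
                     (\<Sum>k<n. g i k \<omega> * sk_avg n \<beta> (\<lambda>i j. g i j \<omega>) (\<lambda>\<sigma>. \<sigma> k * \<sigma> j)))
           in integrable M (\<lambda>\<omega>. (X \<omega>)\<^sup>2) \<and> expectation (\<lambda>\<omega>. (X \<omega>)\<^sup>2) \<le> 40 * C / (real n)\<^sup>2"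
        using sm(1) sm(2)[OF ij(3)] ij(3) by (simp add: residual_def)
    qed
  qed
qed

end
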